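(* Let $n\ge1$, let $C\subset T=\mathbb R^{n+1}/\pi\mathbb Z^{n+1}$ be the standard $(n+1)$-dimensional Lagrangian coamoeba, $\pi:\tilde C\to C$ its real blow up at its vertices, and $F:C\to\mathbb R$ the function defined in the context. Then $\mathbf h=(F_{y_1},\dots,F_{y_{n+1}})$, defined on $C$ minus its vertices, extends smoothly to a map $\mathbf h:\tilde C\to\mathbb R^{n+1}$, and the map $\Phi:\tilde C\to T^*T=\mathbb R^{n+1}\times T$, $\Phi(q)=(\mathbf h(q),\pi(q))$, is a Lagrangian embedding of $\tilde C$.
   Context: $T=\mathbb R^{n+1}/\pi\mathbb Z^{n+1}$ has coordinates $y=(y_1,\dots,y_{n+1})$, and $T^*T=\mathbb R^{n+1}\times T$ has coordinates $(x,y)$ and symplectic form $\omega=\frac1\pi\sum_{i=1}^{n+1}dx_i\wedge dy_i$. Coamoeba. Let $p_0=0$ and $p_k=\frac\pi2 e_k$ ($k=1,\dots,n+1$), $e_k$ the standard basis. $C^+\subset T$ is the set of points represented by a vertex or an interior point of the simplex with vertices $p_0,\dots,p_{n+1}$; $C^-$ is the image of $C^+$ under $[y]\mapsto[-y]$; $C=C^+\cup C^-$. The $p_k$ are the vertices of $C$. Blow up. For a vertex $p$ and a small neighborhood $U_p\subset C$ of $p$ let $\tilde U_p=\{(q,\ell): q\in U_p,\ q-p\in\ell\}$, where $\ell$ ranges over the lines through the origin of $\mathbb R^{n+1}$ (points of $\mathbb{RP}^n$) spanned by a vector pointing from $p$ into the interior of the simplex. Near $p_0$, coordinates on it are $(\alpha_1,\dots,\alpha_n,t)$,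 $\alpha_j>0$, $t\in\mathbb R$ small, with $\pi(\alpha,t)=(t\alpha_1,\dots,t\alpha_n,t)$; similarly at the other vertices after an affine change of coordinates. $\tilde C$ is the smooth manifold obtained by gluing the $\tilde U_p$ to $C\setminus\{p_0,\dots,p_{n+1}\}$ for all vertices $p$, with projection $\pi:\tilde C\to C$; the complement of $\bigcup_j\pi^{-1}(p_j)$ is identified with $C\setminus\{p_0,\dots,p_{n+1}\}$. Function. $F(y)=\big(\cos(\sum_{j=1}^{n+1}y_j)\prod_{j=1}^{n+1}\sin y_j\big)^{1/(n+1)}$ on $C^+$ and $F(y)=(-1)^n\big(\cos(\sum_j y_j)\prod_j\sin y_j\big)^{1/(n+1)}$ on $C^-$ (real roots, the nonnegative one if $n+1$ is even); so $F(-y)=-F(y)$. $F_{y_j}$ is the partial derivative in $y_j$. *)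

theory Defs
  imports "HOL-Analysis.Analysis"
begin

text \<open>All uses below are on open sets of Euclidean spaces. There, requiring all iterated
  directional derivatives to exist and to be differentiable is the usual notion of
  \<open>C\<close>-infinity.\<close>

primrec Ck_on :: "nat \<Rightarrow> 'a set \<Rightarrow> ('a::real_normed_vector \<Rightarrow> 'b::real_normed_vector) \<Rightarrow> bool" where
  "Ck_on 0 S f \<longleftrightarrow> continuous_on S f"
| "Ck_on (Suc k) S f \<longleftrightarrow>
     (\<forall>x\<in>S. f differentiable (at x)) \<and> (\<forall>v. Ck_on k S (\<lambda>x. frechet_derivative f (at x) v))"

definition smooth_on :: "'a set \<Rightarrow> ('a::real_normed_vector \<Rightarrow> 'b::real_normed_vector) \<Rightarrow> bool" where
  "smooth_on S f \<longleftrightarrow> (\<forall>k. Ck_on k S f)"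

text \<open>A chart is a pair of its domain and its coordinate map. An atlas determines the underlying
  set of the manifold (the union of the chart domains) and its topology (a set is open iff all its
  coordinate images are open).\<close>

type_synonym ('p, 'e) chart = "'p set \<times> ('p \<Rightarrow> 'e)"

definition atlas_topology :: "('p, 'e::euclidean_space) chart set \<Rightarrow> 'p topology" where
  "atlas_topology A =
     topology (\<lambda>W. W \<subseteq> (\<Union>(U, \<phi>)\<in>A. U) \<and> (\<forall>(U, \<phi>)\<in>A. open (\<phi> ` (W \<inter> U))))"

definition smooth_manifold :: "('p, 'e::euclidean_space) chart set \<Rightarrow> bool" where
  "smooth_manifold A \<longleftrightarrow>
     (\<forall>(U, \<phi>)\<in>A. inj_on \<phi> U \<and> open (\<phi> ` U)) \<and>
     (\<forall>(U, \<phi>)\<in>A. \<forall>(V, \<psi>)\<in>A.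
        open (\<phi> ` (U \<inter> V)) \<and> smooth_on (\<phi> ` (U \<inter> V)) (\<psi> \<circ> inv_into U \<phi>)) \<and>
     Hausdorff_space (atlas_topology A) \<and> second_countable (atlas_topology A)"

definition smooth_map ::
    "('p, 'e::euclidean_space) chart set \<Rightarrow> ('q, 'f::euclidean_space) chart set \<Rightarrow> ('p \<Rightarrow> 'q) \<Rightarrow> bool" where
  "smooth_map A B f \<longleftrightarrow>
     continuous_map (atlas_topology A) (atlas_topology B) f \<and>
     (\<forall>(U, \<phi>)\<in>A. \<forall>(V, \<psi>)\<in>B. smooth_on (\<phi> ` (U \<inter> f -` V)) (\<psi> \<circ> f \<circ> inv_into U \<phi>))"

definition immersion ::
    "('p, 'e::euclidean_space) chart set \<Rightarrow> ('q, 'f::euclidean_space) chart set \<Rightarrow> ('p \<Rightarrow> 'q) \<Rightarrow> bool" where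
  "immersion A B f \<longleftrightarrow> smooth_map A B f \<and>
     (\<forall>(U, \<phi>)\<in>A. \<forall>(V, \<psi>)\<in>B. \<forall>x \<in> \<phi> ` (U \<inter> f -` V).
        inj (frechet_derivative (\<psi> \<circ> f \<circ> inv_into U \<phi>) (at x)))"

definition smooth_embedding ::
    "('p, 'e::euclidean_space) chart set \<Rightarrow> ('q, 'f::euclidean_space) chart set \<Rightarrow> ('p \<Rightarrow> 'q) \<Rightarrow> bool" where
  "smooth_embedding A B f \<longleftrightarrow> smooth_manifold A \<and> smooth_manifold B \<and> immersion A B f \<and>
     embedding_map (atlas_topology A) (atlas_topology B) f"

text \<open>\<open>\<omega>\<close> is a 2-form on the manifold \<open>B\<close> having the same constant-coefficient expression \<open>\<omega>\<close> in
  every chart of \<open>B\<close>. This is meaningful if the derivatives of the coordinate changes of \<open>B\<close>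
  preserve \<open>\<omega>\<close>; for the atlas of the cotangent bundle of the torus below, the coordinate changes
  are locally translations.\<close>

definition lagrangian_embedding ::
    "('p, 'e::euclidean_space) chart set \<Rightarrow> ('q, 'f::euclidean_space) chart set \<Rightarrow>
     ('f \<Rightarrow> 'f \<Rightarrow> real) \<Rightarrow> ('p \<Rightarrow> 'q) \<Rightarrow> bool" where
  "lagrangian_embedding A B \<omega> f \<longleftrightarrow>
     smooth_embedding A B f \<and> 2 * DIM('e) = DIM('f) \<and>
     (\<forall>(U, \<phi>)\<in>A. \<forall>(V, \<psi>)\<in>B. \<forall>x \<in> \<phi> ` (U \<inter> f -` V). \<forall>u v.
        \<omega> (frechet_derivative (\<psi> \<circ> f \<circ> inv_into U \<phi>) (at x) u)
          (frechet_derivative (\<psi> \<circ> f \<circ> inv_into U \<phi>) (at x) v) = 0)"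

definition euclidean_atlas :: "('e::euclidean_space, 'e) chart set" where
  "euclidean_atlas = {(UNIV, id)}"

definition torus_rel :: "real^'m \<Rightarrow> real^'m \<Rightarrow> bool" where
  "torus_rel x y \<longleftrightarrow> (\<forall>i. \<exists>k::int. y $ i = x $ i + pi * of_int k)"

quotient_type (overloaded) 'm torus = "real^('m::finite)" / torus_rel
  morphisms torus_rep torus_proj
proof (rule equivpI)
  show "reflp (torus_rel :: real^'m \<Rightarrow> _)"
    by (auto simp: reflp_def torus_rel_def intro: exI[of _ 0])
  show "symp (torus_rel :: real^'m \<Rightarrow> _)"
  proof (rule sympI)
    fix x y :: "real^'m"
    assume *: "torus_rel x y"
    show "torus_rel y x" unfolding torus_rel_def
    proof
      fix i
      obtain k :: int where "y $ i = x $ i + pi * of_int k"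
        using * unfolding torus_rel_def by blast
      then have "x $ i = y $ i + pi * of_int (- k)" by simp
      then show "\<exists>k::int. x $ i = y $ i + pi * of_int k" by blast
    qed
  qed
  show "transp (torus_rel :: real^'m \<Rightarrow> _)"
  proof (rule transpI)
    fix x y z :: "real^'m"
    assume *: "torus_rel x y" "torus_rel y z"
    show "torus_rel x z" unfolding torus_rel_def
    proof
      fix i
      obtain k l :: int where "y $ i = x $ i + pi * of_int k" "z $ i = y $ i + pi * of_int l"
        using * unfolding torus_rel_def by blast
      then have "z $ i = x $ i + pi * of_int (k + l)" by (simp add: algebra_simps)
      then show "\<exists>k::int. z $ i = x $ i + pi * of_int k" by blast
    qed
  qed
qed

text \<open>Two points of a ball of radius \<open>\<pi>/2\<close> have distance less than \<open>\<pi>\<close>, so the projection is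
  injective there. The charts are its local inverses.\<close>

definition torus_atlas :: "('m::finite torus, real^'m) chart set" where
  "torus_atlas =
     (\<lambda>c. (torus_proj ` ball c (pi/2), inv_into (ball c (pi/2)) torus_proj)) ` UNIV"

definition cotangent_atlas :: "((real^'m) \<times> ('m::finite torus), (real^'m) \<times> (real^'m)) chart set" where
  "cotangent_atlas = (\<lambda>(U, \<phi>). (UNIV \<times> U, \<lambda>(x, q). (x, \<phi> q))) ` torus_atlas"

definition cotangent_omega :: "(real^'m) \<times> (real^('m::finite)) \<Rightarrow> (real^'m) \<times> (real^'m) \<Rightarrow> real" where
  "cotangent_omega u v = 1 / pi * (\<Sum>i\<in>UNIV. fst u $ i * snd v $ i - fst v $ i * snd u $ i)"

lift_definition torus_neg :: "'m::finite torus \<Rightarrow> 'm torus" is uminus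
proof -
  fix x y :: "real^'m"
  assume *: "torus_rel x y"
  show "torus_rel (- x) (- y)" unfolding torus_rel_def
  proof
    fix i
    obtain k :: int where "y $ i = x $ i + pi * of_int k"
      using * unfolding torus_rel_def by blast
    then have "(- y) $ i = (- x) $ i + pi * of_int (- k)" by simp
    then show "\<exists>k::int. (- y) $ i = (- x) $ i + pi * of_int k" by blast
  qed
qed

text \<open>The vertices are indexed by \<open>'m option\<close>: \<open>None\<close> for \<open>p\<^sub>0\<close>, and \<open>Some i\<close> for the
  vertex on the coordinate axis \<open>i\<close>.\<close>

definition vertex :: "'m option \<Rightarrow> real^('m::finite)" where
  "vertex k = (case k of None \<Rightarrow> 0 | Some i \<Rightarrow> (pi/2) *\<^sub>R axis i 1)"

definition simplex_interior :: "(real^('m::finite)) set" where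
  "simplex_interior = interior (convex hull (range vertex))"

definition coamoeba_vertices :: "'m::finite torus set" where
  "coamoeba_vertices = torus_proj ` range vertex"

definition coamoeba_plus :: "'m::finite torus set" where
  "coamoeba_plus = torus_proj ` (range vertex \<union> simplex_interior)"

definition coamoeba_minus :: "'m::finite torus set" where
  "coamoeba_minus = torus_neg ` coamoeba_plus"

definition coamoeba :: "'m::finite torus set" where
  "coamoeba = coamoeba_plus \<union> coamoeba_minus"

lemma cos_sin_pi_sum:
  assumes "finite I"
  shows "cos (\<Sum>i\<in>I. pi * of_int (k i)) = (\<Prod>i\<in>I. cos (pi * of_int (k i)))
       \<and> sin (\<Sum>i\<in>I. pi * of_int (k i)) = (0::real)"
  using assms by (induction I) (auto simp: cos_add sin_add sin_int_times_real mult.commute)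

lift_definition cos_sum_prod_sin :: "'m::finite torus \<Rightarrow> real"
  is "\<lambda>y. cos (\<Sum>i\<in>UNIV. y $ i) * (\<Prod>i\<in>UNIV. sin (y $ i))"
proof -
  fix x y :: "real^'m"
  assume "torus_rel x y"
  then obtain k :: "'m \<Rightarrow> int" where k: "\<And>i. y $ i = x $ i + pi * of_int (k i)"
    unfolding torus_rel_def by metis
  let ?c = "\<Prod>i\<in>UNIV. cos (pi * of_int (k i))"
  have s: "sin (pi * of_int j) = 0" for j :: int
    by (simp add: sin_int_times_real mult.commute)
  have c: "cos (pi * of_int j) * cos (pi * of_int j) = 1" for j :: int
    using sin_cos_squared_add3[of "pi * of_int j"] s[of j] by simp
  have 1: "cos (\<Sum>i\<in>UNIV. y $ i) = cos (\<Sum>i\<in>UNIV. x $ i) * ?c"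
    unfolding k sum.distrib cos_add
    using cos_sin_pi_sum[of UNIV k] by simp
  have 2: "(\<Prod>i\<in>UNIV. sin (y $ i)) = (\<Prod>i\<in>UNIV. sin (x $ i)) * ?c"
    unfolding k sin_add s by (simp add: prod.distrib)
  have "?c * ?c = 1"
    unfolding prod.distrib[symmetric] c by simp
  then show "cos (\<Sum>i\<in>UNIV. x $ i) * (\<Prod>i\<in>UNIV. sin (x $ i)) =
        cos (\<Sum>i\<in>UNIV. y $ i) * (\<Prod>i\<in>UNIV. sin (y $ i))"
    unfolding 1 2 by (simp add: algebra_simps)
qed

text \<open>Here \<open>CARD('m) = n + 1\<close>. The two parts of the coamoeba meet only in the vertices, where both
  formulas give 0. Only the values on the coamoeba are meaningful. There the radicand is nonnegative
  if \<open>n + 1\<close> is even, so \<open>root\<close> is the real root intended.\<close>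

definition coamoeba_fun :: "'m::finite torus \<Rightarrow> real" where
  "coamoeba_fun q = (if q \<in> coamoeba_plus then root CARD('m) (cos_sum_prod_sin q)
          else (-1) ^ (CARD('m) - 1) * root CARD('m) (cos_sum_prod_sin q))"

definition vertex_lines :: "'m option \<Rightarrow> (real^('m::finite)) set set" where
  "vertex_lines k = (\<lambda>x. span {x - vertex k}) ` simplex_interior"

text \<open>The neighbourhood of a vertex consists of the points of the coamoeba at distance less than
  \<open>\<pi>/4\<close> from it. The difference of such a point and the vertex is understood to be its unique
  representative of norm less than \<open>\<pi>/4\<close>.\<close>

definition blowup_nbhd :: "'m option \<Rightarrow> ('m::finite torus \<times> (real^'m) set) set" where
  "blowup_nbhd k = {(q, l). q \<in> coamoeba \<and> l \<in> vertex_lines k \<and>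
      (\<exists>v. norm v < pi/4 \<and> q = torus_proj (vertex k + v) \<and> v \<in> l)}"

text \<open>Points of the glued manifold: points of the coamoeba other than the vertices, and pairs of a
  vertex (given by its index) and a line.\<close>

datatype 'm blowup_point = Away "('m::finite) torus" | Over "'m option" "(real^'m) set"

fun blowup_proj :: "'m::finite blowup_point \<Rightarrow> 'm torus" where
  "blowup_proj (Away q) = q"
| "blowup_proj (Over k l) = torus_proj (vertex k)"

definition glue :: "'m option \<Rightarrow> ('m::finite torus \<times> (real^'m) set) \<Rightarrow> 'm blowup_point" where
  "glue k = (\<lambda>(q, l). if q = torus_proj (vertex k) then Over k l else Away q)"

text \<open>This is the linear part of the affine involution that permutes the vertices of the simplex,
  exchanging vertex \<open>k\<close> with the origin and fixing the others: for \<open>k = Some i\<close> it replaces the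
  coordinate \<open>y $ i\<close> by \<open>\<pi>/2\<close> minus the sum of all coordinates of \<open>y\<close>. It carries the cone of
  the simplex at vertex \<open>k\<close> to the positive orthant, and conversely.\<close>

definition swap_linear :: "'m option \<Rightarrow> real^'m \<Rightarrow> real^('m::finite)" where
  "swap_linear k v = (case k of None \<Rightarrow> v
     | Some i \<Rightarrow> (\<chi> j. if j = i then - (\<Sum>l\<in>UNIV. v $ l) else v $ j))"

text \<open>From here on the torus has dimension \<open>n + 1\<close> with index type \<open>'n option\<close>, \<open>CARD('n) = n\<close>, the index
  \<open>None\<close> standing for the last coordinate. A point \<open>a\<close> of the coordinate space has
  \<open>\<alpha>\<^sub>j = a $ Some j\<close> and \<open>t = a $ None\<close>.\<close>

definition chart_dir :: "real^('n::finite option) \<Rightarrow> real^('n option)" where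
  "chart_dir a = (\<chi> i. case i of None \<Rightarrow> 1 | Some j \<Rightarrow> a $ Some j)"

definition chart_param ::
    "'n option option \<Rightarrow> real^('n::finite option) \<Rightarrow> 'n option torus \<times> (real^('n option)) set" where
  "chart_param k a =
     (torus_proj (vertex k + a $ None *\<^sub>R swap_linear k (chart_dir a)),
      span {swap_linear k (chart_dir a)})"

definition chart_param_domain :: "'n option option \<Rightarrow> (real^('n::finite option)) set" where
  "chart_param_domain k = {a. (\<forall>j. a $ Some j > 0) \<and>
      norm (a $ None *\<^sub>R swap_linear k (chart_dir a)) < pi/4 \<and> chart_param k a \<in> blowup_nbhd k}"

text \<open>The charts of the first kind are those of the open subset of the torus obtained by removing
  the vertices from the coamoeba. Those of the second kind are the coordinates
  \<open>(\<alpha>, t)\<close> around the exceptional divisors. The union of their domains is the blow up.\<close>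

definition blowup_atlas :: "('n::finite option blowup_point, real^('n option)) chart set" where
  "blowup_atlas =
     (\<lambda>(U, \<phi>). (Away ` (U \<inter> (coamoeba - coamoeba_vertices)), \<phi> \<circ> blowup_proj)) ` torus_atlas \<union>
     (\<lambda>k. (glue k ` blowup_nbhd k, inv_into (chart_param_domain k) (glue k \<circ> chart_param k))) ` UNIV"

end

theory Submission
  imports Defs
begin

text \<open>On the open simplex \<open>F\<close> has gradient \<open>F / m\<close> times \<open>cot y\<^sub>j - tan (\<Sum> y)\<close>, \<open>m = n + 1\<close>. The affine
  involutions exchanging a vertex with the origin preserve \<open>F\<close>, so it suffices to look at the
  origin, where \<open>y = t d\<close> with \<open>d = (\<alpha>, 1)\<close>. Replacing \<open>sin (t d\<^sub>j)\<close> by \<open>t d\<^sub>j sinc (t d\<^sub>j)\<close> makes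
  \<open>F\<close> equal to \<open>t\<close> times a function that is smooth and positive for all small \<open>t\<close>, and the gradient
  smooth in \<open>(\<alpha>, t)\<close> and even in \<open>t\<close>.

  Conversely \<open>(\<alpha>, t)\<close> is a smooth function of the gradient and of \<open>y\<close>, since \<open>t = y\<^sub>m\<close> and \<open>\<alpha>\<^sub>j\<close> is
  the quotient \<open>h\<^sub>m / h\<^sub>j\<close> up to factors that are smooth in \<open>y\<close>. Local smooth left inverses of this kind,
  defined on open subsets of the cotangent bundle, yield at once the smoothness of the coordinate
  changes, the Hausdorff property, injectivity, immersivity and the embedding property. The map
  is isotropic away from the exceptional divisors because the Hessian is symmetric, and on them by
  continuity.\<close>

section \<open>Calculus of smooth maps\<close>


text \<open>The exponent \<open>1/m\<close> makes the extension possible: near a vertex the radicand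
  is \<open>t^m\<close> times a positive smooth factor, so \<open>F\<close> vanishes to first order
  and its gradient stays bounded, with components proportional to \<open>1/d_j\<close> at
  \<open>t = 0\<close>. The ratios of these components remember the line. The base point does not,
  since a whole divisor lies over a single vertex; so the left inverses must use the gradient there,
  while off the divisors the base point is enough.

  A chart crosses its divisor into the reflected half of the coamoeba. This works because twice a
  vertex is a lattice vector, so that \<open>[y] \<mapsto> [-y]\<close> is the point reflection in
  every vertex, and because \<open>F\<close> is odd, so that its gradient agrees at opposite points.

  Cotangent charts involve a choice of representatives, hence maps into the bundle are handled
  through lifts to its universal covering. A left inverse has to identify every point of the
  manifold with the given image, not only those of one chart. The same general argument then serves
  the blow up and, with the identity map, the cotangent bundle itself.\<close>

lemma Ck_on_subset: "Ck_on k S f \<Longrightarrow> T \<subseteq> S \<Longrightarrow> Ck_on k T f"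
  by (induction k arbitrary: f) (auto intro: continuous_on_subset)

text \<open>The derivative of \<open>f\<close> agrees with \<open>f'\<close> only on
  \<open>S\<close>, so passing from one to the other takes a congruence rule at level
  \<open>k\<close>. It is a hypothesis here because that rule is itself proved by induction with the
  present lemma.\<close>

lemma Ck_on_SucI:
  fixes f :: "'a::real_normed_vector \<Rightarrow> 'b::real_normed_vector"
  assumes "open S" and d: "\<And>x. x \<in> S \<Longrightarrow> (f has_derivative f' x) (at x)"
    and c: "\<And>v. Ck_on k S (\<lambda>x. f' x v)"
    and cong: "\<And>f g :: 'a \<Rightarrow> 'b. (\<And>x. x \<in> S \<Longrightarrow> f x = g x) \<Longrightarrow> Ck_on k S f \<Longrightarrow> Ck_on k S g"
  shows "Ck_on (Suc k) S f"
proof -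
  have "Ck_on k S (\<lambda>x. frechet_derivative f (at x) v)" for v
    by (rule cong[OF _ c[of v]]) (use d frechet_derivative_at in metis)
  then show ?thesis
    using d by (auto simp: differentiable_def)
qed

lemma Ck_on_cong:
  fixes f g :: "'a::real_normed_vector \<Rightarrow> 'b::real_normed_vector"
  assumes "open S" "\<And>x. x \<in> S \<Longrightarrow> f x = g x" "Ck_on k S f"
  shows "Ck_on k S g"
  using assms(2,3)
proof (induction k arbitrary: f g)
  case 0
  then show ?case by (simp cong: continuous_on_cong)
next
  case (Suc k)
  have d: "(g has_derivative frechet_derivative f (at x)) (at x)" if "x \<in> S" for x
  proof (rule has_derivative_transform_within_open[OF _ \<open>open S\<close> that])
    show "(f has_derivative frechet_derivative f (at x)) (at x)"
      using Suc.prems(2) that by (simp add: frechet_derivative_works)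
  qed (rule Suc.prems(1))
  show ?case
    by (rule Ck_on_SucI[OF \<open>open S\<close> d]) (use Suc in auto)
qed

lemma Ck_on_SucI':
  assumes "open S" "\<And>x. x \<in> S \<Longrightarrow> (f has_derivative f' x) (at x)"
    and "\<And>v. Ck_on k S (\<lambda>x. f' x v)"
  shows "Ck_on (Suc k) S f"
  using Ck_on_SucI[OF assms] Ck_on_cong[OF \<open>open S\<close>] by blast

lemma Ck_on_Suc_has_derivative:
  "Ck_on (Suc k) S f \<Longrightarrow> x \<in> S \<Longrightarrow> (f has_derivative frechet_derivative f (at x)) (at x)"
  by (simp add: frechet_derivative_works)

lemma Ck_on_SucD: "Ck_on (Suc k) S f \<Longrightarrow> Ck_on k S f"
proof (induction k arbitrary: f)
  case 0
  then show ?case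
    by (auto intro!: differentiable_imp_continuous_on simp: differentiable_on_def
        intro: differentiable_at_imp_differentiable_on)
next
  case (Suc k)
  then show ?case by simp
qed

lemma Ck_on_local:
  assumes "\<And>x. x \<in> S \<Longrightarrow> \<exists>N. open N \<and> x \<in> N \<and> Ck_on k N f"
  shows "Ck_on k S f"
  using assms
proof (induction k arbitrary: f)
  case 0
  show ?case
    unfolding Ck_on.simps
  proof (rule continuous_at_imp_continuous_on, rule ballI)
    fix x assume "x \<in> S"
    then obtain N where "open N" "x \<in> N" "continuous_on N f" using 0 by auto
    then show "isCont f x" by (simp add: continuous_on_eq_continuous_at)
  qed
next
  case (Suc k)
  show ?case
    unfolding Ck_on.simps
  proof (intro conjI ballI allI)
    show "f differentiable at x" if "x \<in> S" for x using Suc.prems[OF that] by auto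
    show "Ck_on k S (\<lambda>x. frechet_derivative f (at x) v)" for v
    proof (rule Suc.IH)
      fix x assume "x \<in> S"
      then show "\<exists>N. open N \<and> x \<in> N \<and> Ck_on k N (\<lambda>x. frechet_derivative f (at x) v)"
        using Suc.prems[of x] by auto
    qed
  qed
qed

lemma Ck_on_const: "open S \<Longrightarrow> Ck_on k S (\<lambda>x. c)"
proof (induction k arbitrary: c)
  case (Suc k)
  show ?case by (rule Ck_on_SucI'[OF Suc.prems has_derivative_const]) (use Suc in simp)
qed simp

lemma Ck_on_bounded_linear:
  assumes "bounded_linear l" "open S" "Ck_on k S f"
  shows "Ck_on k S (\<lambda>x. l (f x))"
  using assms(3)
proof (induction k arbitrary: f)
  case 0
  then show ?case by (simp add: bounded_linear.continuous_on[OF assms(1)])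
next
  case (Suc k)
  show ?case
    by (rule Ck_on_SucI'[OF \<open>open S\<close>
          bounded_linear.has_derivative[OF assms(1) Ck_on_Suc_has_derivative[OF Suc.prems]]])
      (use Suc in auto)
qed

lemma Ck_on_id: "open S \<Longrightarrow> Ck_on k S (\<lambda>x. x)"
proof (cases k)
  case (Suc l)
  assume "open S"
  then show ?thesis
    unfolding Suc by (intro Ck_on_SucI'[OF _ has_derivative_ident] Ck_on_const)
qed simp

lemma Ck_on_add:
  assumes "open S" "Ck_on k S f" "Ck_on k S g"
  shows "Ck_on k S (\<lambda>x. f x + g x)"
  using assms(2,3)
proof (induction k arbitrary: f g)
  case 0
  then show ?case by (simp add: continuous_on_add)
next
  case (Suc k)
  show ?case
    by (rule Ck_on_SucI'[OF \<open>open S\<close>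
          has_derivative_add[OF Suc.prems[THEN Ck_on_Suc_has_derivative]]])
      (use Suc in auto)
qed

lemma Ck_on_bounded_bilinear:
  assumes "bounded_bilinear p" "open S" "Ck_on k S f" "Ck_on k S g"
  shows "Ck_on k S (\<lambda>x. p (f x) (g x))"
  using assms(3,4)
proof (induction k arbitrary: f g)
  case 0
  then show ?case by (simp add: bounded_bilinear.continuous_on[OF assms(1)])
next
  case (Suc k)
  note fg = Suc.prems[THEN Ck_on_SucD] and d = Suc.prems[THEN Ck_on_Suc_has_derivative]
  show ?case
    by (rule Ck_on_SucI'[OF \<open>open S\<close> bounded_bilinear.FDERIV[OF assms(1) d]])
      (use Suc fg in \<open>auto intro!: Ck_on_add[OF \<open>open S\<close>]\<close>)
qed

lemma Ck_on_sum:
  assumes "open S" "\<And>i. i \<in> I \<Longrightarrow> Ck_on k S (f i)"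
  shows "Ck_on k S (\<lambda>x. \<Sum>i\<in>I. f i x)"
  using assms(2)
  by (induction I rule: infinite_finite_induct) (auto intro: Ck_on_const Ck_on_add \<open>open S\<close>)

text \<open>The direction \<open>D f x v\<close> in which the outer function is differentiated depends on \<open>x\<close>, hence
  the expansion in a basis.\<close>

lemma Ck_on_compose:
  fixes f :: "'a::real_normed_vector \<Rightarrow> 'b::euclidean_space"
  assumes "open S" "open T" "f ` S \<subseteq> T" "Ck_on k S f" "Ck_on k T g"
  shows "Ck_on k S (\<lambda>x. g (f x))"
  using assms(4,5)
proof (induction k arbitrary: g)
  case 0
  then show ?case
    using continuous_on_compose2[OF _ _ \<open>f ` S \<subseteq> T\<close>] by auto
next
  case (Suc k)
  let ?f' = "\<lambda>x. frechet_derivative f (at x)" and ?g' = "\<lambda>x. frechet_derivative g (at x)"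
  have f: "(f has_derivative ?f' x) (at x)" if "x \<in> S" for x
    using Ck_on_Suc_has_derivative[OF Suc.prems(1) that] .
  have g: "(g has_derivative ?g' (f x)) (at (f x))" if "x \<in> S" for x
    using Ck_on_Suc_has_derivative[OF Suc.prems(2)] that \<open>f ` S \<subseteq> T\<close> by blast
  have d: "((\<lambda>x. g (f x)) has_derivative (\<lambda>v. \<Sum>b\<in>Basis. (?f' x v \<bullet> b) *\<^sub>R ?g' (f x) b)) (at x)"
    if "x \<in> S" for x
  proof -
    have l: "linear (?g' (f x))" using g[OF that] by (rule has_derivative_linear)
    have "?g' (f x) w = (\<Sum>b\<in>Basis. (w \<bullet> b) *\<^sub>R ?g' (f x) b)" for w
      by (subst (1) euclidean_representation[of w, symmetric])
        (simp only: linear_sum[OF l] linear_scale[OF l])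
    from this[of "?f' x v" for v] show ?thesis
      using has_derivative_compose[OF f[OF that] g[OF that]] by simp
  qed
  have fk: "Ck_on k S f" by (rule Ck_on_SucD[OF Suc.prems(1)])
  show ?case
  proof (rule Ck_on_SucI'[OF \<open>open S\<close> d])
    fix v
    have 1: "Ck_on k S (\<lambda>x. ?f' x v \<bullet> b)" for b
      using Suc.prems(1) by (intro Ck_on_bounded_linear[OF bounded_linear_inner_left \<open>open S\<close>]) simp
    have 2: "Ck_on k S (\<lambda>x. ?g' (f x) b)" for b
      using Suc.prems(2) by (intro Suc.IH fk) simp
    show "Ck_on k S (\<lambda>x. \<Sum>b\<in>Basis. (?f' x v \<bullet> b) *\<^sub>R ?g' (f x) b)"
      by (intro Ck_on_sum Ck_on_bounded_bilinear[OF bounded_bilinear_scaleR] 1 2 \<open>open S\<close>)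
  qed assumption
qed

section \<open>Closure properties of smooth maps\<close>

lemma smooth_on_subset: "smooth_on S f \<Longrightarrow> T \<subseteq> S \<Longrightarrow> smooth_on T f"
  by (simp add: smooth_on_def Ck_on_subset[of _ S])

lemma smooth_on_cong:
  "open S \<Longrightarrow> smooth_on S f \<Longrightarrow> (\<And>x. x \<in> S \<Longrightarrow> f x = g x) \<Longrightarrow> smooth_on S g"
  unfolding smooth_on_def by (auto intro: Ck_on_cong)

lemma smooth_on_local:
  assumes "\<And>x. x \<in> S \<Longrightarrow> \<exists>N. open N \<and> x \<in> N \<and> smooth_on N f"
  shows "smooth_on S f"
  unfolding smooth_on_def
proof
  show "Ck_on k S f" for k
    by (rule Ck_on_local) (use assms in \<open>auto simp: smooth_on_def\<close>)
qed

lemma smooth_on_const: "open S \<Longrightarrow> smooth_on S (\<lambda>x. c)"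
  by (simp add: smooth_on_def Ck_on_const)

lemma smooth_on_ident: "open S \<Longrightarrow> smooth_on S (\<lambda>x. x)"
  by (simp add: smooth_on_def Ck_on_id)

lemma smooth_on_bounded_linear:
  "bounded_linear l \<Longrightarrow> open S \<Longrightarrow> smooth_on S f \<Longrightarrow> smooth_on S (\<lambda>x. l (f x))"
  by (simp add: smooth_on_def Ck_on_bounded_linear)

lemma smooth_on_linear:
  fixes l :: "'a::euclidean_space \<Rightarrow> 'b::real_normed_vector"
  shows "linear l \<Longrightarrow> open S \<Longrightarrow> smooth_on S f \<Longrightarrow> smooth_on S (\<lambda>x. l (f x))"
  by (simp add: linear_conv_bounded_linear smooth_on_bounded_linear)

lemma smooth_on_add:
  "open S \<Longrightarrow> smooth_on S f \<Longrightarrow> smooth_on S g \<Longrightarrow> smooth_on S (\<lambda>x. f x + g x)"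
  by (simp add: smooth_on_def Ck_on_add)

lemma smooth_on_minus:
  "open S \<Longrightarrow> smooth_on S f \<Longrightarrow> smooth_on S (\<lambda>x. - f x)"
  by (rule smooth_on_bounded_linear[OF bounded_linear_minus[OF bounded_linear_ident]])

lemma smooth_on_diff:
  "open S \<Longrightarrow> smooth_on S f \<Longrightarrow> smooth_on S g \<Longrightarrow> smooth_on S (\<lambda>x. f x - g x)"
  using smooth_on_add[OF _ _ smooth_on_minus, of S f g] by simp

lemma smooth_on_bounded_bilinear:
  "bounded_bilinear p \<Longrightarrow> open S \<Longrightarrow> smooth_on S f \<Longrightarrow> smooth_on S g \<Longrightarrow>
    smooth_on S (\<lambda>x. p (f x) (g x))"
  by (simp add: smooth_on_def Ck_on_bounded_bilinear)

lemmas smooth_on_scaleR = smooth_on_bounded_bilinear[OF bounded_bilinear_scaleR]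

lemma smooth_on_mult:
  fixes f g :: "'a::real_normed_vector \<Rightarrow> real"
  shows "open S \<Longrightarrow> smooth_on S f \<Longrightarrow> smooth_on S g \<Longrightarrow> smooth_on S (\<lambda>x. f x * g x)"
  by (rule smooth_on_bounded_bilinear[OF bounded_bilinear_mult])

lemma smooth_on_sum:
  "open S \<Longrightarrow> (\<And>i. i \<in> I \<Longrightarrow> smooth_on S (f i)) \<Longrightarrow> smooth_on S (\<lambda>x. \<Sum>i\<in>I. f i x)"
  by (simp add: smooth_on_def Ck_on_sum)

lemma smooth_on_compose:
  fixes f :: "'a::real_normed_vector \<Rightarrow> 'b::euclidean_space"
  shows "smooth_on T g \<Longrightarrow> open S \<Longrightarrow> open T \<Longrightarrow> smooth_on S f \<Longrightarrow> (\<And>x. x \<in> S \<Longrightarrow> f x \<in> T) \<Longrightarrow>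
    smooth_on S (\<lambda>x. g (f x))"
  unfolding smooth_on_def using Ck_on_compose[of S T f _ g] by (simp add: image_subset_iff)

lemma smooth_on_vec:
  fixes f :: "'a::real_normed_vector \<Rightarrow> 'i::finite \<Rightarrow> real"
  assumes "open S" "\<And>i. smooth_on S (\<lambda>x. f x i)"
  shows "smooth_on S (\<lambda>x. \<chi> i. f x i)"
proof -
  have "(\<chi> i. f x i) = (\<Sum>i\<in>UNIV. f x i *\<^sub>R axis i 1)" for x
    by (simp add: vec_eq_iff axis_def if_distrib sum.delta cong: if_cong)
  then show ?thesis
    using assms by (auto intro!: smooth_on_sum smooth_on_scaleR smooth_on_const)
qed

lemma smooth_on_vec_nth:
  "open S \<Longrightarrow> smooth_on S f \<Longrightarrow> smooth_on S (\<lambda>x. f x $ i)"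
  by (rule smooth_on_bounded_linear[OF bounded_linear_vec_nth])

lemma smooth_on_fst: "open S \<Longrightarrow> smooth_on S f \<Longrightarrow> smooth_on S (\<lambda>x. fst (f x))"
  by (rule smooth_on_bounded_linear[OF bounded_linear_fst])

lemma smooth_on_snd: "open S \<Longrightarrow> smooth_on S f \<Longrightarrow> smooth_on S (\<lambda>x. snd (f x))"
  by (rule smooth_on_bounded_linear[OF bounded_linear_snd])

lemma smooth_on_Pair:
  assumes "open S" "smooth_on S f" "smooth_on S g"
  shows "smooth_on S (\<lambda>x. (f x, g x))"
proof -
  have 1: "bounded_linear (\<lambda>x. (x, 0::'c))" and 2: "bounded_linear (\<lambda>x. (0::'b, x))"
    by (auto intro: bounded_linear_Pair bounded_linear_ident bounded_linear_zero)
  show ?thesis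
    using smooth_on_add[OF assms(1) smooth_on_bounded_linear[OF 1 assms(1,2)]
        smooth_on_bounded_linear[OF 2 assms(1,3)]] by simp
qed

section \<open>Elementary functions of one real variable\<close>

lemma Ck_on_Suc_real:
  fixes f :: "real \<Rightarrow> real"
  assumes "open S" "\<And>x. x \<in> S \<Longrightarrow> (f has_real_derivative f' x) (at x)" "Ck_on k S f'"
  shows "Ck_on (Suc k) S f"
proof (rule Ck_on_SucI'[OF \<open>open S\<close>])
  show "(f has_derivative (\<lambda>v. f' x * v)) (at x)" if "x \<in> S" for x
    using assms(2)[OF that] by (simp add: has_field_derivative_def)
  show "Ck_on k S (\<lambda>x. f' x * v)" for v
    by (rule Ck_on_bounded_linear[OF bounded_linear_mult_left assms(1,3)])
qed

lemma smooth_on_real_sin_cos: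
  "smooth_on UNIV (sin :: real \<Rightarrow> real)" "smooth_on UNIV (cos :: real \<Rightarrow> real)"
proof -
  have "Ck_on k UNIV (sin :: real \<Rightarrow> real) \<and> Ck_on k UNIV (cos :: real \<Rightarrow> real)" for k
  proof (induction k)
    case 0
    then show ?case by (simp add: continuous_intros)
  next
    case (Suc k)
    have "Ck_on k UNIV (\<lambda>x. - sin x :: real)"
      by (rule Ck_on_bounded_linear[OF bounded_linear_minus[OF bounded_linear_ident]]) (use Suc in auto)
    then show ?case
      using Suc Ck_on_Suc_real[of UNIV sin cos k] Ck_on_Suc_real[of UNIV cos "\<lambda>x. - sin x" k]
      by (simp add: DERIV_sin DERIV_cos)
  qed
  then show "smooth_on UNIV (sin :: real \<Rightarrow> real)" "smooth_on UNIV (cos :: real \<Rightarrow> real)"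
    by (auto simp: smooth_on_def)
qed

lemma smooth_on_real_exp: "smooth_on UNIV (exp :: real \<Rightarrow> real)"
proof -
  have "Ck_on k UNIV (exp :: real \<Rightarrow> real)" for k
  proof (induction k)
    case (Suc k)
    then show ?case by (intro Ck_on_Suc_real[of UNIV exp exp]) (auto intro: DERIV_exp)
  qed (simp add: continuous_intros)
  then show ?thesis by (simp add: smooth_on_def)
qed

lemma smooth_on_real_inverse: "smooth_on (- {0}) (inverse :: real \<Rightarrow> real)"
proof -
  have "Ck_on k (- {0}) (inverse :: real \<Rightarrow> real)" for k
  proof (induction k)
    case 0
    then show ?case by (auto intro!: continuous_intros)
  next
    case (Suc k)
    have o: "open (- {0::real})" by auto
    have "Ck_on k (- {0}) (\<lambda>x::real. - (inverse x * inverse x))"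
      by (intro Ck_on_bounded_linear[OF bounded_linear_minus[OF bounded_linear_ident]]
          Ck_on_bounded_bilinear[OF bounded_bilinear_mult] o Suc)
    then show ?case
      by (rule Ck_on_Suc_real[OF o, rotated])
        (auto intro!: derivative_eq_intros)
  qed
  then show ?thesis by (simp add: smooth_on_def)
qed

lemma smooth_on_real_ln: "smooth_on {0<..} (ln :: real \<Rightarrow> real)"
proof -
  have "Ck_on k {0<..} (inverse :: real \<Rightarrow> real)" for k
    using smooth_on_subset[OF smooth_on_real_inverse, of "{0<..}"]
    by (simp add: smooth_on_def subset_eq)
  then have "Ck_on (Suc k) {0<..} (ln :: real \<Rightarrow> real)" for k
    by (rule Ck_on_Suc_real[rotated 2]) (auto intro!: derivative_eq_intros simp: field_simps)
  then show ?thesis by (simp add: smooth_on_def Ck_on_SucD del: Ck_on.simps)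
qed

text \<open>Termwise differentiation gives another series that converges everywhere, so the
  induction runs over all coefficient sequences at once. The lemma serves \<open>sinc_fun\<close>,
  for which the quotient rule fails at 0.\<close>

lemma smooth_on_power_series:
  fixes c :: "nat \<Rightarrow> real"
  assumes "\<And>x. summable (\<lambda>n. c n * x ^ n)"
  shows "smooth_on UNIV (\<lambda>x. \<Sum>n. c n * x ^ n)"
proof -
  have "Ck_on k UNIV (\<lambda>x. \<Sum>n. c n * x ^ n)" if "\<And>x. summable (\<lambda>n. c n * x ^ n)"
    for k and c :: "nat \<Rightarrow> real"
    using that
  proof (induction k arbitrary: c)
    case 0
    have "isCont (\<lambda>x. \<Sum>n. c n * x ^ n) x" for x
      using DERIV_isCont[OF termdiffs_strong_converges_everywhere[of c x]] 0 by simp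
    then show ?case by (simp add: continuous_at_imp_continuous_on)
  next
    case (Suc k)
    have d: "((\<lambda>x. \<Sum>n. c n * x ^ n) has_real_derivative (\<Sum>n. diffs c n * x ^ n)) (at x)" for x
      using Suc.prems by (rule termdiffs_strong_converges_everywhere)
    have "Ck_on k UNIV (\<lambda>x. \<Sum>n. diffs c n * x ^ n)"
      by (rule Suc.IH) (rule termdiff_converges_all[OF Suc.prems])
    then show ?case
      by (rule Ck_on_Suc_real[OF open_UNIV d, rotated])
  qed
  then show ?thesis using assms by (simp add: smooth_on_def)
qed

definition sinc_fun :: "real \<Rightarrow> real" where
  "sinc_fun x = (if x = 0 then 1 else sin x / x)"

lemma sinc_fun_0 [simp]: "sinc_fun 0 = 1" by (simp add: sinc_fun_def)

lemma sinc_fun_mult: "x * sinc_fun x = sin x" by (simp add: sinc_fun_def)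

lemma sinc_fun_minus [simp]: "sinc_fun (- x) = sinc_fun x" by (simp add: sinc_fun_def)

lemma sinc_fun_pos: "\<bar>x\<bar> < pi \<Longrightarrow> 0 < sinc_fun x"
  using sin_gt_zero[of x] sin_gt_zero[of "- x"]
  by (cases x "0::real" rule: linorder_cases) (auto simp: sinc_fun_def zero_less_divide_iff)

lemma smooth_on_sinc_fun: "smooth_on UNIV sinc_fun"
proof -
  have s: "(\<lambda>n. sin_coeff (Suc n) * x ^ n) sums sinc_fun x" for x
  proof (cases "x = 0")
    case True
    have "(\<lambda>n. sin_coeff (Suc n) * 0 ^ n) sums (sin_coeff (Suc 0) :: real)"
      using powser_sums_zero[of "\<lambda>n. sin_coeff (Suc n)"] .
    then show ?thesis using True by (simp add: sin_coeff_def)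
  next
    case False
    have "(\<lambda>n. sin_coeff n * x ^ n) sums sin x"
      using sin_converges[of x] by simp
    \<comment> \<open>The sine series has constant term 0, so dropping its first term leaves the sum
      unchanged.\<close>
    then have "(\<lambda>n. sin_coeff (Suc n) * x ^ Suc n) sums sin x"
      by (subst sums_Suc_iff) (simp add: sin_coeff_def)
    then have "(\<lambda>n. sin_coeff (Suc n) * x ^ Suc n / x) sums (sin x / x)"
      by (rule sums_divide)
    then show ?thesis using False by (simp add: sinc_fun_def)
  qed
  then have "sinc_fun = (\<lambda>x. \<Sum>n. sin_coeff (Suc n) * x ^ n)"
    by (auto simp: sums_iff)
  then show ?thesis
    using smooth_on_power_series[of "\<lambda>n. sin_coeff (Suc n)"] s by (auto simp: sums_iff)
qed

lemma smooth_on_sin: "open S \<Longrightarrow> smooth_on S f \<Longrightarrow> smooth_on S (\<lambda>x. sin (f x :: real))"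
  and smooth_on_cos: "open S \<Longrightarrow> smooth_on S f \<Longrightarrow> smooth_on S (\<lambda>x. cos (f x :: real))"
  and smooth_on_exp: "open S \<Longrightarrow> smooth_on S f \<Longrightarrow> smooth_on S (\<lambda>x. exp (f x :: real))"
  and smooth_on_sinc: "open S \<Longrightarrow> smooth_on S f \<Longrightarrow> smooth_on S (\<lambda>x. sinc_fun (f x))"
  and smooth_on_ln: "open S \<Longrightarrow> smooth_on S f \<Longrightarrow> (\<And>x. x \<in> S \<Longrightarrow> 0 < f x) \<Longrightarrow>
    smooth_on S (\<lambda>x. ln (f x :: real))"
  and smooth_on_inverse: "open S \<Longrightarrow> smooth_on S f \<Longrightarrow> (\<And>x. x \<in> S \<Longrightarrow> f x \<noteq> 0) \<Longrightarrow>
    smooth_on S (\<lambda>x. inverse (f x :: real))"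
  by (simp_all add: smooth_on_compose[OF smooth_on_real_sin_cos(1)]
      smooth_on_compose[OF smooth_on_real_sin_cos(2)] smooth_on_compose[OF smooth_on_real_exp]
      smooth_on_compose[OF smooth_on_sinc_fun] smooth_on_compose[OF smooth_on_real_ln]
      smooth_on_compose[OF smooth_on_real_inverse, OF _ open_Compl[OF closed_singleton]])

lemma smooth_on_divide:
  "open S \<Longrightarrow> smooth_on S f \<Longrightarrow> smooth_on S g \<Longrightarrow> (\<And>x. x \<in> S \<Longrightarrow> g x \<noteq> 0) \<Longrightarrow>
    smooth_on S (\<lambda>x. f x / g x :: real)"
  unfolding divide_inverse by (intro smooth_on_mult smooth_on_inverse)

lemmas smooth_on_intros =
  smooth_on_const smooth_on_ident smooth_on_add smooth_on_minus smooth_on_diff smooth_on_scaleR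
  smooth_on_mult smooth_on_sum smooth_on_vec smooth_on_vec_nth smooth_on_fst smooth_on_snd
  smooth_on_Pair smooth_on_sin smooth_on_cos smooth_on_exp smooth_on_sinc smooth_on_ln
  smooth_on_divide

lemma smooth_on_continuous: "smooth_on S f \<Longrightarrow> continuous_on S f"
  unfolding smooth_on_def by (drule spec[of _ 0]) simp

lemma smooth_on_has_derivative:
  "smooth_on S f \<Longrightarrow> x \<in> S \<Longrightarrow> (f has_derivative frechet_derivative f (at x)) (at x)"
  unfolding smooth_on_def by (blast intro: Ck_on_Suc_has_derivative[of 0])

lemma smooth_on_frechet_derivative:
  "smooth_on S f \<Longrightarrow> smooth_on S (\<lambda>x. frechet_derivative f (at x) v)"
  unfolding smooth_on_def
proof
  assume "\<forall>k. Ck_on k S f"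
  then have "Ck_on (Suc k) S f" for k by blast
  then show "Ck_on k S (\<lambda>x. frechet_derivative f (at x) v)" for k by simp
qed

section \<open>The cotangent bundle and atlases lifted to it\<close>


definition lattice_pt :: "real^'m \<Rightarrow> bool" where
  "lattice_pt z \<longleftrightarrow> (\<forall>i. \<exists>k::int. z $ i = pi * of_int k)"

lemma torus_proj_eq_iff: "torus_proj x = torus_proj y \<longleftrightarrow> lattice_pt (y - x)"
proof -
  have "y $ i = x $ i + pi * of_int k \<longleftrightarrow> (y - x) $ i = pi * of_int k" for i and k :: int
    by auto
  then show ?thesis
    unfolding torus.abs_eq_iff torus_rel_def lattice_pt_def by simp
qed

lemma torus_proj_add: "lattice_pt z \<Longrightarrow> torus_proj (x + z) = torus_proj x"
  using torus_proj_eq_iff[of x "x + z"] by simp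

lemma torus_proj_diff: "lattice_pt z \<Longrightarrow> torus_proj (x - z) = torus_proj x"
  using torus_proj_eq_iff[of "x - z" x] by simp

lemma lattice_pt_minus [simp]: "lattice_pt (- z) \<longleftrightarrow> lattice_pt z"
  using torus_proj_eq_iff[of 0 z] torus_proj_eq_iff[of z 0] by auto

lemma torus_proj_surj: obtains y where "q = torus_proj y"
  by (metis Quotient3_torus Quotient3_abs_rep)

lemma lattice_pt_coord_eq_0:
  assumes "lattice_pt z" "\<bar>z $ i\<bar> < pi"
  shows "z $ i = 0"
proof -
  obtain k :: int where k: "z $ i = pi * of_int k"
    using assms(1) by (auto simp: lattice_pt_def)
  then have "pi * \<bar>of_int k\<bar> < pi * 1"
    using assms(2) by (simp add: abs_mult)
  then have "\<bar>k\<bar> < 1" by simp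
  then show ?thesis using k by simp
qed

lemma lattice_pt_eq_0:
  assumes "lattice_pt z" "\<And>i. \<bar>z $ i\<bar> < pi"
  shows "z = 0"
  using lattice_pt_coord_eq_0[OF assms(1)] assms(2) by (simp add: vec_eq_iff)

lemma inj_on_torus_proj: "inj_on torus_proj (ball c (pi/2) :: (real^'m::finite) set)"
proof (rule inj_onI)
  fix x y :: "real^'m"
  assume "x \<in> ball c (pi/2)" "y \<in> ball c (pi/2)" "torus_proj x = torus_proj y"
  then have "norm (y - x) < pi"
    using dist_triangle_less_add[of x c "pi/2" y "pi/2"] by (simp add: dist_commute dist_norm norm_minus_commute)
  then have "\<bar>(y - x) $ i\<bar> < pi" for i
    using component_le_norm_cart[of "y - x" i] by simp
  then show "x = y"
    using lattice_pt_eq_0[of "y - x"] \<open>torus_proj x = torus_proj y\<close> by (simp add: torus_proj_eq_iff)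
qed

text \<open>The universal covering of the cotangent bundle; the cotangent charts are its local
  inverses.\<close>

definition cover_map :: "(real^'m) \<times> (real^'m::finite) \<Rightarrow> (real^'m) \<times> 'm torus" where
  "cover_map = (\<lambda>(x, y). (x, torus_proj y))"

lemma cover_map_simp [simp]: "cover_map (x, y) = (x, torus_proj y)"
  by (simp add: cover_map_def)

lemma cover_map_eq_iff:
  "cover_map b = cover_map b' \<longleftrightarrow> (\<exists>z. lattice_pt z \<and> b' = b + (0, z))"
proof (cases b; cases b')
  fix x y x' y' assume [simp]: "b = (x, y)" "b' = (x', y')"
  have "y' = y + z \<longleftrightarrow> z = y' - y" for z by auto
  then show ?thesis by (auto simp: torus_proj_eq_iff)
qed

lemma cover_map_add: "lattice_pt z \<Longrightarrow> cover_map (b + (0, z)) = cover_map b"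
  by (metis cover_map_eq_iff)

lemma cover_map_surj: obtains b where "y = cover_map b"
  by (cases y) (metis cover_map_simp torus_proj_surj)

text \<open>The saturation of a set is the union of its lattice translates. Together with
  \<open>openin_cotangent\<close> this says that the covering is an open map.\<close>

lemma open_vimage_cover_map_image:
  assumes "open B"
  shows "open (cover_map -` (cover_map ` B))"
proof -
  have "cover_map -` (cover_map ` B) = (\<Union>z\<in>Collect lattice_pt. (+) (0, z) ` B)"
  proof (intro equalityI subsetI)
    fix b' assume "b' \<in> cover_map -` cover_map ` B"
    then obtain b where "b \<in> B" "cover_map b = cover_map b'" by auto
    then obtain z where "lattice_pt z" "b' = (0, z) + b"
      unfolding cover_map_eq_iff by (auto simp: add.commute)
    then show "b' \<in> (\<Union>z\<in>Collect lattice_pt. (+) (0, z) ` B)"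
      using \<open>b \<in> B\<close> by blast
  next
    fix b' assume "b' \<in> (\<Union>z\<in>Collect lattice_pt. (+) (0, z) ` B)"
    then obtain z b where "lattice_pt z" "b \<in> B" "b' = b + (0, z)" by (auto simp: add.commute)
    then show "b' \<in> cover_map -` cover_map ` B"
      by (simp only: vimage_eq cover_map_add imageI)
  qed
  then show ?thesis
    using assms by (auto intro: open_translation)
qed

section \<open>The topology determined by an atlas\<close>

definition charted :: "('p, 'e) chart set \<Rightarrow> 'p set" where
  "charted A = (\<Union>(U, \<phi>)\<in>A. U)"

lemma charted_iff: "p \<in> charted A \<longleftrightarrow> (\<exists>U \<phi>. (U, \<phi>) \<in> A \<and> p \<in> U)"
  by (auto simp: charted_def)

lemmas open_vimage_Int = continuous_on_open_vimage[THEN iffD1, rule_format]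

lemma charted_supset: "(U, \<phi>) \<in> A \<Longrightarrow> U \<subseteq> charted A"
  unfolding charted_def by blast

text \<open>The constructor \<open>topology\<close> can be unfolded only for a predicate that
  satisfies \<open>istopology\<close>. Injectivity of the charts enters for intersections, since
  images must commute with them.\<close>

lemma openin_atlas_topology:
  assumes inj: "\<And>U \<phi>. (U, \<phi>) \<in> A \<Longrightarrow> inj_on \<phi> U"
  shows "openin (atlas_topology A) W \<longleftrightarrow>
    W \<subseteq> charted A \<and> (\<forall>U \<phi>. (U, \<phi>) \<in> A \<longrightarrow> open (\<phi> ` (W \<inter> U)))"
proof -
  let ?O = "\<lambda>W. W \<subseteq> charted A \<and> (\<forall>U \<phi>. (U, \<phi>) \<in> A \<longrightarrow> open (\<phi> ` (W \<inter> U)))"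
  have "istopology ?O"
    unfolding istopology_def
  proof (intro conjI allI impI)
    fix W W' U \<phi>
    assume *: "?O W" "?O W'" and U: "(U, \<phi>) \<in> A"
    then have o: "open (\<phi> ` (W \<inter> U))" "open (\<phi> ` (W' \<inter> U))" by blast+
    have "\<phi> ` ((W \<inter> W') \<inter> U) = \<phi> ` (W \<inter> U) \<inter> \<phi> ` (W' \<inter> U)"
      using inj[OF U] by (auto simp: inj_on_def)
    then show "open (\<phi> ` ((W \<inter> W') \<inter> U))" using o by (simp add: open_Int)
  next
    fix K U \<phi>
    assume *: "\<forall>W\<in>K. ?O W" and U: "(U, \<phi>) \<in> A"
    have "\<phi> ` (\<Union>K \<inter> U) = (\<Union>W\<in>K. \<phi> ` (W \<inter> U))" by blast
    then show "open (\<phi> ` (\<Union>K \<inter> U))" using * U by (simp add: open_UN)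
  qed blast+
  moreover have "atlas_topology A = topology ?O"
    unfolding atlas_topology_def charted_def by (rule arg_cong[where f = topology]) fast
  ultimately show ?thesis by (simp only: topology_inverse')
qed

lemma topspace_atlas_topology:
  assumes "\<And>U \<phi>. (U, \<phi>) \<in> A \<Longrightarrow> inj_on \<phi> U"
    and "\<And>U \<phi> V \<psi>. (U, \<phi>) \<in> A \<Longrightarrow> (V, \<psi>) \<in> A \<Longrightarrow> open (\<phi> ` (U \<inter> V))"
  shows "topspace (atlas_topology A) = charted A"
proof
  note o = openin_atlas_topology[OF assms(1)]
  show "topspace (atlas_topology A) \<subseteq> charted A"
    using openin_topspace[of "atlas_topology A"] o by blast
  have "openin (atlas_topology A) (charted A)"
  proof -
    have "charted A \<inter> U = U" if "(U, \<phi>) \<in> A" for U \<phi>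
      using charted_supset[OF that] by blast
    moreover have "open (\<phi> ` U)" if "(U, \<phi>) \<in> A" for U \<phi>
      using assms(2)[OF that that] by simp
    ultimately show ?thesis by (simp add: o)
  qed
  then show "charted A \<subseteq> topspace (atlas_topology A)"
    by (rule openin_subset)
qed

lemma atlas_topology_euclidean: "atlas_topology euclidean_atlas = euclidean"
  unfolding topology_eq
  by (subst openin_atlas_topology) (auto simp: euclidean_atlas_def charted_def)

section \<open>The atlas of the cotangent bundle\<close>

abbreviation cot_chart :: "real^'m \<Rightarrow> (real^'m) \<times> ('m::finite torus) \<Rightarrow> (real^'m) \<times> (real^'m)" where
  "cot_chart c \<equiv> \<lambda>(x, q). (x, inv_into (ball c (pi/2)) torus_proj q)"

lemma cotangent_atlas_eq:
  "cotangent_atlas = range (\<lambda>c. (UNIV \<times> torus_proj ` ball c (pi/2), cot_chart c))"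
  unfolding cotangent_atlas_def torus_atlas_def by (auto simp: image_image)

lemma cot_chart_cover_map:
  "b \<in> UNIV \<times> ball c (pi/2) \<Longrightarrow> cot_chart c (cover_map b) = b"
  by (cases b) (simp add: inv_into_f_f[OF inj_on_torus_proj])

lemma cot_chart_domain: "UNIV \<times> torus_proj ` ball c (pi/2) = cover_map ` (UNIV \<times> ball c (pi/2))"
  by (auto simp: cover_map_def image_iff)

lemma cot_chart_image:
  "cot_chart c ` (W \<inter> UNIV \<times> torus_proj ` ball c (pi/2)) = cover_map -` W \<inter> (UNIV \<times> ball c (pi/2))"
proof -
  have "W \<inter> UNIV \<times> torus_proj ` ball c (pi/2) = cover_map ` (cover_map -` W \<inter> (UNIV \<times> ball c (pi/2)))"
    unfolding cot_chart_domain by blast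
  then have "cot_chart c ` (W \<inter> UNIV \<times> torus_proj ` ball c (pi/2)) =
      (\<lambda>b. cot_chart c (cover_map b)) ` (cover_map -` W \<inter> (UNIV \<times> ball c (pi/2)))"
    by (simp add: image_image)
  also have "\<dots> = (\<lambda>b. b) ` (cover_map -` W \<inter> (UNIV \<times> ball c (pi/2)))"
    by (rule image_cong[OF refl]) (rule cot_chart_cover_map, blast)
  finally show ?thesis by simp
qed

lemma inj_on_cot_chart:
  "inj_on (cot_chart c) (UNIV \<times> torus_proj ` ball c (pi/2) :: ((real^'m) \<times> 'm::finite torus) set)"
proof (rule inj_on_inverseI)
  fix p :: "(real^'m) \<times> 'm torus"
  assume "p \<in> UNIV \<times> torus_proj ` ball c (pi/2)"
  then obtain b where "p = cover_map b" "b \<in> UNIV \<times> ball c (pi/2)"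
    unfolding cot_chart_domain by blast
  then show "cover_map (cot_chart c p) = p"
    by (simp only: cot_chart_cover_map)
qed

lemma cotangent_atlas_cases:
  assumes "(V, \<psi>) \<in> cotangent_atlas"
  obtains c where "V = UNIV \<times> torus_proj ` ball c (pi/2)" "\<psi> = cot_chart c"
  using assms unfolding cotangent_atlas_eq by blast

lemma charted_cotangent: "charted cotangent_atlas = UNIV"
proof -
  have "cover_map b \<in> charted cotangent_atlas" for b :: "(real^'a) \<times> (real^'a)"
    unfolding charted_iff cotangent_atlas_eq cot_chart_domain
    by (intro exI conjI, rule rangeI[where x = "snd b"]) (rule imageI, cases b, simp)
  then show ?thesis by (metis cover_map_surj UNIV_eq_I)
qed

text \<open>The atlas topology is the quotient topology of the covering: chart images are the traces
  of the preimage on the open sets \<open>UNIV \<times> ball c (pi/2)\<close>, and these exhaust the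
  covering space.\<close>

lemma openin_cotangent:
  "openin (atlas_topology cotangent_atlas) W \<longleftrightarrow> open (cover_map -` W)"
proof -
  have "inj_on \<psi> V" if "(V, \<psi>) \<in> cotangent_atlas" for V and \<psi> :: "(real^'a) \<times> 'a torus \<Rightarrow> _"
    using that inj_on_cot_chart by (elim cotangent_atlas_cases) simp
  then have "openin (atlas_topology cotangent_atlas) W \<longleftrightarrow>
      (\<forall>c. open (cot_chart c ` (W \<inter> UNIV \<times> torus_proj ` ball c (pi/2))))"
    by (subst openin_atlas_topology) (auto simp: charted_cotangent, auto simp: cotangent_atlas_eq)
  also have "\<dots> \<longleftrightarrow> (\<forall>c. open (cover_map -` W \<inter> (UNIV \<times> ball c (pi/2))))"
    by (simp only: cot_chart_image)
  also have "\<dots> \<longleftrightarrow> open (cover_map -` W)"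
  proof
    assume *: "\<forall>c. open (cover_map -` W \<inter> (UNIV \<times> ball c (pi/2)))"
    have "b \<in> UNIV \<times> ball (snd b) (pi/2)" for b :: "(real^'a) \<times> (real^'a)"
      by (cases b) simp
    then have "cover_map -` W = (\<Union>c. cover_map -` W \<inter> (UNIV \<times> ball c (pi/2)))"
      by blast
    then show "open (cover_map -` W)" using * open_UN[of UNIV "\<lambda>c. cover_map -` W \<inter> (UNIV \<times> ball c (pi/2))"] by simp
  qed (auto intro: open_Times)
  finally show ?thesis .
qed

lemma topspace_cotangent:
  "topspace (atlas_topology cotangent_atlas) = (UNIV :: ((real^'m) \<times> 'm::finite torus) set)"
  using openin_subset[of "atlas_topology cotangent_atlas" UNIV] openin_cotangent[of UNIV] by auto

lemma continuous_map_cotangent_iff: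
  "continuous_map (atlas_topology cotangent_atlas) euclidean f \<longleftrightarrow>
    continuous_on UNIV (f \<circ> cover_map)"
  by (simp add: continuous_map_def topspace_cotangent openin_cotangent continuous_on_open_vimage
      vimage_def)

text \<open>The functions \<open>cos (2 y)\<close> and \<open>sin (2 y)\<close> have period pi and
  together separate the points of a circle of length pi. Applied to each coordinate they induce a
  continuous injection of the bundle into a Euclidean space, independent of the representative
  chosen by \<open>inv cover_map\<close>.\<close>

lemma Hausdorff_cotangent:
  "Hausdorff_space (atlas_topology cotangent_atlas :: ((real^'m) \<times> 'm::finite torus) topology)"
proof (rule Hausdorff_space_injective_preimage)
  let ?e = "\<lambda>p :: (real^'m) \<times> (real^'m). (fst p, (\<chi> i. cos (2 * snd p $ i)), (\<chi> i. sin (2 * snd p $ i)))"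
  have "?e (x, y) = ?e (x, y')" if "torus_proj y = torus_proj y'" for x y y'
  proof -
    have "cos (2 * y $ i) = cos (2 * y' $ i)" "sin (2 * y $ i) = sin (2 * y' $ i)" for i
    proof -
      obtain k :: int where "(y' - y) $ i = pi * of_int k"
        using \<open>torus_proj y = torus_proj y'\<close> by (auto simp: torus_proj_eq_iff lattice_pt_def)
      then have "2 * y' $ i = 2 * y $ i + 2 * pi * of_int k" by (simp add: algebra_simps)
      then have "sin (2 * y' $ i) = sin (2 * y $ i) \<and> cos (2 * y' $ i) = cos (2 * y $ i)"
        unfolding sin_cos_eq_iff by blast
      then show "cos (2 * y $ i) = cos (2 * y' $ i)" "sin (2 * y $ i) = sin (2 * y' $ i)" by auto
    qed
    then show ?thesis by simp
  qed
  note e_eq = this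
  have ic: "cover_map (inv cover_map y) = y" for y :: "(real^'m) \<times> 'm torus"
    by (rule f_inv_into_f) (metis cover_map_surj rangeI)
  have e: "?e (inv cover_map (cover_map b)) = ?e b" for b :: "(real^'m) \<times> (real^'m)"
  proof -
    obtain x y where b: "b = (x, y)" by (cases b)
    obtain x' y' where b': "inv cover_map (cover_map b) = (x', y')"
      by (cases "inv cover_map (cover_map b)")
    have "cover_map (x', y') = cover_map (x, y)"
      using ic[of "cover_map b"] unfolding b' unfolding b .
    then show ?thesis unfolding b' unfolding b using e_eq[of y' y x] by simp
  qed
  show "continuous_map (atlas_topology cotangent_atlas) euclidean (?e \<circ> inv cover_map)"
    unfolding continuous_map_cotangent_iff o_def e
    by (intro continuous_intros)
  show "inj_on (?e \<circ> inv cover_map) (topspace (atlas_topology cotangent_atlas))"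
  proof (rule inj_onI)
    fix p q :: "(real^'m) \<times> 'm torus"
    assume *: "(?e \<circ> inv cover_map) p = (?e \<circ> inv cover_map) q"
    obtain x y where p: "p = cover_map (x, y)" by (metis cover_map_surj surj_pair)
    obtain x' y' where q: "q = cover_map (x', y')" by (metis cover_map_surj surj_pair)
    have "?e (x, y) = ?e (x', y')" using * unfolding o_def p q e .
    then have "x = x'" and sc: "sin (2 * y' $ i) = sin (2 * y $ i) \<and> cos (2 * y' $ i) = cos (2 * y $ i)" for i
      by (auto simp: vec_eq_iff)
    have "\<exists>k::int. (y' - y) $ i = pi * of_int k" for i
    proof -
      obtain k :: int where "2 * y' $ i = 2 * y $ i + 2 * pi * of_int k"
        using sc[of i] unfolding sin_cos_eq_iff by auto
      then show ?thesis by (intro exI[of _ k]) (simp add: algebra_simps)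
    qed
    then show "p = q"
      using \<open>x = x'\<close> by (simp add: p q torus_proj_eq_iff lattice_pt_def)
  qed
qed simp

lemma second_countable_euclidean: "second_countable (euclidean :: 'a::second_countable_topology topology)"
proof -
  obtain B :: "'a set set" where B: "countable B" "topological_basis B"
    using ex_countable_basis by blast
  then have "\<exists>V\<in>B. x \<in> V \<and> V \<subseteq> U" if "open U" "x \<in> U" for U x
    using that by (metis topological_basisE)
  then show ?thesis
    unfolding second_countable_def using B topological_basis_open
    by (intro exI[of _ B]) auto
qed

lemma second_countable_cotangent:
  "second_countable (atlas_topology cotangent_atlas :: ((real^'m) \<times> 'm::finite torus) topology)"
proof (rule second_countable_open_map_image)
  show "continuous_map euclidean (atlas_topology cotangent_atlas) cover_map"
    by (simp add: continuous_map_def topspace_cotangent openin_cotangent vimage_def)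
  show "open_map euclidean (atlas_topology cotangent_atlas) cover_map"
    by (simp add: open_map_def openin_cotangent open_vimage_cover_map_image)
  show "cover_map ` topspace euclidean = topspace (atlas_topology cotangent_atlas)"
    unfolding topspace_cotangent by (metis UNIV_eq_I cover_map_surj rangeI topspace_euclidean)
qed (rule second_countable_euclidean)

section \<open>Lifts along the covering\<close>

definition is_lift ::
    "('p \<Rightarrow> (real^'m) \<times> 'm::finite torus) \<Rightarrow> 'p set \<Rightarrow> ('p \<Rightarrow> 'e::euclidean_space) \<Rightarrow> ('e \<Rightarrow> (real^'m) \<times> (real^'m)) \<Rightarrow> bool" where
  "is_lift f U \<phi> g \<longleftrightarrow> smooth_on (\<phi> ` U) g \<and> (\<forall>p\<in>U. f p = cover_map (g (\<phi> p)))"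

text \<open>A chart which near each value of the lift of \<open>f\<close> is recovered from \<open>f\<close> by a smooth map.
  If all charts of an atlas have this property then \<open>f\<close> is an embedding.\<close>

definition chart_recoverable ::
    "'p set \<Rightarrow> ('p \<Rightarrow> (real^'m) \<times> 'm::finite torus) \<Rightarrow> 'p set \<Rightarrow> ('p \<Rightarrow> 'e::euclidean_space) \<Rightarrow> (real^'m) \<times> (real^'m) \<Rightarrow> bool" where
  "chart_recoverable M f U \<phi> b0 \<longleftrightarrow> (\<exists>B l. open B \<and> b0 \<in> B \<and> smooth_on B l \<and>
     (\<forall>q\<in>M. \<forall>b\<in>B. f q = cover_map b \<longrightarrow> q \<in> U \<and> \<phi> q = l b))"

text \<open>Two representatives of the same bundle point differ by a lattice vector. The vector that
  moves \<open>g a0\<close> into the ball of the cotangent chart still does so for nearby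
  \<open>a\<close>, where the chart must then return the shifted lift.\<close>

lemma lift_local:
  assumes inj: "inj_on \<phi> U" and o: "open (\<phi> ` U)" and lift: "is_lift f U \<phi> g"
    and V: "(V, \<psi>) \<in> cotangent_atlas" and a0: "a0 \<in> \<phi> ` (U \<inter> f -` V)"
  shows "\<exists>N z. open N \<and> a0 \<in> N \<and> N \<subseteq> \<phi> ` U \<and> (\<forall>a\<in>N. (\<psi> \<circ> f \<circ> inv_into U \<phi>) a = g a - z)"
proof -
  obtain c where V: "V = UNIV \<times> torus_proj ` ball c (pi/2)" and \<psi>: "\<psi> = cot_chart c"
    using V by (rule cotangent_atlas_cases)
  obtain p0 where p0: "p0 \<in> U" "f p0 \<in> V" "a0 = \<phi> p0" using a0 by blast
  then obtain b where b: "b \<in> UNIV \<times> ball c (pi/2)" "cover_map (g a0) = cover_map b"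
    using lift unfolding V cot_chart_domain is_lift_def by force
  then obtain z where z: "lattice_pt z" "g a0 = b + (0, z)" unfolding cover_map_eq_iff
    by (metis cover_map_eq_iff)
  define N where "N = {a \<in> \<phi> ` U. g a - (0, z) \<in> UNIV \<times> ball c (pi/2)}"
  have "continuous_on (\<phi> ` U) (\<lambda>a. g a - (0, z))"
    using lift by (intro continuous_intros smooth_on_continuous) (simp add: is_lift_def)
  then have "open (\<phi> ` U \<inter> (\<lambda>a. g a - (0, z)) -` (UNIV \<times> ball c (pi/2)))"
    by (intro continuous_open_preimage o open_Times open_UNIV open_ball)
  then have 1: "open N" by (simp add: vimage_def Int_def N_def)
  have 2: "a0 \<in> N" using p0 b z by (simp add: N_def)
  have 3: "(\<psi> \<circ> f \<circ> inv_into U \<phi>) a = g a - (0, z)" if "a \<in> N" for a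
  proof -
    have "f (inv_into U \<phi> a) = cover_map (g a)"
      using that lift by (auto simp: N_def is_lift_def inv_into_into f_inv_into_f)
    also have "\<dots> = cover_map (g a - (0, z))"
      using cover_map_add[of "z" "g a - (0, z)"] z by simp
    finally show ?thesis
      using that by (simp add: N_def \<psi> cot_chart_cover_map del: cover_map_simp split del: prod.split)
  qed
  have 4: "N \<subseteq> \<phi> ` U" by (auto simp: N_def)
  show ?thesis
    by (rule exI[of _ N], rule exI[of _ "(0, z)"]) (use 1 2 3 4 in simp)
qed

text \<open>The translation of \<open>lift_local\<close> drops out on differentiation. Immersivity
  and isotropy thus have to be checked only for one lift per chart.\<close>

lemma lift_frechet_derivative:
  assumes "inj_on \<phi> U" "open (\<phi> ` U)" "is_lift f U \<phi> g"
    and "(V, \<psi>) \<in> cotangent_atlas" "a0 \<in> \<phi> ` (U \<inter> f -` V)"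
  shows "frechet_derivative (\<psi> \<circ> f \<circ> inv_into U \<phi>) (at a0) = frechet_derivative g (at a0)"
proof -
  obtain N z where N: "open N" "a0 \<in> N" "N \<subseteq> \<phi> ` U"
    "\<forall>a\<in>N. (\<psi> \<circ> f \<circ> inv_into U \<phi>) a = g a - z"
    using lift_local[OF assms] by blast
  have "(g has_derivative frechet_derivative g (at a0)) (at a0)"
    using assms(3) N by (auto simp: is_lift_def intro: smooth_on_has_derivative)
  then have "((\<lambda>a. g a - z) has_derivative frechet_derivative g (at a0)) (at a0)"
    by (auto intro!: derivative_eq_intros)
  then have "(\<psi> \<circ> f \<circ> inv_into U \<phi> has_derivative frechet_derivative g (at a0)) (at a0)"
    by (rule has_derivative_transform_within_open[OF _ N(1,2)]) (use N(4) in simp)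
  then show ?thesis by (rule frechet_derivative_at[symmetric])
qed

text \<open>Compatibility of the charts, the Hausdorff property and the embedding property all come
  out of recoverability, because it speaks about every point of \<open>charted A\<close> and so
  relates different charts to each other.\<close>

locale lifted_atlas =
  fixes A :: "('p, 'e::euclidean_space) chart set" and f :: "'p \<Rightarrow> (real^'m) \<times> 'm::finite torus"
  assumes inj: "(U, \<phi>) \<in> A \<Longrightarrow> inj_on \<phi> U"
    and open_image: "(U, \<phi>) \<in> A \<Longrightarrow> open (\<phi> ` U)"
    and lifts: "(U, \<phi>) \<in> A \<Longrightarrow>
      \<exists>g. is_lift f U \<phi> g \<and> (\<forall>p\<in>U. chart_recoverable (charted A) f U \<phi> (g (\<phi> p)))"
begin

lemma inj_f: "inj_on f (charted A)"
proof (rule inj_onI)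
  fix p q assume "p \<in> charted A" and q: "q \<in> charted A" and eq: "f p = f q"
  then obtain U \<phi> where U: "(U, \<phi>) \<in> A" "p \<in> U" by (auto simp: charted_iff)
  then obtain g B l where g: "is_lift f U \<phi> g" and "g (\<phi> p) \<in> B"
    and l: "\<And>q b. q \<in> charted A \<Longrightarrow> b \<in> B \<Longrightarrow> f q = cover_map b \<Longrightarrow> q \<in> U \<and> \<phi> q = l b"
    using lifts[OF U(1)] unfolding chart_recoverable_def by metis
  have "f p = cover_map (g (\<phi> p))" using g U by (simp add: is_lift_def)
  then have "q \<in> U" "\<phi> q = \<phi> p"
    using l[OF q \<open>g (\<phi> p) \<in> B\<close>] l[OF \<open>p \<in> charted A\<close> \<open>g (\<phi> p) \<in> B\<close>] eq by auto
  then show "p = q" using inj[OF U(1)] U(2) by (simp add: inj_on_def)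
qed

text \<open>The coordinate change factors through the cotangent bundle: lift from the first chart,
  shift by a lattice vector into the domain of the left inverse of the second chart, and apply that
  inverse. Recoverability also places nearby points in \<open>V\<close>, which makes the overlap
  open.\<close>

lemma transition_local:
  assumes U: "(U, \<phi>) \<in> A" and V: "(V, \<psi>) \<in> A" and a0: "a0 \<in> \<phi> ` (U \<inter> V)"
  shows "\<exists>N. open N \<and> a0 \<in> N \<and> N \<subseteq> \<phi> ` (U \<inter> V) \<and> smooth_on N (\<psi> \<circ> inv_into U \<phi>)"
proof -
  obtain p0 where p0: "p0 \<in> U" "p0 \<in> V" "a0 = \<phi> p0" using a0 by blast
  obtain g where g: "is_lift f U \<phi> g" using lifts[OF U] by blast
  obtain h B l where h: "is_lift f V \<psi> h" and B: "open B" "h (\<psi> p0) \<in> B" "smooth_on B l"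
    and l: "\<And>q b. q \<in> charted A \<Longrightarrow> b \<in> B \<Longrightarrow> f q = cover_map b \<Longrightarrow> q \<in> V \<and> \<psi> q = l b"
    using lifts[OF V] p0(2) unfolding chart_recoverable_def by metis
  have "cover_map (h (\<psi> p0)) = cover_map (g a0)"
    using g h p0 unfolding is_lift_def by metis
  then obtain z where z: "lattice_pt z" "g a0 = h (\<psi> p0) + (0, z)"
    unfolding cover_map_eq_iff by blast
  let ?N = "\<phi> ` U \<inter> (\<lambda>a. g a - (0, z)) -` B"
  have sm: "smooth_on (\<phi> ` U) (\<lambda>a. g a - (0, z))"
    using g open_image[OF U] by (intro smooth_on_intros) (auto simp: is_lift_def)
  then have o: "open ?N"
    by (intro continuous_open_preimage[OF smooth_on_continuous] open_image[OF U] \<open>open B\<close>)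
  have "inv_into U \<phi> a \<in> V \<and> \<psi> (inv_into U \<phi> a) = l (g a - (0, z))" if "a \<in> ?N" for a
  proof (rule l)
    have a: "inv_into U \<phi> a \<in> U" "\<phi> (inv_into U \<phi> a) = a"
      using that by (auto simp: inv_into_into f_inv_into_f)
    then show "inv_into U \<phi> a \<in> charted A" using charted_supset[OF U] by blast
    show "g a - (0, z) \<in> B" using that by simp
    have "f (inv_into U \<phi> a) = cover_map (g a)"
      using g a by (simp add: is_lift_def)
    then show "f (inv_into U \<phi> a) = cover_map (g a - (0, z))"
      using cover_map_add[OF z(1), of "g a - (0, z)"] by simp
  qed
  note * = this
  have "smooth_on ?N (\<lambda>a. l (g a - (0, z)))"
    by (rule smooth_on_compose[OF B(3) o B(1) smooth_on_subset[OF sm]]) auto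
  then have "smooth_on ?N (\<psi> \<circ> inv_into U \<phi>)"
    by (rule smooth_on_cong[OF o]) (use * in simp)
  moreover have "?N \<subseteq> \<phi> ` (U \<inter> V)"
  proof
    fix a assume a: "a \<in> ?N"
    then show "a \<in> \<phi> ` (U \<inter> V)"
      using *[OF a] by (intro image_eqI[of _ _ "inv_into U \<phi> a"]) (auto simp: inv_into_into f_inv_into_f)
  qed
  moreover have "a0 \<in> ?N" using p0 z B by simp
  ultimately show ?thesis using o by blast
qed

lemma open_overlap:
  assumes "(U, \<phi>) \<in> A" "(V, \<psi>) \<in> A"
  shows "open (\<phi> ` (U \<inter> V))"
proof (rule Topological_Spaces.openI)
  fix a assume "a \<in> \<phi> ` (U \<inter> V)"
  from transition_local[OF assms this]
  show "\<exists>T. open T \<and> a \<in> T \<and> T \<subseteq> \<phi> ` (U \<inter> V)" by metis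
qed

lemma smooth_transition:
  assumes "(U, \<phi>) \<in> A" "(V, \<psi>) \<in> A"
  shows "smooth_on (\<phi> ` (U \<inter> V)) (\<psi> \<circ> inv_into U \<phi>)"
proof (rule smooth_on_local)
  fix a assume "a \<in> \<phi> ` (U \<inter> V)"
  from transition_local[OF assms this]
  show "\<exists>N. open N \<and> a \<in> N \<and> smooth_on N (\<psi> \<circ> inv_into U \<phi>)" by metis
qed

lemmas openin_A = openin_atlas_topology[of A, OF inj]

lemma topspace_A: "topspace (atlas_topology A) = charted A"
  by (rule topspace_atlas_topology) (auto simp: inj open_overlap)

text \<open>The map \<open>k\<close> is the covering when \<open>F\<close> is the embedding, and the
  identity when \<open>F\<close> is the gradient component, whose values are already
  Euclidean.\<close>

lemma continuous_map_A:
  assumes "\<And>U \<phi>. (U, \<phi>) \<in> A \<Longrightarrow> \<exists>g. continuous_on (\<phi> ` U) g \<and> (\<forall>p\<in>U. F p = k (g (\<phi> p)))"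
    and "\<And>W. openin X W \<Longrightarrow> open (k -` W)" and "F ` charted A \<subseteq> topspace X"
  shows "continuous_map (atlas_topology A) X F"
  unfolding continuous_map_def topspace_A
proof (intro conjI allI impI)
  fix W assume "openin X W"
  have "open (\<phi> ` ({p \<in> charted A. F p \<in> W} \<inter> U))" if U: "(U, \<phi>) \<in> A" for U \<phi>
  proof -
    obtain g where g: "continuous_on (\<phi> ` U) g" "\<And>p. p \<in> U \<Longrightarrow> F p = k (g (\<phi> p))"
      using assms(1)[OF U] by blast
    have "\<phi> ` ({p \<in> charted A. F p \<in> W} \<inter> U) = g -` (k -` W) \<inter> \<phi> ` U"
      using charted_supset[OF U] g(2) by auto
    then show ?thesis
      using open_vimage_Int[OF open_image[OF U] g(1) assms(2)[OF \<open>openin X W\<close>]] by simp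
  qed
  then show "openin (atlas_topology A) {p \<in> charted A. F p \<in> W}"
    by (auto simp: openin_A)
qed (use assms(3) in auto)

lemma continuous_f: "continuous_map (atlas_topology A) (atlas_topology cotangent_atlas) f"
proof (rule continuous_map_A[where k = cover_map])
  fix U \<phi> assume "(U, \<phi>) \<in> A"
  then show "\<exists>g. continuous_on (\<phi> ` U) g \<and> (\<forall>p\<in>U. f p = cover_map (g (\<phi> p)))"
    using lifts smooth_on_continuous unfolding is_lift_def by blast
qed (auto simp: openin_cotangent topspace_cotangent)

text \<open>Near \<open>f p\<close> the image of \<open>W\<close> contains what the image of the
  manifold shares with the set of those \<open>cover_map b\<close> for which the left inverse takes
  \<open>b\<close> to coordinates of points of \<open>W\<close>. That set is open because the
  covering is an open map.\<close>

lemma open_f_image: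
  assumes W: "openin (atlas_topology A) W"
  shows "openin (subtopology (atlas_topology cotangent_atlas) (f ` charted A)) (f ` W)"
proof (subst openin_subopen, rule ballI)
  fix y assume "y \<in> f ` W"
  then obtain p where p: "p \<in> W" "y = f p" by blast
  have "W \<subseteq> charted A" using W by (simp add: openin_A)
  then have "p \<in> charted A" using p by blast
  then obtain U \<phi> where U: "(U, \<phi>) \<in> A" "p \<in> U" unfolding charted_iff by blast
  obtain g B l where g: "is_lift f U \<phi> g" and B: "open B" "g (\<phi> p) \<in> B" "smooth_on B l"
    and l: "\<And>q b. q \<in> charted A \<Longrightarrow> b \<in> B \<Longrightarrow> f q = cover_map b \<Longrightarrow> q \<in> U \<and> \<phi> q = l b"
    using lifts[OF U(1)] U(2) unfolding chart_recoverable_def by metis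
  have "open (\<phi> ` (W \<inter> U))" using W U by (auto simp: openin_A)
  then have "open (l -` (\<phi> ` (W \<inter> U)) \<inter> B)"
    by (rule open_vimage_Int[OF B(1) smooth_on_continuous[OF B(3)]])
  then have O: "openin (atlas_topology cotangent_atlas) (cover_map ` (l -` (\<phi> ` (W \<inter> U)) \<inter> B))"
    (is "openin _ ?O") by (simp add: openin_cotangent open_vimage_cover_map_image)
  have fp: "f p = cover_map (g (\<phi> p))" using g U by (simp add: is_lift_def)
  have "\<phi> p = l (g (\<phi> p))"
    using l[OF _ B(2) fp] p \<open>W \<subseteq> charted A\<close> by blast
  then have yO: "y \<in> ?O" unfolding \<open>y = f p\<close> fp using B p U by (intro imageI) auto
  have Of: "f q \<in> f ` W" if q: "q \<in> charted A" "f q \<in> ?O" for q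
  proof -
    obtain b where b: "f q = cover_map b" "l b \<in> \<phi> ` (W \<inter> U)" "b \<in> B" using q(2) by blast
    then have "q \<in> U" "\<phi> q \<in> \<phi> ` (W \<inter> U)" using l[OF q(1) b(3) b(1)] by auto
    then have "q \<in> W" using inj[OF U(1)] by (auto simp: inj_on_def)
    then show ?thesis by simp
  qed
  show "\<exists>T. openin (subtopology (atlas_topology cotangent_atlas) (f ` charted A)) T \<and> y \<in> T \<and> T \<subseteq> f ` W"
  proof (intro exI[of _ "f ` charted A \<inter> ?O"] conjI)
    show "openin (subtopology (atlas_topology cotangent_atlas) (f ` charted A)) (f ` charted A \<inter> ?O)"
      using O by (rule openin_subtopology_Int2)
    show "y \<in> f ` charted A \<inter> ?O" using yO p(2) \<open>p \<in> charted A\<close> by simp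
    show "f ` charted A \<inter> ?O \<subseteq> f ` W"
    proof
      fix x assume x: "x \<in> f ` charted A \<inter> ?O"
      then obtain q where q: "q \<in> charted A" "x = f q" by blast
      then have "f q \<in> ?O" using x by simp
      then show "x \<in> f ` W" using Of[OF q(1)] q(2) by simp
    qed
  qed
qed

lemma embedding_map_f: "embedding_map (atlas_topology A) (atlas_topology cotangent_atlas) f"
  unfolding embedding_map_def topspace_A
proof (rule bijective_open_imp_homeomorphic_map)
  show "continuous_map (atlas_topology A) (subtopology (atlas_topology cotangent_atlas) (f ` charted A)) f"
    using continuous_f by (simp add: continuous_map_in_subtopology topspace_A)
  show "open_map (atlas_topology A) (subtopology (atlas_topology cotangent_atlas) (f ` charted A)) f"
    using open_f_image by (simp add: open_map_def)
qed (auto simp: topspace_A inj_f topspace_cotangent)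

text \<open>As the manifold is homeomorphic to a subspace of the cotangent bundle, it inherits the
  Hausdorff property and second countability from there.\<close>

lemma smooth_manifold_A: "smooth_manifold A"
proof -
  note h = embedding_map_imp_homeomorphic_space[OF embedding_map_f]
  have "Hausdorff_space (atlas_topology A)"
    using homeomorphic_Hausdorff_space[OF h] Hausdorff_space_subtopology[OF Hausdorff_cotangent] by blast
  moreover have "second_countable (atlas_topology A)"
    using homeomorphic_space_second_countability[OF h]
      second_countable_subtopology[OF second_countable_cotangent] by blast
  ultimately show ?thesis
    unfolding smooth_manifold_def using inj open_image open_overlap smooth_transition by blast
qed

lemma smooth_map_f: "smooth_map A cotangent_atlas f"
proof -
  have "smooth_on (\<phi> ` (U \<inter> f -` V)) (\<psi> \<circ> f \<circ> inv_into U \<phi>)"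
    if U: "(U, \<phi>) \<in> A" and V: "(V, \<psi>) \<in> cotangent_atlas" for U \<phi> V \<psi>
  proof (rule smooth_on_local)
    fix a0 assume a0: "a0 \<in> \<phi> ` (U \<inter> f -` V)"
    obtain g where g: "is_lift f U \<phi> g" using lifts[OF U] by blast
    obtain N z where N: "open N" "a0 \<in> N" "N \<subseteq> \<phi> ` U"
      "\<forall>a\<in>N. (\<psi> \<circ> f \<circ> inv_into U \<phi>) a = g a - z"
      using lift_local[OF inj[OF U] open_image[OF U] g V a0] by blast
    have "smooth_on N g" using g N(3) smooth_on_subset by (auto simp: is_lift_def)
    then have "smooth_on N (\<lambda>a. g a - z)" by (intro smooth_on_intros N(1))
    then have "smooth_on N (\<psi> \<circ> f \<circ> inv_into U \<phi>)"
      by (rule smooth_on_cong[OF N(1)]) (use N(4) in simp)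
    then show "\<exists>N. open N \<and> a0 \<in> N \<and> smooth_on N (\<psi> \<circ> f \<circ> inv_into U \<phi>)"
      using N by blast
  qed
  then show ?thesis
    unfolding smooth_map_def using continuous_f by blast
qed

text \<open>By the chain rule for \<open>l (g a) = a\<close> the derivative of the lift has a left
  inverse.\<close>

lemma inj_lift_derivative:
  assumes U: "(U, \<phi>) \<in> A" and a0: "a0 \<in> \<phi> ` U"
  shows "\<exists>g. is_lift f U \<phi> g \<and> inj (frechet_derivative g (at a0))"
proof -
  obtain p0 where p0: "p0 \<in> U" "a0 = \<phi> p0" using a0 by blast
  obtain g B l where g: "is_lift f U \<phi> g" and B: "open B" "g a0 \<in> B" "smooth_on B l"
    and l: "\<And>q b. q \<in> charted A \<Longrightarrow> b \<in> B \<Longrightarrow> f q = cover_map b \<Longrightarrow> q \<in> U \<and> \<phi> q = l b"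
    using lifts[OF U] p0 unfolding chart_recoverable_def by metis
  let ?N = "g -` B \<inter> \<phi> ` U"
  have sm: "smooth_on (\<phi> ` U) g" using g by (simp add: is_lift_def)
  have "open ?N"
    by (rule open_vimage_Int[OF open_image[OF U] smooth_on_continuous[OF sm] B(1)])
  have lg: "l (g a) = a" if a: "a \<in> ?N" for a
  proof -
    obtain p where p: "p \<in> U" "a = \<phi> p" using a by blast
    then have "f p = cover_map (g a)" using g by (simp add: is_lift_def)
    moreover have "p \<in> charted A" using p charted_supset[OF U] by blast
    ultimately show ?thesis using l[of p "g a"] a p by simp
  qed
  let ?g' = "frechet_derivative g (at a0)" and ?l' = "frechet_derivative l (at (g a0))"
  have "((\<lambda>a. l (g a)) has_derivative (\<lambda>v. ?l' (?g' v))) (at a0)"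
    by (rule has_derivative_compose[OF smooth_on_has_derivative[OF sm a0]
          smooth_on_has_derivative[OF B(3,2)]])
  then have "((\<lambda>a. a) has_derivative (\<lambda>v. ?l' (?g' v))) (at a0)"
    by (rule has_derivative_transform_within_open[OF _ \<open>open ?N\<close>]) (use a0 B lg in auto)
  then have "(\<lambda>v. ?l' (?g' v)) = (\<lambda>v. v)"
    by (rule has_derivative_unique) (rule has_derivative_ident)
  then have "inj ?g'" by (metis (no_types, lifting) injI)
  then show ?thesis using g by blast
qed

lemma smooth_embedding_f:
  assumes "smooth_manifold (cotangent_atlas :: ((real^'m) \<times> 'm torus, _) chart set)"
  shows "smooth_embedding A cotangent_atlas f"
  unfolding smooth_embedding_def immersion_def
proof (intro conjI smooth_manifold_A assms smooth_map_f embedding_map_f)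
  have "inj (frechet_derivative (\<psi> \<circ> f \<circ> inv_into U \<phi>) (at x))"
    if U: "(U, \<phi>) \<in> A" and V: "(V, \<psi>) \<in> cotangent_atlas" and x: "x \<in> \<phi> ` (U \<inter> f -` V)" for U \<phi> V \<psi> x
  proof -
    have "x \<in> \<phi> ` U" using x by blast
    then obtain g where g: "is_lift f U \<phi> g" "inj (frechet_derivative g (at x))"
      using inj_lift_derivative[OF U] by blast
    then show ?thesis
      using lift_frechet_derivative[OF inj[OF U] open_image[OF U] g(1) V x] by simp
  qed
  then show "\<forall>(U, \<phi>)\<in>A. \<forall>(V, \<psi>)\<in>cotangent_atlas. \<forall>x\<in>\<phi> ` (U \<inter> f -` V).
      inj (frechet_derivative (\<psi> \<circ> f \<circ> inv_into U \<phi>) (at x))"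
    by blast
qed

lemma lagrangian_embedding_f:
  assumes "smooth_manifold (cotangent_atlas :: ((real^'m) \<times> 'm torus, _) chart set)"
    and "DIM('e) = CARD('m)"
    and isotropic: "\<And>U \<phi>. (U, \<phi>) \<in> A \<Longrightarrow> \<exists>g. is_lift f U \<phi> g \<and> (\<forall>a\<in>\<phi> ` U. \<forall>u v.
      cotangent_omega (frechet_derivative g (at a) u) (frechet_derivative g (at a) v) = 0)"
  shows "lagrangian_embedding A cotangent_atlas cotangent_omega f"
  unfolding lagrangian_embedding_def
proof (intro conjI smooth_embedding_f assms(1))
  show "2 * DIM('e) = DIM((real^'m) \<times> (real^'m))" using assms(2) by simp
  have "cotangent_omega (frechet_derivative (\<psi> \<circ> f \<circ> inv_into U \<phi>) (at x) u)
          (frechet_derivative (\<psi> \<circ> f \<circ> inv_into U \<phi>) (at x) v) = 0"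
    if U: "(U, \<phi>) \<in> A" and V: "(V, \<psi>) \<in> cotangent_atlas" and x: "x \<in> \<phi> ` (U \<inter> f -` V)"
    for U \<phi> V \<psi> x u v
  proof -
    obtain g where g: "is_lift f U \<phi> g" "\<forall>a\<in>\<phi> ` U. \<forall>u v.
      cotangent_omega (frechet_derivative g (at a) u) (frechet_derivative g (at a) v) = 0"
      using isotropic[OF U] by blast
    have "x \<in> \<phi> ` U" using x by blast
    then show ?thesis
      unfolding lift_frechet_derivative[OF inj[OF U] open_image[OF U] g(1) V x]
      using g(2) by blast
  qed
  then show "\<forall>(U, \<phi>)\<in>A. \<forall>(V, \<psi>)\<in>cotangent_atlas. \<forall>x\<in>\<phi> ` (U \<inter> f -` V). \<forall>u v.
        cotangent_omega (frechet_derivative (\<psi> \<circ> f \<circ> inv_into U \<phi>) (at x) u)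
          (frechet_derivative (\<psi> \<circ> f \<circ> inv_into U \<phi>) (at x) v) = 0"
    by blast
qed

end

text \<open>The cotangent atlas is an instance of the locale with the identity as the map: each
  chart is inverted by the covering, so the identity on its image is both the lift and the left
  inverse.\<close>

lemma smooth_manifold_cotangent:
  "smooth_manifold (cotangent_atlas :: ((real^'m) \<times> 'm::finite torus, _) chart set)"
proof -
  interpret lifted_atlas "cotangent_atlas :: ((real^'m) \<times> 'm torus, _) chart set" "\<lambda>p. p"
  proof
    fix V and \<psi> :: "(real^'m) \<times> 'm torus \<Rightarrow> (real^'m) \<times> (real^'m)"
    assume "(V, \<psi>) \<in> cotangent_atlas"
    then obtain c where V: "V = UNIV \<times> torus_proj ` ball c (pi/2)" and \<psi>: "\<psi> = cot_chart c"
      by (rule cotangent_atlas_cases)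
    have im: "\<psi> ` V = UNIV \<times> ball c (pi/2)"
      using cot_chart_image[of c UNIV] by (simp add: V \<psi>)
    show "inj_on \<psi> V" unfolding V \<psi> by (rule inj_on_cot_chart)
    show o: "open (\<psi> ` V)" by (simp add: im open_Times)
    have inv: "cover_map (\<psi> p) = p" if "p \<in> V" for p
    proof -
      obtain b where "p = cover_map b" "b \<in> UNIV \<times> ball c (pi/2)"
        using \<open>p \<in> V\<close> unfolding V cot_chart_domain by blast
      then show ?thesis unfolding \<psi> by (simp only: cot_chart_cover_map)
    qed
    have "is_lift (\<lambda>p. p) V \<psi> (\<lambda>b. b)"
      unfolding is_lift_def using inv smooth_on_ident[OF o] by simp
    moreover have "chart_recoverable (charted cotangent_atlas) (\<lambda>p. p) V \<psi> (\<psi> p)" if "p \<in> V" for p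
      unfolding chart_recoverable_def
    proof (intro exI[of _ "\<psi> ` V"] exI[of _ "\<lambda>b. b"] conjI ballI impI)
      fix q b assume b: "b \<in> \<psi> ` V" and q: "q = cover_map b"
      then show "q \<in> V" "\<psi> q = b" using inv by auto
    qed (use that o smooth_on_ident[OF o] in auto)
    ultimately show "\<exists>g. is_lift (\<lambda>p. p) V \<psi> g \<and>
        (\<forall>p\<in>V. chart_recoverable (charted cotangent_atlas) (\<lambda>p. p) V \<psi> (g (\<psi> p)))"
      by blast
  qed
  show ?thesis by (rule smooth_manifold_A)
qed

section \<open>The function on the simplex\<close>


abbreviation coord_sum :: "real^'m::finite \<Rightarrow> real" where
  "coord_sum v \<equiv> \<Sum>i\<in>UNIV. v $ i"

lemma coord_sum_scaleR: "coord_sum (c *\<^sub>R v) = c * coord_sum v"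
  by (simp add: sum_distrib_left)

lemma simplex_interior_eq:
  "simplex_interior = {y :: real^'m::finite. (\<forall>i. 0 < y $ i) \<and> coord_sum y < pi / 2}"
proof -
  let ?s = "\<lambda>x :: real^'m. (pi/2) *\<^sub>R x"
  have B: "Basis = range (\<lambda>i :: 'm. axis i (1::real))"
    by (auto simp: Basis_vec_def)
  have v: "range vertex = ?s ` insert (0 :: real^'m) Basis"
  proof
    show "range vertex \<subseteq> ?s ` insert (0 :: real^'m) Basis"
    proof
      fix p :: "real^'m" assume "p \<in> range vertex"
      then obtain k where "p = vertex k" by blast
      then show "p \<in> ?s ` insert 0 Basis" by (cases k) (auto simp: vertex_def B)
    qed
    have "0 = vertex None" "?s (axis i 1) = vertex (Some i)" for i :: 'm
      by (simp_all add: vertex_def)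
    then show "?s ` insert (0 :: real^'m) Basis \<subseteq> range vertex"
      unfolding B by auto
  qed
  have sum: "(\<Sum>i\<in>Basis. x \<bullet> i) = coord_sum x" for x :: "real^'m"
    unfolding B by (subst sum.reindex) (auto simp: inj_on_def axis_eq_axis inner_axis)
  have "simplex_interior = ?s ` interior (convex hull (insert 0 Basis) :: (real^'m) set)"
    unfolding simplex_interior_def v convex_hull_scaling
    by (rule interior_injective_linear_image) (auto intro: linear_scaleR inj_onI)
  also have "\<dots> = {y. (\<forall>i. 0 < y $ i) \<and> coord_sum y < pi / 2}"
  proof (intro equalityI subsetI)
    fix y assume "y \<in> ?s ` interior (convex hull (insert 0 Basis) :: (real^'m) set)"
    then obtain x where "y = ?s x" "\<forall>i. 0 < x $ i" "coord_sum x < 1"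
      unfolding interior_std_simplex sum by (auto simp: B inner_axis)
    then show "y \<in> {y. (\<forall>i. 0 < y $ i) \<and> coord_sum y < pi / 2}"
      by (simp add: coord_sum_scaleR del: vector_scaleR_component) simp
  next
    fix y :: "real^'m" assume y: "y \<in> {y. (\<forall>i. 0 < y $ i) \<and> coord_sum y < pi / 2}"
    let ?x = "(2/pi) *\<^sub>R y"
    have "coord_sum ?x < 1" using y by (simp add: coord_sum_scaleR field_simps del: vector_scaleR_component)
    then have "?x \<in> interior (convex hull (insert 0 Basis))"
      unfolding interior_std_simplex sum using y by (auto simp: B inner_axis)
    moreover have "y = ?s ?x" by simp
    ultimately show "y \<in> ?s ` interior (convex hull (insert 0 Basis) :: (real^'m) set)"
      by blast
  qed
  finally show ?thesis .
qed

lemma open_simplex_interior: "open simplex_interior"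
  by (simp add: simplex_interior_def)

lemma simplex_coord:
  assumes "u \<in> simplex_interior"
  shows "0 < u $ i" "u $ i \<le> coord_sum u" "u $ i < pi / 2"
proof -
  show 1: "0 < u $ i" using assms by (auto simp: simplex_interior_eq)
  have "0 \<le> u $ j" for j using assms by (auto simp: simplex_interior_eq intro: less_imp_le)
  then show "u $ i \<le> coord_sum u" by (intro member_le_sum) auto
  then show "u $ i < pi / 2" using assms by (simp add: simplex_interior_eq)
qed

lemma simplex_sum: "u \<in> simplex_interior \<Longrightarrow> coord_sum u < pi / 2"
  by (simp add: simplex_interior_eq)

lemma vertex_nth: "vertex k $ i = (if k = Some i then pi / 2 else 0)"
  by (cases k) (auto simp: vertex_def axis_def)

section \<open>The simplex and its reflection in the torus\<close>

text \<open>Twice a vertex is a lattice vector, so negation on the torus fixes every vertex and acts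
  around it as the point reflection. The negative half of the coamoeba therefore continues the cone
  of the simplex through each vertex.\<close>

lemma torus_proj_minus_vertex: "torus_proj (- vertex k - v) = torus_proj (vertex k - v)"
  unfolding torus_proj_eq_iff lattice_pt_def
  by (auto simp: vertex_nth intro: exI[of _ 1] exI[of _ 0])

lemma torus_proj_uminus_eq_iff: "torus_proj (- x) = torus_proj (- y) \<longleftrightarrow> torus_proj x = torus_proj y"
  unfolding torus_proj_eq_iff using lattice_pt_minus[of "y - x"] by (simp add: minus_diff_commute)

lemma torus_proj_simplex_eq:
  assumes "u \<in> simplex_interior" "u' \<in> simplex_interior" "torus_proj u = torus_proj u'"
  shows "u = u'"
proof -
  have "\<bar>(u' - u) $ i\<bar> < pi" for i
    using simplex_coord[OF assms(1), of i] simplex_coord[OF assms(2), of i] by simp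
  then show ?thesis
    using lattice_pt_eq_0[of "u' - u"] assms(3) by (simp add: torus_proj_eq_iff)
qed

text \<open>A single coordinate decides: those of \<open>u\<close> and \<open>u'\<close> lie
  strictly between 0 and pi/2, so their sum is no multiple of pi.\<close>

lemma torus_proj_simplex_neq_minus:
  assumes "u \<in> simplex_interior" "u' \<in> simplex_interior"
  shows "torus_proj u \<noteq> torus_proj (- u')"
proof
  fix i
  assume "torus_proj u = torus_proj (- u')"
  moreover have "\<bar>(- u' - u) $ i\<bar> < pi"
    using simplex_coord[OF assms(1), of i] simplex_coord[OF assms(2), of i] by simp
  ultimately have "(- u' - u) $ i = 0"
    unfolding torus_proj_eq_iff by (rule lattice_pt_coord_eq_0)
  then show False
    using simplex_coord[OF assms(1), of i] simplex_coord[OF assms(2), of i] by simp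
qed

lemma vertex_not_simplex: "vertex k \<notin> simplex_interior"
proof
  assume v: "vertex k \<in> simplex_interior"
  \<comment> \<open>For the origin any coordinate will do, being 0; for another vertex
    \<open>i\<close> is chosen as its axis, where the coordinate is pi/2.\<close>
  obtain i where i: "(\<exists>j. k = Some j) \<longrightarrow> k = Some i" by auto
  show False
    using simplex_coord[OF v, of i] i by (cases k) (auto simp: vertex_nth)
qed

lemma torus_proj_simplex_neq_vertex:
  assumes "u \<in> simplex_interior"
  shows "torus_proj u \<noteq> torus_proj (vertex k)" "torus_proj (- u) \<noteq> torus_proj (vertex k)"
proof -
  show *: "torus_proj u \<noteq> torus_proj (vertex k)"
  proof
    assume eq: "torus_proj u = torus_proj (vertex k)"
    have "\<bar>(vertex k - u) $ i\<bar> < pi" for i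
      using simplex_coord[OF assms(1), of i] by (auto simp: vertex_nth)
    then have "vertex k = u"
      using lattice_pt_eq_0[of "vertex k - u"] eq by (simp add: torus_proj_eq_iff)
    then show False using assms vertex_not_simplex by metis
  qed
  have "torus_proj (vertex k) = torus_proj (- vertex k)"
    using torus_proj_minus_vertex[of k 0] by simp
  then show "torus_proj (- u) \<noteq> torus_proj (vertex k)"
    using * by (simp add: torus_proj_uminus_eq_iff)
qed

lemma torus_neg_proj: "torus_neg (torus_proj y) = torus_proj (- y)"
  by (rule torus_neg.abs_eq)

lemma away_cases:
  assumes "q \<in> coamoeba - coamoeba_vertices"
  obtains u where "u \<in> simplex_interior" "q = torus_proj u"
  | u where "u \<in> simplex_interior" "q = torus_proj (- u)"
proof -
  have "torus_proj (- vertex k) \<in> coamoeba_vertices" for k :: "'a option"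
    using torus_proj_minus_vertex[of k 0] by (auto simp: coamoeba_vertices_def)
  then show thesis
    using assms that
    by (auto simp: coamoeba_def coamoeba_plus_def coamoeba_minus_def torus_neg_proj coamoeba_vertices_def)
qed

lemma away_intros:
  assumes "u \<in> simplex_interior"
  shows "torus_proj u \<in> coamoeba - coamoeba_vertices" "torus_proj (- u) \<in> coamoeba - coamoeba_vertices"
    and "torus_proj u \<in> coamoeba_plus" "torus_proj (- u) \<notin> coamoeba_plus"
proof -
  show p: "torus_proj u \<in> coamoeba_plus" using assms by (auto simp: coamoeba_plus_def)
  then have "torus_proj (- u) \<in> coamoeba_minus"
    unfolding coamoeba_minus_def torus_neg_proj[symmetric] by blast
  then show "torus_proj u \<in> coamoeba - coamoeba_vertices" "torus_proj (- u) \<in> coamoeba - coamoeba_vertices"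
    using p torus_proj_simplex_neq_vertex[OF assms] by (auto simp: coamoeba_def coamoeba_vertices_def)
  show "torus_proj (- u) \<notin> coamoeba_plus"
    using torus_proj_simplex_neq_vertex(2)[OF assms] torus_proj_simplex_neq_minus[OF _ assms]
    by (auto simp: coamoeba_plus_def) (metis+)
qed

section \<open>The root, its gradient and its Hessian\<close>

definition radicand :: "real^'m::finite \<Rightarrow> real" where
  "radicand y = cos (coord_sum y) * (\<Prod>i\<in>UNIV. sin (y $ i))"

text \<open>The root written through logarithms, which makes its smoothness and its logarithmic
  derivative immediate. It agrees with the real root where all factors are positive.\<close>

definition simplex_fun :: "real^'m::finite \<Rightarrow> real" where
  "simplex_fun y = exp ((ln (cos (coord_sum y)) + (\<Sum>i\<in>UNIV. ln (sin (y $ i)))) / CARD('m))"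

definition simplex_grad :: "real^'m::finite \<Rightarrow> real^'m" where
  "simplex_grad y = (\<chi> j. simplex_fun y / CARD('m) *
     (cos (y $ j) / sin (y $ j) - sin (coord_sum y) / cos (coord_sum y)))"

lemma simplex_sin_cos_pos:
  assumes "u \<in> simplex_interior"
  shows "0 < sin (u $ i)" "0 < cos (coord_sum u)"
proof -
  show "0 < sin (u $ i)" using simplex_coord[OF assms, of i] by (intro sin_gt_zero) auto
  have "- (pi / 2) < coord_sum u" using simplex_coord[OF assms, of i] by linarith
  then show "0 < cos (coord_sum u)" using simplex_sum[OF assms] by (rule cos_gt_zero_pi)
qed

lemma simplex_sin_cos_neq_0:
  assumes "u \<in> simplex_interior"
  shows "sin (u $ i) \<noteq> 0" "cos (coord_sum u) \<noteq> 0"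
  using simplex_sin_cos_pos[OF assms] by (auto dest: less_imp_neq[symmetric])

lemma root_eq_exp_ln: "0 < n \<Longrightarrow> 0 < x \<Longrightarrow> root n x = exp (ln x / n)"
  by (simp add: ln_root[symmetric])

lemma simplex_fun_eq_root:
  fixes u :: "real^'m::finite"
  assumes "u \<in> simplex_interior"
  shows "simplex_fun u = root CARD('m) (radicand u)"
proof -
  note p = simplex_sin_cos_pos[OF assms]
  have "0 < (\<Prod>i\<in>UNIV. sin (u $ i))" using p by (intro prod_pos) auto
  moreover have "ln (\<Prod>i\<in>UNIV. sin (u $ i)) = (\<Sum>i\<in>UNIV. ln (sin (u $ i)))"
    by (intro ln_prod) (auto simp: simplex_sin_cos_neq_0[OF assms])
  ultimately show ?thesis
    using p(2) by (simp add: root_eq_exp_ln radicand_def simplex_fun_def ln_mult_pos)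
qed

text \<open>Negation multiplies the radicand by \<open>(-1)^m\<close>. For odd \<open>m\<close> the
  root passes the sign on and the prefactor is 1; for even \<open>m\<close> the root is unchanged
  and the prefactor is -1. Either way \<open>F\<close> is odd.\<close>

lemma coamoeba_fun_simplex:
  fixes u :: "real^'m::finite"
  assumes "u \<in> simplex_interior"
  shows "coamoeba_fun (torus_proj u) = simplex_fun u"
    and "coamoeba_fun (torus_proj (- u)) = - simplex_fun u"
proof -
  have c: "cos_sum_prod_sin (torus_proj y) = radicand y" for y :: "real^'m"
    unfolding radicand_def by (rule cos_sum_prod_sin.abs_eq)
  show "coamoeba_fun (torus_proj u) = simplex_fun u"
    by (simp add: coamoeba_fun_def away_intros[OF assms] c simplex_fun_eq_root[OF assms])
  obtain n where n: "CARD('m) = Suc n" by (metis card_Suc_eq_finite finite_UNIV_card_ge_0 gr0_implies_Suc finite)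
  have "radicand (- u) = (- 1) ^ CARD('m) * radicand u"
    by (simp add: radicand_def sum_negf prod_uminus)
  then have "root (Suc n) (radicand (- u)) = (- 1) ^ Suc n * root (Suc n) (radicand u)"
    unfolding n by (cases "even n") (simp_all add: real_root_minus)
  then show "coamoeba_fun (torus_proj (- u)) = - simplex_fun u"
    unfolding coamoeba_fun_def by (simp add: away_intros[OF assms] c simplex_fun_eq_root[OF assms] n)
qed

lemma has_derivative_vec:
  fixes f :: "'a::real_normed_vector \<Rightarrow> 'i::finite \<Rightarrow> real"
  assumes "\<And>i. ((\<lambda>x. f x i) has_derivative (\<lambda>v. f' v i)) F"
  shows "((\<lambda>x. \<chi> i. f x i) has_derivative (\<lambda>v. \<chi> i. f' v i)) F"
proof -
  have "(\<chi> i. g i) = (\<Sum>i\<in>UNIV. g i *\<^sub>R axis i 1)" for g :: "'i \<Rightarrow> real"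
    by (simp add: vec_eq_iff axis_def if_distrib sum.delta cong: if_cong)
  then show ?thesis
    by (simp only:) (intro has_derivative_sum has_derivative_scaleR_left assms)
qed

lemmas has_derivative_vec_nth [derivative_intros] = bounded_linear.has_derivative[OF bounded_linear_vec_nth]

lemma simplex_fun_has_derivative:
  fixes u :: "real^'m::finite"
  assumes "u \<in> simplex_interior"
  shows "(simplex_fun has_derivative (\<lambda>v. simplex_grad u \<bullet> v)) (at u)"
proof -
  note p = simplex_sin_cos_pos[OF assms]
  let ?c = "\<lambda>j. cos (u $ j) / sin (u $ j) - sin (coord_sum u) / cos (coord_sum u)"
  have "(simplex_fun has_derivative (\<lambda>v. simplex_fun u *
     ((- sin (coord_sum u) * coord_sum v / cos (coord_sum u) +
        (\<Sum>i\<in>UNIV. cos (u $ i) * v $ i / sin (u $ i))) / CARD('m)))) (at u)"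
    unfolding simplex_fun_def
    using p by (auto intro!: derivative_eq_intros simp: less_imp_neq[symmetric] field_simps)
  moreover have "simplex_fun u *
     ((- sin (coord_sum u) * coord_sum v / cos (coord_sum u) +
        (\<Sum>i\<in>UNIV. cos (u $ i) * v $ i / sin (u $ i))) / CARD('m)) = simplex_grad u \<bullet> v" for v
  proof -
    have "simplex_grad u \<bullet> v = simplex_fun u / CARD('m) * (\<Sum>j\<in>UNIV. ?c j * v $ j)"
      by (simp add: simplex_grad_def inner_vec_def sum_distrib_left mult.assoc)
    also have "(\<Sum>j\<in>UNIV. ?c j * v $ j) = (\<Sum>i\<in>UNIV. cos (u $ i) * v $ i / sin (u $ i)) -
        sin (coord_sum u) / cos (coord_sum u) * coord_sum v"
      by (simp add: left_diff_distrib sum_subtractf sum_distrib_left)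
    finally show ?thesis by (simp add: field_simps)
  qed
  ultimately show ?thesis by simp
qed

definition simplex_hess :: "real^'m::finite \<Rightarrow> real^'m \<Rightarrow> real^'m" where
  "simplex_hess u v = (\<chi> j. (simplex_grad u \<bullet> v) / CARD('m) *
       (cos (u $ j) / sin (u $ j) - sin (coord_sum u) / cos (coord_sum u)) -
     simplex_fun u / CARD('m) * (v $ j / (sin (u $ j))\<^sup>2 + coord_sum v / (cos (coord_sum u))\<^sup>2))"

lemma simplex_grad_has_derivative:
  fixes u :: "real^'m::finite"
  assumes "u \<in> simplex_interior"
  shows "(simplex_grad has_derivative simplex_hess u) (at u)"
proof -
  note p = simplex_sin_cos_pos[OF assms]
  have 1: "((\<lambda>y. cos (y $ j) / sin (y $ j)) has_derivative (\<lambda>v. - (v $ j / (sin (u $ j))\<^sup>2))) (at u)" for j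
  proof -
    have "((\<lambda>x. cos x / sin x) has_real_derivative
        (- sin (u $ j) * sin (u $ j) - cos (u $ j) * cos (u $ j)) / (sin (u $ j) * sin (u $ j))) (at (u $ j))"
      using p(1)[of j] by (auto intro!: derivative_eq_intros)
    moreover have "- sin (u $ j) * sin (u $ j) - cos (u $ j) * cos (u $ j) = - 1"
      using sin_cos_squared_add[of "u $ j"] by (simp add: power2_eq_square)
    ultimately have "((\<lambda>x. cos x / sin x) has_real_derivative - (1 / (sin (u $ j))\<^sup>2)) (at (u $ j))"
      by (simp add: power2_eq_square)
    from DERIV_compose_FDERIV[OF this has_derivative_vec_nth[OF has_derivative_ident]]
    show ?thesis by simp
  qed
  have 2: "((\<lambda>y. sin (coord_sum y) / cos (coord_sum y)) has_derivative
      (\<lambda>v. coord_sum v / (cos (coord_sum u))\<^sup>2)) (at u)"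
  proof -
    have "((\<lambda>x. sin x / cos x) has_real_derivative (1 / (cos (coord_sum u))\<^sup>2)) (at (coord_sum u))"
      using DERIV_tan[of "coord_sum u"] p(2) by (simp add: tan_def inverse_eq_divide)
    from DERIV_compose_FDERIV[OF this has_derivative_sum[OF has_derivative_vec_nth[OF has_derivative_ident]]]
    show ?thesis by simp
  qed
  have "((\<lambda>y. simplex_fun y / CARD('m) *
        (cos (y $ j) / sin (y $ j) - sin (coord_sum y) / cos (coord_sum y))) has_derivative
      (\<lambda>v. (simplex_grad u \<bullet> v) / CARD('m) *
       (cos (u $ j) / sin (u $ j) - sin (coord_sum u) / cos (coord_sum u)) -
     simplex_fun u / CARD('m) * (v $ j / (sin (u $ j))\<^sup>2 + coord_sum v / (cos (coord_sum u))\<^sup>2))) (at u)" for j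
  proof (rule has_derivative_eq_rhs)
    show "((\<lambda>y. simplex_fun y / CARD('m) *
        (cos (y $ j) / sin (y $ j) - sin (coord_sum y) / cos (coord_sum y))) has_derivative
      (\<lambda>v. simplex_fun u / CARD('m) * (- (v $ j / (sin (u $ j))\<^sup>2) - coord_sum v / (cos (coord_sum u))\<^sup>2) +
        (simplex_grad u \<bullet> v) / CARD('m) *
          (cos (u $ j) / sin (u $ j) - sin (coord_sum u) / cos (coord_sum u)))) (at u)"
      by (intro has_derivative_mult has_derivative_diff 1 2 simplex_fun_has_derivative[OF assms]
          bounded_linear.has_derivative[OF bounded_linear_divide])
  qed (simp add: algebra_simps)
  then show ?thesis
    unfolding simplex_hess_def[abs_def]
    by (subst ext[OF simplex_grad_def]) (rule has_derivative_vec)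
qed

text \<open>Once the gradient is inserted, the first term is a multiple of a product of one linear
  form evaluated at \<open>v\<close> and at \<open>w\<close>. The second is a diagonal form plus a
  product of coordinate sums. Each is symmetric by inspection.\<close>

lemma simplex_hess_symmetric: "simplex_hess u v \<bullet> w = simplex_hess u w \<bullet> v"
proof -
  let ?c = "\<lambda>j. cos (u $ j) / sin (u $ j) - sin (coord_sum u) / cos (coord_sum u)"
  let ?m = "real CARD('a)"
  have g: "simplex_grad u \<bullet> v = simplex_fun u / ?m * (\<Sum>j\<in>UNIV. ?c j * v $ j)" for v
    by (simp add: simplex_grad_def inner_vec_def sum_distrib_left mult.assoc)
  have "simplex_hess u v \<bullet> w = (simplex_grad u \<bullet> v) / ?m * (\<Sum>j\<in>UNIV. ?c j * w $ j) -
      simplex_fun u / ?m * ((\<Sum>j\<in>UNIV. v $ j * w $ j / (sin (u $ j))\<^sup>2) +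
        coord_sum v * coord_sum w / (cos (coord_sum u))\<^sup>2)" for v w
  proof -
    have "simplex_hess u v \<bullet> w = (\<Sum>j\<in>UNIV. (simplex_grad u \<bullet> v) / ?m * (?c j * w $ j) -
      simplex_fun u / ?m * (v $ j * w $ j / (sin (u $ j))\<^sup>2 + coord_sum v / (cos (coord_sum u))\<^sup>2 * w $ j))"
      unfolding simplex_hess_def inner_vec_def
      by (rule sum.cong[OF refl]) (simp add: algebra_simps)
    also have "\<dots> = (simplex_grad u \<bullet> v) / ?m * (\<Sum>j\<in>UNIV. ?c j * w $ j) -
      simplex_fun u / ?m * ((\<Sum>j\<in>UNIV. v $ j * w $ j / (sin (u $ j))\<^sup>2) +
        coord_sum v / (cos (coord_sum u))\<^sup>2 * coord_sum w)"
      by (simp only: sum_subtractf sum.distrib sum_distrib_left[symmetric])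
    finally show ?thesis by simp
  qed
  then show ?thesis unfolding g by (simp add: mult.commute)
qed

lemma smooth_on_simplex_grad: "smooth_on simplex_interior (simplex_grad :: real^'m::finite \<Rightarrow> _)"
  unfolding simplex_grad_def[abs_def] simplex_fun_def[abs_def]
  by (intro smooth_on_intros open_simplex_interior) (auto simp: simplex_sin_cos_neq_0 simplex_sin_cos_pos)

section \<open>Coordinates around a vertex\<close>


lemma coord_sum_swap_linear:
  "coord_sum (swap_linear (Some i) v) = - (v $ i)"
  "swap_linear (Some i) v $ j = (if j = i then - coord_sum v else v $ j)"
proof -
  show nth: "swap_linear (Some i) v $ j = (if j = i then - coord_sum v else v $ j)" for j
    by (simp add: swap_linear_def)
  have "coord_sum (swap_linear (Some i) v) = - coord_sum v + (\<Sum>j\<in>UNIV - {i}. v $ j)"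
    by (simp add: sum.remove[of UNIV i] nth)
  then show "coord_sum (swap_linear (Some i) v) = - (v $ i)"
    by (simp add: sum.remove[of UNIV i "\<lambda>j. v $ j"])
qed

lemma swap_linear_None [simp]: "swap_linear None v = v"
  by (simp add: swap_linear_def)

lemma linear_swap_linear: "linear (swap_linear k)"
proof (cases k)
  case None
  then have "swap_linear k = id" by auto
  then show ?thesis by (simp add: linear_id)
next
  case (Some i)
  show ?thesis
    unfolding Some
    by (rule linearI) (auto simp: vec_eq_iff coord_sum_swap_linear sum.distrib sum_distrib_left)
qed

lemmas swap_linear_scaleR = linear_scale[OF linear_swap_linear]
  and swap_linear_0 [simp] = linear_0[OF linear_swap_linear]
  and swap_linear_minus = linear_neg[OF linear_swap_linear]

lemma swap_linear_swap_linear [simp]: "swap_linear k (swap_linear k v) = v"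
proof (cases k)
  case (Some i)
  have "swap_linear k (swap_linear k v) $ j = v $ j" for j
    unfolding Some coord_sum_swap_linear(2)[of i "swap_linear (Some i) v"] coord_sum_swap_linear(1)
    by (simp add: coord_sum_swap_linear(2))
  then show ?thesis by (simp add: vec_eq_iff)
qed simp

lemma inner_adjoint_swap_linear: "adjoint (swap_linear k) x \<bullet> y = x \<bullet> swap_linear k y"
  by (metis adjoint_works linear_swap_linear inner_commute)

text \<open>Acting by the adjoint on the fibre and by the involution on the base preserves the
  pairing, hence also the symplectic form.\<close>

lemma adjoint_swap_linear_swap_linear: "adjoint (swap_linear k) x \<bullet> swap_linear k y = x \<bullet> y"
  by (simp add: inner_adjoint_swap_linear)

lemma adjoint_swap_linear_adjoint [simp]: "adjoint (swap_linear k) (adjoint (swap_linear k) x) = x"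
  by (rule vector_eq_rdot[THEN iffD1]) (simp add: inner_adjoint_swap_linear)

lemma vertex_swap_nth:
  "(vertex (Some i) + swap_linear (Some i) v) $ j = (if j = i then pi / 2 - coord_sum v else v $ j)"
  "coord_sum (vertex (Some i) + swap_linear (Some i) v) = pi / 2 - v $ i"
proof -
  have "coord_sum (vertex (Some i)) = pi / 2" by (simp add: vertex_nth)
  then show "coord_sum (vertex (Some i) + swap_linear (Some i) v) = pi / 2 - v $ i"
    by (simp add: sum.distrib coord_sum_swap_linear(1))
qed (simp add: vertex_nth coord_sum_swap_linear(2))

lemma vertex_None [simp]: "vertex None = 0"
  by (simp add: vertex_def)

lemma vertex_swap_simplex: "vertex k + swap_linear k v \<in> simplex_interior \<longleftrightarrow> v \<in> simplex_interior"
proof (cases k)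
  case (Some i)
  have "(\<forall>j. 0 < (if j = i then pi / 2 - coord_sum v else v $ j)) \<and> pi / 2 - v $ i < pi / 2 \<longleftrightarrow>
     (\<forall>j. 0 < v $ j) \<and> coord_sum v < pi / 2"
    by (auto split: if_splits)
  then show ?thesis
    unfolding simplex_interior_eq Some mem_Collect_eq vertex_swap_nth .
qed simp

text \<open>Coordinate \<open>i\<close> becomes pi/2 minus the coordinate sum, and the coordinate
  sum becomes pi/2 minus coordinate \<open>i\<close>. The cosine of the sum and the sine of that
  coordinate thus trade places.\<close>

lemma radicand_swap: "radicand (vertex k + swap_linear k v) = radicand v"
proof (cases k)
  case (Some i)
  have "(\<Prod>j\<in>UNIV. sin (if j = i then pi / 2 - coord_sum v else v $ j)) =
      cos (coord_sum v) * (\<Prod>j\<in>UNIV - {i}. sin (v $ j))"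
    by (simp add: prod.remove[of UNIV i] sin_diff)
  moreover have "(\<Prod>j\<in>UNIV. sin (v $ j)) = sin (v $ i) * (\<Prod>j\<in>UNIV - {i}. sin (v $ j))"
    by (simp add: prod.remove[of UNIV i])
  ultimately show ?thesis
    unfolding radicand_def Some vertex_swap_nth by (simp add: cos_diff)
qed simp

lemma simplex_fun_swap:
  "v \<in> simplex_interior \<Longrightarrow> simplex_fun (vertex k + swap_linear k v) = simplex_fun v"
  by (simp add: simplex_fun_eq_root vertex_swap_simplex radicand_swap)

text \<open>Differentiate \<open>simplex_fun_swap\<close> and use that the linear part is its own
  inverse. The adjoint appears because the involution is in general not orthogonal.\<close>

lemma simplex_grad_swap:
  assumes "v \<in> simplex_interior"
  shows "simplex_grad (vertex k + swap_linear k v) = adjoint (swap_linear k) (simplex_grad v)"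
proof -
  let ?u = "vertex k + swap_linear k v"
  have "((\<lambda>v. vertex k + swap_linear k v) has_derivative swap_linear k) (at v)"
    using linear_imp_has_derivative[OF linear_swap_linear] by (auto intro!: derivative_eq_intros)
  then have "((\<lambda>v. simplex_fun (vertex k + swap_linear k v)) has_derivative
      (\<lambda>w. simplex_grad ?u \<bullet> swap_linear k w)) (at v)"
    by (rule has_derivative_compose) (rule simplex_fun_has_derivative, simp add: vertex_swap_simplex assms)
  then have "(simplex_fun has_derivative (\<lambda>w. simplex_grad ?u \<bullet> swap_linear k w)) (at v)"
    by (rule has_derivative_transform_within_open[OF _ open_simplex_interior assms]) (rule simplex_fun_swap)
  then have "(\<lambda>w. simplex_grad ?u \<bullet> swap_linear k w) = (\<lambda>w. simplex_grad v \<bullet> w)"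
    by (rule has_derivative_unique[OF _ simplex_fun_has_derivative[OF assms]])
  then have "simplex_grad ?u \<bullet> swap_linear k (swap_linear k w) = simplex_grad v \<bullet> swap_linear k w" for w
    by (rule fun_cong)
  then have "simplex_grad ?u \<bullet> w = adjoint (swap_linear k) (simplex_grad v) \<bullet> w" for w
    by (simp add: inner_adjoint_swap_linear)
  then show ?thesis by (subst vector_eq_rdot[symmetric]) simp
qed

section \<open>Points close to a vertex\<close>

text \<open>Each coordinate of the difference is below pi/2 + pi/4 < pi in absolute value, and 0 is
  the only multiple of pi in that range.\<close>

lemma small_vertex_diff:
  assumes "norm v < pi / 4" "torus_proj (vertex k + v) = torus_proj u"
    and "\<And>i. \<bar>(u - vertex k) $ i\<bar> \<le> pi / 2"
  shows "u = vertex k + v"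
proof -
  have "\<bar>(u - (vertex k + v)) $ i\<bar> < pi" for i
    using assms(3)[of i] component_le_norm_cart[of v i] assms(1)
    unfolding vector_minus_component vector_add_component by linarith
  then have "u - (vertex k + v) = 0"
    using assms(2) by (intro lattice_pt_eq_0) (simp_all add: torus_proj_eq_iff)
  then show ?thesis by simp
qed

lemma small_vertex_eq:
  assumes "norm v < pi / 4" "torus_proj (vertex k + v) = torus_proj (vertex k')"
  shows "k' = k" "v = 0"
proof -
  have eq: "vertex k' = vertex k + v"
    by (rule small_vertex_diff[OF assms]) (auto simp: vertex_nth)
  have "\<bar>v $ i\<bar> < pi / 4" for i
    using component_le_norm_cart[of v i] assms(1) by simp
  \<comment> \<open>Coordinates of vertices are 0 or pi/2, so a difference below pi/4 forces them to
    agree.\<close>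
  then have d: "\<bar>vertex k' $ i - vertex k $ i\<bar> < pi / 4" for i by (simp add: eq)
  have k: "k' = Some i \<longleftrightarrow> k = Some i" for i
    using d[of i] by (auto simp: vertex_nth split: if_splits)
  show "k' = k" by (metis k not_None_eq)
  then show "v = 0" using eq by simp
qed

lemma small_eq:
  assumes "norm v < pi / 4" "norm v' < pi / 4" "torus_proj (vertex k + v) = torus_proj (vertex k + v')"
  shows "v = v'"
proof -
  have "\<bar>(vertex k + v' - vertex k) $ i\<bar> \<le> pi / 2" for i
    using component_le_norm_cart[of v' i] assms(2) by simp
  from small_vertex_diff[OF assms(1,3) this] show ?thesis by simp
qed

lemma small_simplex_cone:
  assumes "u \<in> simplex_interior" "norm v < pi / 4" "torus_proj (vertex k + v) = torus_proj u"
  shows "\<exists>w\<in>simplex_interior. v = swap_linear k w"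
proof -
  have "\<bar>(u - vertex k) $ i\<bar> \<le> pi / 2" for i
    using simplex_coord[OF assms(1), of i] by (auto simp: vertex_nth)
  with assms(2,3) have "u = vertex k + v" by (rule small_vertex_diff)
  then have "vertex k + swap_linear k (swap_linear k v) \<in> simplex_interior" using assms(1) by simp
  then have "swap_linear k v \<in> simplex_interior" by (simp only: vertex_swap_simplex)
  then show ?thesis by (intro bexI[of _ "swap_linear k v"]) simp_all
qed

lemma small_away_cone:
  assumes "norm v < pi / 4" "torus_proj (vertex k + v) \<in> coamoeba - coamoeba_vertices"
  shows "\<exists>w\<in>simplex_interior. v = swap_linear k w \<or> v = - swap_linear k w"
  using assms(2)
proof (cases rule: away_cases)
  case (1 u)
  then show ?thesis using small_simplex_cone[OF 1(1) assms(1)] by auto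
next
  case (2 u)
  \<comment> \<open>Reflection in the vertex reduces this case to a point of the positive
    half.\<close>
  have "torus_proj (vertex k + - v) = torus_proj (- (vertex k + v))"
    using torus_proj_minus_vertex[of k v] by simp
  also have "\<dots> = torus_proj u"
    using 2(2) torus_proj_uminus_eq_iff[of "vertex k + v" "- u"] by simp
  finally obtain w where "w \<in> simplex_interior" "- v = swap_linear k w"
    using small_simplex_cone[OF 2(1), of "- v"] assms(1) by auto
  then show ?thesis by (metis minus_minus)
qed

section \<open>Blow up coordinates\<close>

lemma chart_dir_nth [simp]: "chart_dir a $ None = 1" "chart_dir a $ Some j = a $ Some j"
  by (simp_all add: chart_dir_def)

text \<open>The blow down map in coordinates at the origin; \<open>swap_linear k\<close> transports
  it to vertex \<open>k\<close>.\<close>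

definition chart_pt :: "real^('n::finite option) \<Rightarrow> real^('n option)" where
  "chart_pt a = a $ None *\<^sub>R chart_dir a"

lemma chart_pt_nth: "chart_pt a $ i = a $ None * chart_dir a $ i"
  by (simp add: chart_pt_def)

lemma coord_sum_chart_pt: "coord_sum (chart_pt a) = a $ None * coord_sum (chart_dir a)"
  by (simp only: chart_pt_def coord_sum_scaleR)

lemma chart_eqI: "a $ None = a' $ None \<Longrightarrow> chart_dir a = chart_dir a' \<Longrightarrow> a = a'"
proof -
  assume *: "a $ None = a' $ None" "chart_dir a = chart_dir a'"
  have "a $ Some j = a' $ Some j" for j
    using arg_cong[OF *(2), of "\<lambda>v. v $ Some j"] by simp
  then have "a $ i = a' $ i" for i using * by (cases i) auto
  then show ?thesis by (simp add: vec_eq_iff)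
qed

text \<open>The explicit form of \<open>chart_param_domain\<close>. For positive
  \<open>\<alpha>\<close>, the bound on the coordinate sum says that \<open>chart_pt a\<close> lies
  in the open simplex, in its negative, or at the origin.\<close>

definition over_domain :: "'n option option \<Rightarrow> (real^('n::finite option)) set" where
  "over_domain k = {a. (\<forall>j. 0 < a $ Some j) \<and> norm (swap_linear k (chart_pt a)) < pi / 4 \<and>
     \<bar>coord_sum (chart_pt a)\<bar> < pi / 2}"

definition over_pt :: "'n option option \<Rightarrow> real^('n::finite option) \<Rightarrow> 'n option blowup_point" where
  "over_pt k a = glue k (chart_param k a)"

lemma chart_param_eq:
  "chart_param k a = (torus_proj (vertex k + swap_linear k (chart_pt a)), span {swap_linear k (chart_dir a)})"
  by (simp add: chart_param_def chart_pt_def swap_linear_scaleR)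

lemma chart_dir_pos: "(\<forall>j. 0 < a $ Some j) \<Longrightarrow> 0 < chart_dir a $ i"
  by (cases i) auto

lemma over_domain_simplex:
  assumes "a \<in> over_domain k" "a $ None \<noteq> 0"
  shows "\<bar>a $ None\<bar> *\<^sub>R chart_dir a \<in> simplex_interior"
proof -
  have "0 < chart_dir a $ i" for i using assms by (intro chart_dir_pos) (simp add: over_domain_def)
  moreover have "coord_sum (\<bar>a $ None\<bar> *\<^sub>R chart_dir a) = \<bar>coord_sum (chart_pt a)\<bar>"
  proof -
    have "0 \<le> coord_sum (chart_dir a)" using \<open>\<And>i. 0 < chart_dir a $ i\<close> by (intro sum_nonneg less_imp_le)
    then show ?thesis unfolding coord_sum_chart_pt coord_sum_scaleR by (simp add: abs_mult)
  qed
  ultimately show ?thesis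
    using assms unfolding simplex_interior_eq over_domain_def by simp
qed

text \<open>For negative \<open>t\<close> the point is the vertex minus a cone vector, which modulo
  the lattice is the negative of a point on the side of the simplex.\<close>

lemma torus_proj_over:
  "torus_proj (vertex k + swap_linear k (chart_pt a)) =
    torus_proj ((if a $ None < 0 then - 1 else 1) *\<^sub>R (vertex k + swap_linear k (\<bar>a $ None\<bar> *\<^sub>R chart_dir a)))"
proof (cases "a $ None < 0")
  case True
  then have "swap_linear k (chart_pt a) = - swap_linear k (\<bar>a $ None\<bar> *\<^sub>R chart_dir a)"
    by (simp add: chart_pt_def swap_linear_scaleR swap_linear_minus)
  then show ?thesis
    using True torus_proj_minus_vertex[of k "swap_linear k (\<bar>a $ None\<bar> *\<^sub>R chart_dir a)"] by simp
qed (simp add: chart_pt_def)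

lemma over_away:
  assumes "a \<in> over_domain k" "a $ None \<noteq> 0"
  shows "torus_proj (vertex k + swap_linear k (chart_pt a)) \<in> coamoeba - coamoeba_vertices"
proof -
  let ?u = "vertex k + swap_linear k (\<bar>a $ None\<bar> *\<^sub>R chart_dir a)"
  have u: "?u \<in> simplex_interior"
    using over_domain_simplex[OF assms] by (simp only: vertex_swap_simplex)
  show ?thesis
  proof (cases "a $ None < 0")
    case True
    then have "torus_proj (vertex k + swap_linear k (chart_pt a)) = torus_proj (- ?u)"
      unfolding torus_proj_over by simp
    then show ?thesis using away_intros(2)[OF u] by simp
  next
    case False
    then have "torus_proj (vertex k + swap_linear k (chart_pt a)) = torus_proj ?u"
      unfolding torus_proj_over by simp
    then show ?thesis using away_intros(1)[OF u] by simp
  qed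
qed

lemma over_pt_eq:
  assumes "a \<in> over_domain k"
  shows "over_pt k a = (if a $ None = 0 then Over k (span {swap_linear k (chart_dir a)})
    else Away (torus_proj (vertex k + swap_linear k (chart_pt a))))"
proof (cases "a $ None = 0")
  case True
  then show ?thesis by (simp add: over_pt_def glue_def chart_param_eq chart_pt_def)
next
  case False
  then have "torus_proj (vertex k + swap_linear k (chart_pt a)) \<noteq> torus_proj (vertex k)"
    using over_away[OF assms] by (auto simp: coamoeba_vertices_def)
  then show ?thesis using False by (simp add: over_pt_def glue_def chart_param_eq)
qed

text \<open>A line determines its spanning direction because the last coordinate is normalised to
  1.\<close>

lemma span_swap_chart_dir_eqD:
  assumes "span {swap_linear k (chart_dir a)} = span {swap_linear k (chart_dir a')}"
  shows "chart_dir a = chart_dir a'"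
proof -
  have "swap_linear k (chart_dir a) \<in> span {swap_linear k (chart_dir a')}"
    using assms span_base[of "swap_linear k (chart_dir a)"] by blast
  then obtain c where "swap_linear k (chart_dir a) = c *\<^sub>R swap_linear k (chart_dir a')"
    by (auto simp: span_singleton)
  then have "swap_linear k (swap_linear k (chart_dir a)) = swap_linear k (c *\<^sub>R swap_linear k (chart_dir a'))"
    by simp
  then have eq: "chart_dir a = c *\<^sub>R chart_dir a'" by (simp add: swap_linear_scaleR)
  then have "chart_dir a $ None = (c *\<^sub>R chart_dir a') $ None" by (rule arg_cong)
  then have "c = 1" by simp
  then show ?thesis using eq by simp
qed

lemma swap_chart_pt_None: "swap_linear k (chart_pt a) = swap_linear k (chart_pt a') \<Longrightarrow> a $ None = a' $ None"
proof -
  assume "swap_linear k (chart_pt a) = swap_linear k (chart_pt a')"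
  then have "swap_linear k (swap_linear k (chart_pt a)) $ None = swap_linear k (swap_linear k (chart_pt a')) $ None"
    by (rule arg_cong)
  then show ?thesis by (simp add: chart_pt_nth)
qed

lemma chart_param_inj:
  assumes "norm (swap_linear k (chart_pt a)) < pi / 4" "norm (swap_linear k (chart_pt a')) < pi / 4"
    and "chart_param k a = chart_param k a'"
  shows "a = a'"
proof (rule chart_eqI)
  show "chart_dir a = chart_dir a'"
    using assms(3) by (intro span_swap_chart_dir_eqD[of k]) (simp add: chart_param_eq)
  show "a $ None = a' $ None"
    using assms(3) by (intro swap_chart_pt_None[of k] small_eq[OF assms(1,2), of k]) (simp add: chart_param_eq)
qed

text \<open>\<open>glue\<close> keeps the line only over the vertex. Elsewhere the line is read off
  from the point itself, whose small representative is unique by \<open>small_eq\<close>.\<close>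

lemma inj_on_over_pt: "inj_on (over_pt k) (over_domain k)"
proof (rule inj_onI)
  fix a a' assume a: "a \<in> over_domain k" "a' \<in> over_domain k" and eq: "over_pt k a = over_pt k a'"
  have n: "norm (swap_linear k (chart_pt a)) < pi / 4" "norm (swap_linear k (chart_pt a')) < pi / 4"
    using a by (simp_all add: over_domain_def)
  have 0: "a $ None = 0 \<longleftrightarrow> a' $ None = 0"
    using eq unfolding a[THEN over_pt_eq] by (simp split: if_splits)
  show "a = a'"
  proof (cases "a $ None = 0")
    case True
    then have "span {swap_linear k (chart_dir a)} = span {swap_linear k (chart_dir a')}"
      using eq 0 by (simp add: a[THEN over_pt_eq])
    then have "chart_dir a = chart_dir a'" by (rule span_swap_chart_dir_eqD)
    then show ?thesis using True 0 by (auto intro: chart_eqI)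
  next
    case False
    then have "torus_proj (vertex k + swap_linear k (chart_pt a)) = torus_proj (vertex k + swap_linear k (chart_pt a'))"
      using eq 0 by (simp add: a[THEN over_pt_eq])
    then have w: "swap_linear k (chart_pt a) = swap_linear k (chart_pt a')"
      by (rule small_eq[OF n])
    have t: "a $ None = a' $ None" by (rule swap_chart_pt_None[OF w])
    have "chart_pt a = chart_pt a'" using arg_cong[OF w, of "swap_linear k"] by simp
    then have "chart_dir a = chart_dir a'" using False t by (simp add: chart_pt_def)
    with t show ?thesis by (rule chart_eqI)
  qed
qed

lemma blowup_nbhd_eq: "blowup_nbhd k = chart_param k ` over_domain k"
proof (intro equalityI subsetI)
  fix p assume "p \<in> chart_param k ` over_domain k"
  then obtain a where a: "a \<in> over_domain k" and p: "p = chart_param k a" by blast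
  let ?q = "torus_proj (vertex k + swap_linear k (chart_pt a))" and ?l = "span {swap_linear k (chart_dir a)}"
  have "?q \<in> coamoeba"
  proof (cases "a $ None = 0")
    case True
    then show ?thesis by (auto simp: chart_pt_def coamoeba_def coamoeba_plus_def)
  next
    case False
    then show ?thesis using over_away[OF a] by blast
  qed
  moreover have "?l \<in> vertex_lines k"
  proof -
    have pos: "0 < chart_dir a $ i" for i using a by (intro chart_dir_pos) (simp add: over_domain_def)
    then have s: "0 < coord_sum (chart_dir a)" by (intro sum_pos) auto
    \<comment> \<open>This factor gives the direction the coordinate sum pi/4, safely below the
      bound pi/2 of the simplex.\<close>
    define e where "e = pi / 4 / coord_sum (chart_dir a)"
    have "0 < e" using s by (simp add: e_def)
    moreover have "coord_sum (e *\<^sub>R chart_dir a) < pi / 2"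
      unfolding coord_sum_scaleR e_def using s by simp
    ultimately have "e *\<^sub>R chart_dir a \<in> simplex_interior"
      unfolding simplex_interior_eq mem_Collect_eq using pos by simp
    then have x: "vertex k + swap_linear k (e *\<^sub>R chart_dir a) \<in> simplex_interior"
      by (simp only: vertex_swap_simplex)
    have "span {vertex k + swap_linear k (e *\<^sub>R chart_dir a) - vertex k} = ?l"
      using \<open>0 < e\<close> span_image_scale[of "{swap_linear k (chart_dir a)}" "\<lambda>_. e"]
      by (simp add: swap_linear_scaleR)
    then show ?thesis unfolding vertex_lines_def using x by blast
  qed
  moreover have "swap_linear k (chart_pt a) \<in> ?l" "norm (swap_linear k (chart_pt a)) < pi / 4"
    using a by (auto simp: over_domain_def chart_pt_def swap_linear_scaleR span_base span_scale)
  ultimately show "p \<in> blowup_nbhd k"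
    unfolding p chart_param_eq blowup_nbhd_def by blast
next
  fix p assume "p \<in> blowup_nbhd k"
  then obtain q x v where p: "p = (q, span {x - vertex k})" and q: "q \<in> coamoeba" "q = torus_proj (vertex k + v)"
    and x: "x \<in> simplex_interior" and v: "norm v < pi / 4" "v \<in> span {x - vertex k}"
    unfolding blowup_nbhd_def vertex_lines_def by blast
  obtain s where s: "v = s *\<^sub>R (x - vertex k)" using v(2) by (auto simp: span_singleton)
  define d where "d = swap_linear k (x - vertex k)"
  have "vertex k + swap_linear k d \<in> simplex_interior" using x by (simp add: d_def)
  then have d: "d \<in> simplex_interior" by (simp only: vertex_swap_simplex)
  then have pos: "0 < d $ i" for i by (rule simplex_coord)
  \<comment> \<open>The coordinates of \<open>s d\<close>: its last entry, and the quotients of the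
    entries of \<open>d\<close> by the last one, which make sense even for
    \<open>s = 0\<close>.\<close>
  define a where "a = (\<chi> i. case i of None \<Rightarrow> s * d $ None | Some j \<Rightarrow> d $ Some j / d $ None)"
  have dir: "chart_dir a = (1 / d $ None) *\<^sub>R d"
    using pos[of None] by (auto simp: vec_eq_iff chart_dir_def a_def split: option.split)
  have "a $ None = s * d $ None" by (simp add: a_def)
  then have "chart_pt a = s *\<^sub>R d"
    using pos[of None] by (simp add: chart_pt_def dir)
  then have pt: "swap_linear k (chart_pt a) = v"
    by (simp add: swap_linear_scaleR s d_def)
  have "\<bar>coord_sum (chart_pt a)\<bar> < pi / 2"
  \<comment> \<open>A nonzero \<open>v\<close> leads to a point of the coamoeba that is no vertex,
    so the cone vector is up to sign a point of the simplex, where the coordinate sum is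
    bounded.\<close>
  proof (cases "v = 0")
    case True
    then have "swap_linear k (swap_linear k (chart_pt a)) = swap_linear k 0" by (simp only: pt)
    then show ?thesis by simp
  next
    case False
    then have "q \<in> coamoeba - coamoeba_vertices"
      using q small_vertex_eq(2)[OF v(1)] by (auto simp: coamoeba_vertices_def)
    then obtain w where w: "w \<in> simplex_interior" "v = swap_linear k w \<or> v = swap_linear k (- w)"
      using small_away_cone[OF v(1), of k] q(2) by (auto simp: swap_linear_minus)
    then have "chart_pt a = w \<or> chart_pt a = - w"
      using pt by (metis swap_linear_swap_linear)
    then show ?thesis
      using simplex_sum[OF w(1)] simplex_coord[OF w(1), of None] by (auto simp: sum_negf)
  qed
  moreover have "0 < a $ Some j" for j using pos by (simp add: a_def)
  ultimately have "a \<in> over_domain k" using v(1) by (simp add: over_domain_def pt)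
  moreover have "span {swap_linear k (chart_dir a)} = span {x - vertex k}"
    using pos[of None] span_image_scale[of "{x - vertex k}" "\<lambda>_. 1 / d $ None"]
    by (simp add: dir swap_linear_scaleR d_def)
  then have "chart_param k a = p" by (simp add: chart_param_eq pt p q)
  ultimately show "p \<in> chart_param k ` over_domain k" by blast
qed

text \<open>The original domain only asks for the image to lie in the neighbourhood. Injectivity of
  \<open>chart_param\<close> on small vectors turns this into a condition on
  \<open>a\<close>.\<close>

lemma chart_param_domain_eq: "chart_param_domain k = over_domain k"
proof -
  have e: "a $ None *\<^sub>R swap_linear k (chart_dir a) = swap_linear k (chart_pt a)" for a
    by (simp add: chart_pt_def swap_linear_scaleR)
  have n: "norm (swap_linear k (chart_pt a)) < pi / 4" if "a \<in> over_domain k" for a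
    using that by (simp add: over_domain_def)
  have "a \<in> over_domain k"
    if "norm (swap_linear k (chart_pt a)) < pi / 4" "chart_param k a \<in> chart_param k ` over_domain k" for a
    using that chart_param_inj[OF that(1) n] by blast
  then show ?thesis
    unfolding chart_param_domain_def blowup_nbhd_eq e using n by (auto simp: over_domain_def)
qed

lemma smooth_on_chart_dir_nth: "open S \<Longrightarrow> smooth_on S (\<lambda>a. chart_dir a $ i)"
  by (cases i) (simp_all add: smooth_on_intros)

lemma smooth_on_chart_pt_nth: "open S \<Longrightarrow> smooth_on S (\<lambda>a. chart_pt a $ i)"
  unfolding chart_pt_nth by (intro smooth_on_intros smooth_on_chart_dir_nth)

lemma smooth_on_chart_pt: "open S \<Longrightarrow> smooth_on S chart_pt"
proof -
  assume "open S"
  then have "smooth_on S (\<lambda>a. \<chi> i. chart_pt a $ i)"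
    by (intro smooth_on_vec smooth_on_chart_pt_nth)
  then show ?thesis by simp
qed

lemma open_over_domain: "open (over_domain k)"
proof -
  have c: "continuous_on UNIV chart_pt"
    by (intro smooth_on_continuous smooth_on_chart_pt open_UNIV)
  have s: "continuous_on UNIV (\<lambda>a. swap_linear k (chart_pt a))"
    by (intro smooth_on_continuous smooth_on_linear[OF linear_swap_linear] smooth_on_chart_pt open_UNIV)
  have "over_domain k = (\<Inter>j. {a. 0 < a $ Some j}) \<inter> {a. norm (swap_linear k (chart_pt a)) < pi / 4} \<inter>
      {a. \<bar>coord_sum (chart_pt a)\<bar> < pi / 2}"
    by (auto simp: over_domain_def)
  then show ?thesis
    by (auto intro!: open_Int open_INT open_Collect_less continuous_intros c s)
qed

section \<open>The gradient in blow up coordinates\<close>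

text \<open>For nonzero \<open>t\<close> this is the value of \<open>simplex_fun\<close> at
  \<open>|t| d\<close>, divided by \<open>|t|\<close>: each of the \<open>m\<close> sines
  contributes one factor \<open>|t|\<close>, and the \<open>m\<close>-th root leaves exactly
  one.\<close>

definition model_fun :: "real^('n::finite option) \<Rightarrow> real" where
  "model_fun a = exp ((ln (cos (coord_sum (chart_pt a))) +
     (\<Sum>i\<in>UNIV. ln (chart_dir a $ i * sinc_fun (chart_pt a $ i)))) / CARD('n option))"

text \<open>The factor \<open>|t|\<close> of the function is multiplied into the bracket, where it
  removes the pole of the cotangent. At \<open>t = 0\<close> component \<open>j\<close> is
  \<open>model_fun / m\<close> divided by \<open>d_j\<close>.\<close>

definition model_grad :: "real^('n::finite option) \<Rightarrow> real^('n option)" where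
  "model_grad a = (\<chi> j. model_fun a / CARD('n option) *
     (cos (chart_pt a $ j) / (chart_dir a $ j * sinc_fun (chart_pt a $ j)) -
      a $ None * (sin (coord_sum (chart_pt a)) / cos (coord_sum (chart_pt a)))))"

lemma over_domain_pos:
  assumes "a \<in> over_domain k"
  shows "0 < chart_dir a $ i" "0 < sinc_fun (chart_pt a $ i)" "0 < cos (coord_sum (chart_pt a))"
proof -
  have pos: "0 < chart_dir a $ i" for i
    using assms by (intro chart_dir_pos) (simp add: over_domain_def)
  then show "0 < chart_dir a $ i" .
  have lt: "\<bar>coord_sum (chart_pt a)\<bar> < pi / 2" using assms by (simp add: over_domain_def)
  then show "0 < cos (coord_sum (chart_pt a))" by (intro cos_gt_zero_pi) linarith+
  have "chart_dir a $ i \<le> coord_sum (chart_dir a)"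
    using pos by (intro member_le_sum) (auto intro: less_imp_le)
  then have "\<bar>chart_pt a $ i\<bar> \<le> \<bar>coord_sum (chart_pt a)\<bar>"
    using pos[of i] unfolding coord_sum_chart_pt by (simp add: chart_pt_nth abs_mult mult_left_mono)
  then show "0 < sinc_fun (chart_pt a $ i)" using lt by (intro sinc_fun_pos) linarith
qed

lemma over_domain_neq_0:
  assumes "a \<in> over_domain k"
  shows "chart_dir a $ i \<noteq> 0" "sinc_fun (chart_pt a $ i) \<noteq> 0" "cos (coord_sum (chart_pt a)) \<noteq> 0"
  using over_domain_pos[OF assms] by (auto dest: less_imp_neq[symmetric])

lemma smooth_on_model_grad: "smooth_on (over_domain k) model_grad"
  unfolding model_grad_def[abs_def] model_fun_def[abs_def]
  by (intro smooth_on_intros smooth_on_chart_dir_nth smooth_on_chart_pt_nth open_over_domain)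
    (auto simp: over_domain_pos over_domain_neq_0)

lemma sinc_fun_abs [simp]: "sinc_fun \<bar>x\<bar> = sinc_fun x"
  by (simp add: abs_if)

text \<open>The \<open>m\<close> copies of \<open>ln |t|\<close>, divided by \<open>m\<close>, yield
  one factor \<open>|t|\<close> in front, which cancels the \<open>|t|\<close> in each sine of the
  denominators. The remaining absolute values disappear because \<open>cos\<close> and
  \<open>sinc_fun\<close> are even and \<open>t\<close> times the tangent of the coordinate sum is
  even in \<open>t\<close>.\<close>

lemma model_grad_eq:
  fixes a :: "real^('n::finite option)"
  assumes "a \<in> over_domain k" "a $ None \<noteq> 0"
  shows "model_grad a = simplex_grad (\<bar>a $ None\<bar> *\<^sub>R chart_dir a)"
proof -
  let ?s = "\<bar>a $ None\<bar>" and ?d = "chart_dir a"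
  let ?w = "?s *\<^sub>R ?d" and ?m = "real CARD('n option)"
  note p = over_domain_pos[OF assms(1)]
  have s: "0 < ?s" using assms(2) by simp
  have cs: "coord_sum ?w = \<bar>coord_sum (chart_pt a)\<bar>"
    using p(1) by (simp add: coord_sum_chart_pt coord_sum_scaleR abs_mult sum_nonneg less_imp_le del: vector_scaleR_component)
  have w: "?w $ i = \<bar>chart_pt a $ i\<bar>" for i
    using p(1)[of i] by (simp add: chart_pt_nth abs_mult)
  have sn: "sin (?w $ i) = ?s * (?d $ i * sinc_fun (chart_pt a $ i))" for i
  proof -
    have "sin (?w $ i) = ?w $ i * sinc_fun (?w $ i)" by (simp only: sinc_fun_mult)
    also have "sinc_fun (?w $ i) = sinc_fun (chart_pt a $ i)" by (simp only: w sinc_fun_abs)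
    finally show ?thesis by simp
  qed
  have "(\<Sum>i\<in>UNIV. ln (sin (?w $ i))) = (\<Sum>i\<in>UNIV. ln ?s + ln (?d $ i * sinc_fun (chart_pt a $ i)))"
    unfolding sn using s p by (intro sum.cong refl ln_mult_pos) auto
  also have "\<dots> = ?m * ln ?s + (\<Sum>i\<in>UNIV. ln (?d $ i * sinc_fun (chart_pt a $ i)))"
    by (simp add: sum.distrib)
  finally have "simplex_fun ?w = exp ((?m * ln ?s + (ln (cos (coord_sum (chart_pt a))) +
      (\<Sum>i\<in>UNIV. ln (?d $ i * sinc_fun (chart_pt a $ i))))) / ?m)"
    unfolding simplex_fun_def cs by (simp only: cos_abs_real) (simp add: algebra_simps)
  also have "\<dots> = ?s * model_fun a"
    using s by (simp add: add_divide_distrib exp_add model_fun_def)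
  finally have F: "simplex_fun ?w = ?s * model_fun a" .
  have "?s * (cos (?w $ j) / sin (?w $ j) - sin (coord_sum ?w) / cos (coord_sum ?w)) =
      cos (chart_pt a $ j) / (?d $ j * sinc_fun (chart_pt a $ j)) -
      a $ None * (sin (coord_sum (chart_pt a)) / cos (coord_sum (chart_pt a)))" for j
  proof -
    have "?s * (cos (?w $ j) / sin (?w $ j)) = cos (chart_pt a $ j) / (?d $ j * sinc_fun (chart_pt a $ j))"
      unfolding sn unfolding w using s by simp
    \<comment> \<open>Both factors change sign together with \<open>t\<close>.\<close>
    moreover have "?s * sin (coord_sum ?w) = a $ None * sin (coord_sum (chart_pt a))"
    proof (cases "0 < a $ None")
      case True
      then have "coord_sum ?w = coord_sum (chart_pt a)" by (simp add: chart_pt_def)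
      then show ?thesis using True by simp
    next
      case False
      then have "?w = - chart_pt a" using s by (simp add: chart_pt_def)
      then have "coord_sum ?w = - coord_sum (chart_pt a)" by (simp add: sum_negf)
      then show ?thesis using False by simp
    qed
    moreover have "cos (coord_sum ?w) = cos (coord_sum (chart_pt a))" by (simp only: cs cos_abs_real)
    ultimately show ?thesis by (simp only: right_diff_distrib times_divide_eq_right)
  qed
  note * = this
  show ?thesis
    unfolding simplex_grad_def model_grad_def F vec_eq_iff vec_lambda_beta
  proof
    fix j
    show "model_fun a / ?m * (cos (chart_pt a $ j) / (?d $ j * sinc_fun (chart_pt a $ j)) -
        a $ None * (sin (coord_sum (chart_pt a)) / cos (coord_sum (chart_pt a)))) =
      ?s * model_fun a / ?m * (cos (?w $ j) / sin (?w $ j) - sin (coord_sum ?w) / cos (coord_sum ?w))"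
      unfolding *[symmetric] by (simp only: mult_ac times_divide_eq_right times_divide_eq_left)
  qed
qed

text \<open>The cosine cancels against \<open>tan\<close> by the addition theorem. Dividing this identity by its
  instance for \<open>j = None\<close> recovers \<open>\<alpha>\<^sub>j\<close> from the gradient and the point of the torus, also
  where \<open>t = 0\<close>.\<close>

lemma model_grad_identity:
  fixes a :: "real^('n::finite option)"
  assumes "a \<in> over_domain k"
  shows "chart_dir a $ j * sinc_fun (chart_pt a $ j) * model_grad a $ j * cos (coord_sum (chart_pt a)) =
    model_fun a / CARD('n option) * cos (coord_sum (chart_pt a) + chart_pt a $ j)"
proof -
  note p = over_domain_neq_0[OF assms]
  let ?q = "chart_dir a $ j * sinc_fun (chart_pt a $ j)" and ?S = "coord_sum (chart_pt a)"
  have "a $ None * ?q = sin (chart_pt a $ j)"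
    unfolding sinc_fun_mult[symmetric] by (simp add: chart_pt_nth)
  moreover have "?q * (cos (chart_pt a $ j) / ?q - a $ None * (sin ?S / cos ?S)) * cos ?S =
      cos (chart_pt a $ j) * cos ?S - a $ None * ?q * sin ?S"
    using p(1,2)[of j] p(3) by (simp add: field_simps)
  ultimately have "?q * (cos (chart_pt a $ j) / ?q - a $ None * (sin ?S / cos ?S)) * cos ?S =
      cos (?S + chart_pt a $ j)"
    by (simp add: cos_add)
  from arg_cong[OF this, of "\<lambda>x. model_fun a / CARD('n option) * x"] show ?thesis
    unfolding model_grad_def vec_lambda_beta by (simp only: mult_ac)
qed

section \<open>Inverting the gradient\<close>

text \<open>In the quotient of the two identities the factors \<open>model_fun a / m\<close> and the
  cosine of the coordinate sum cancel, so only the gradient \<open>x\<close> and the point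
  \<open>w\<close> remain. At \<open>w = 0\<close> the quotient is simply
  \<open>x $ None / x $ Some j\<close>.\<close>

definition recover :: "real^('n::finite option) \<Rightarrow> real^('n option) \<Rightarrow> real^('n option)" where
  "recover x w = (\<chi> i. case i of None \<Rightarrow> w $ None | Some j \<Rightarrow>
     sinc_fun (w $ None) * x $ None * cos (coord_sum w + w $ Some j) /
     (sinc_fun (w $ Some j) * x $ Some j * cos (coord_sum w + w $ None)))"

lemma recover_model_grad:
  assumes a: "a \<in> over_domain k" and c: "\<And>i. 0 < cos (coord_sum (chart_pt a) + chart_pt a $ i)"
  shows "recover (model_grad a) (chart_pt a) = a"
proof -
  let ?S = "coord_sum (chart_pt a)" and ?w = "chart_pt a" and ?x = "model_grad a"
  note p = over_domain_neq_0[OF a] and i = model_grad_identity[OF a]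
  have R: "model_fun a / CARD('a option) \<noteq> 0" by (simp add: model_fun_def)
  have c': "cos (?S + ?w $ i) \<noteq> 0" for i using c[of i] by simp
  have x: "?x $ j \<noteq> 0" for j using i[of j] R c'[of j] by auto
  have "sinc_fun (?w $ None) * ?x $ None * cos (?S + ?w $ Some j) /
     (sinc_fun (?w $ Some j) * ?x $ Some j * cos (?S + ?w $ None)) = a $ Some j" for j
  proof -
    \<comment> \<open>Cross multiplication. The entry of \<open>chart_dir a\<close> at
      \<open>None\<close> is 1, so it may be inserted to match the left side of the identity for
      \<open>None\<close>.\<close>
    have "sinc_fun (?w $ None) * ?x $ None * cos (?S + ?w $ Some j) * (model_fun a / CARD('a option) * cos ?S) =
       (chart_dir a $ None * sinc_fun (?w $ None) * ?x $ None * cos ?S) *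
       (model_fun a / CARD('a option) * cos (?S + ?w $ Some j))" by simp
    also have "\<dots> = (model_fun a / CARD('a option) * cos (?S + ?w $ None)) *
        (chart_dir a $ Some j * sinc_fun (?w $ Some j) * ?x $ Some j * cos ?S)"
      by (simp only: i)
    also have "\<dots> = a $ Some j * (sinc_fun (?w $ Some j) * ?x $ Some j * cos (?S + ?w $ None)) *
        (model_fun a / CARD('a option) * cos ?S)" by simp
    finally have "sinc_fun (?w $ None) * ?x $ None * cos (?S + ?w $ Some j) =
        a $ Some j * (sinc_fun (?w $ Some j) * ?x $ Some j * cos (?S + ?w $ None))"
      using R p(3) by (simp only: mult_cancel_right) simp
    then show ?thesis using x[of "Some j"] p(2)[of "Some j"] c'[of None] by (simp add: divide_eq_eq)
  qed
  moreover have "?w $ None = a $ None" by (simp add: chart_pt_nth)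
  ultimately show ?thesis
    unfolding recover_def vec_eq_iff vec_lambda_beta by (auto split: option.split)
qed

lemma model_grad_pos:
  assumes a: "a \<in> over_domain k" and c: "0 < cos (coord_sum (chart_pt a) + chart_pt a $ j)"
  shows "0 < model_grad a $ j"
proof -
  note p = over_domain_pos[OF a]
  have "0 < model_fun a / CARD('a option) * cos (coord_sum (chart_pt a) + chart_pt a $ j)"
    using c by (simp add: model_fun_def)
  then have "0 < (chart_dir a $ j * sinc_fun (chart_pt a $ j) * cos (coord_sum (chart_pt a))) * model_grad a $ j"
    unfolding model_grad_identity[OF a, symmetric] by (simp only: mult_ac)
  moreover have "0 < chart_dir a $ j * sinc_fun (chart_pt a $ j) * cos (coord_sum (chart_pt a))"
    using p by simp
  ultimately show ?thesis by (simp only: zero_less_mult_pos)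
qed

section \<open>The Lagrangian embedding\<close>


lemma cotangent_omega_eq: "cotangent_omega u v = (fst u \<bullet> snd v - fst v \<bullet> snd u) / pi"
  by (simp add: cotangent_omega_def inner_vec_def sum_subtractf)

section \<open>The gradient extended to the blow up\<close>

text \<open>Both choices are unique on points of the blow up. A point and its reflection receive the
  same value, as the gradient of an odd function is even.\<close>

fun blowup_grad :: "'n::finite option blowup_point \<Rightarrow> real^('n option)" where
  "blowup_grad (Away q) =
    simplex_grad (SOME u. u \<in> simplex_interior \<and> (q = torus_proj u \<or> q = torus_proj (- u)))"
| "blowup_grad (Over k l) = adjoint (swap_linear k)
    (model_grad (SOME a. a $ None = 0 \<and> l = span {swap_linear k (chart_dir a)}))"

lemma blowup_grad_away:
  assumes "u \<in> simplex_interior" "q = torus_proj u \<or> q = torus_proj (- u)"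
  shows "blowup_grad (Away q) = simplex_grad u"
proof -
  have "(SOME u. u \<in> simplex_interior \<and> (q = torus_proj u \<or> q = torus_proj (- u))) = u"
  proof (rule some_equality)
    fix u' assume u': "u' \<in> simplex_interior \<and> (q = torus_proj u' \<or> q = torus_proj (- u'))"
    then have "torus_proj u = torus_proj u'"
      using assms torus_proj_simplex_neq_minus[of u u'] torus_proj_simplex_neq_minus[of u' u]
      by (auto simp: torus_proj_uminus_eq_iff)
    then show "u' = u" using torus_proj_simplex_eq[OF assms(1)] u' by blast
  qed (use assms in blast)
  then show ?thesis by simp
qed

lemma blowup_grad_over:
  assumes a: "a \<in> over_domain k"
  shows "blowup_grad (over_pt k a) = adjoint (swap_linear k) (model_grad a)"
proof (cases "a $ None = 0")
  case True
  have "(SOME a'. a' $ None = 0 \<and> span {swap_linear k (chart_dir a)} = span {swap_linear k (chart_dir a')}) = a"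
  proof (rule some_equality)
    fix a' :: "real^('a option)"
    assume "a' $ None = 0 \<and> span {swap_linear k (chart_dir a)} = span {swap_linear k (chart_dir a')}"
    then show "a' = a"
      using True span_swap_chart_dir_eqD[of k a a'] by (auto intro: chart_eqI)
  qed (use True in simp)
  then show ?thesis using True by (simp add: over_pt_eq[OF a])
next
  case False
  let ?w = "\<bar>a $ None\<bar> *\<^sub>R chart_dir a"
  have w: "?w \<in> simplex_interior" by (rule over_domain_simplex[OF a False])
  have "blowup_grad (Away (torus_proj (vertex k + swap_linear k (chart_pt a)))) =
      simplex_grad (vertex k + swap_linear k ?w)"
    using torus_proj_over[of k a] w
    by (intro blowup_grad_away) (auto simp: vertex_swap_simplex split: if_splits)
  then show ?thesis
    using False by (simp add: over_pt_eq[OF a] simplex_grad_swap[OF w] model_grad_eq[OF a False])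
qed

text \<open>On the negative half the function and the direction of motion both change sign, so the
  derivative is again the gradient at the point of the simplex.\<close>

lemma coamoeba_fun_derivative:
  fixes y :: "real^('n::finite option)"
  assumes "torus_proj y \<in> coamoeba - coamoeba_vertices"
  shows "((\<lambda>s. coamoeba_fun (torus_proj (y + s *\<^sub>R axis j 1))) has_real_derivative
               blowup_grad (Away (torus_proj y)) $ j) (at 0)"
proof -
  \<comment> \<open>The constant \<open>c\<close> will be 1 on the positive half and -1 on the
    negative one. Openness gives the neighbourhood of 0 on which the formula for
    \<open>coamoeba_fun\<close> may be substituted.\<close>
  have *: "((\<lambda>s. simplex_fun (u + (c * s) *\<^sub>R axis j 1)) has_real_derivative c * simplex_grad u $ j) (at 0) \<and>
      open {s. u + (c * s) *\<^sub>R axis j 1 \<in> simplex_interior}"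
    if u: "u \<in> simplex_interior" for u :: "real^('n option)" and c :: real
  proof
    have 1: "((\<lambda>s. u + (c * s) *\<^sub>R axis j 1) has_derivative (\<lambda>s. (c * s) *\<^sub>R axis j 1)) (at 0)"
      by (auto intro!: derivative_eq_intros)
    have "((\<lambda>s. simplex_fun (u + (c * s) *\<^sub>R axis j 1)) has_derivative
        (\<lambda>s. simplex_grad u \<bullet> ((c * s) *\<^sub>R axis j 1))) (at 0)"
      by (rule has_derivative_compose[OF 1]) (use simplex_fun_has_derivative[OF u] in simp)
    moreover have "(\<lambda>s. simplex_grad u \<bullet> ((c * s) *\<^sub>R axis j 1)) = (*) (c * simplex_grad u $ j)"
      by (simp add: fun_eq_iff inner_axis)
    ultimately show "((\<lambda>s. simplex_fun (u + (c * s) *\<^sub>R axis j 1)) has_real_derivative c * simplex_grad u $ j) (at 0)"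
      by (simp only: has_field_derivative_def)
    have "open ((\<lambda>s. u + (c * s) *\<^sub>R axis j 1) -` simplex_interior)"
      by (intro open_vimage open_simplex_interior continuous_intros)
    then show "open {s. u + (c * s) *\<^sub>R axis j 1 \<in> simplex_interior}" by (simp add: vimage_def)
  qed
  show ?thesis
    using assms
  proof (cases rule: away_cases)
    case (1 u)
    note u = *[OF 1(1), of 1]
    have "lattice_pt (u - y)" using 1(2) by (simp add: torus_proj_eq_iff)
    then have "torus_proj (y + s *\<^sub>R axis j 1) = torus_proj (u + s *\<^sub>R axis j 1)" for s
      by (simp add: torus_proj_eq_iff)
    moreover have "((\<lambda>s. coamoeba_fun (torus_proj (u + s *\<^sub>R axis j 1))) has_real_derivative simplex_grad u $ j) (at 0)"
      by (rule has_field_derivative_transform_within_open[of "\<lambda>s. simplex_fun (u + (1 * s) *\<^sub>R axis j 1)" _ _ "{s. u + (1 * s) *\<^sub>R axis j 1 \<in> simplex_interior}"])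
        (use u 1 in \<open>auto simp: coamoeba_fun_simplex\<close>)
    ultimately show ?thesis using blowup_grad_away[OF 1(1), of "torus_proj y"] 1(2) by simp
  next
    case (2 u)
    note u = *[OF 2(1), of "- 1"]
    have "lattice_pt (- u - y)" using 2(2) by (simp add: torus_proj_eq_iff)
    then have "torus_proj (y + s *\<^sub>R axis j 1) = torus_proj (- (u + (- 1 * s) *\<^sub>R axis j 1))" for s
      by (simp add: torus_proj_eq_iff)
    moreover have "((\<lambda>s. - simplex_fun (u + (- 1 * s) *\<^sub>R axis j 1)) has_real_derivative simplex_grad u $ j) (at 0)"
      using DERIV_minus[OF conjunct1[OF u]] by simp
    then have "((\<lambda>s. coamoeba_fun (torus_proj (- (u + (- 1 * s) *\<^sub>R axis j 1)))) has_real_derivative simplex_grad u $ j) (at 0)"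
    proof (rule has_field_derivative_transform_within_open[OF _ conjunct2[OF u]])
      show "- simplex_fun (u + (- 1 * s) *\<^sub>R axis j 1) = coamoeba_fun (torus_proj (- (u + (- 1 * s) *\<^sub>R axis j 1)))"
        if "s \<in> {s. u + (- 1 * s) *\<^sub>R axis j 1 \<in> simplex_interior}" for s
        using coamoeba_fun_simplex(2)[symmetric] that by blast
    qed (use 2 in simp)
    ultimately show ?thesis using blowup_grad_away[OF 2(1), of "torus_proj y"] 2(2) by simp
  qed
qed

text \<open>The sign and the lattice translation that carry a representative into the simplex can be
  kept fixed nearby, the simplex being open.\<close>

lemma blowup_grad_local:
  assumes "torus_proj y0 \<in> coamoeba - coamoeba_vertices"
  shows "\<exists>N s z. open N \<and> y0 \<in> N \<and> (\<forall>y\<in>N. s *\<^sub>R (y - z) \<in> simplex_interior \<and>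
    blowup_grad (Away (torus_proj y)) = simplex_grad (s *\<^sub>R (y - z)))"
proof -
  have *: "\<exists>N s z. open N \<and> y0 \<in> N \<and> (\<forall>y\<in>N. s *\<^sub>R (y - z) \<in> simplex_interior \<and>
      blowup_grad (Away (torus_proj y)) = simplex_grad (s *\<^sub>R (y - z)))"
    if u: "s *\<^sub>R (y0 - z) \<in> simplex_interior" and z: "lattice_pt z" and s: "s = 1 \<or> s = - 1" for s z
  proof (intro exI conjI ballI)
    have "open ((\<lambda>y. s *\<^sub>R (y - z)) -` simplex_interior)"
      by (intro open_vimage open_simplex_interior continuous_intros)
    then show "open {y. s *\<^sub>R (y - z) \<in> simplex_interior}" by (simp add: vimage_def)
    show "y0 \<in> {y. s *\<^sub>R (y - z) \<in> simplex_interior}" using u by simp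
    fix y assume y: "y \<in> {y. s *\<^sub>R (y - z) \<in> simplex_interior}"
    then show "s *\<^sub>R (y - z) \<in> simplex_interior" by simp
    have "torus_proj y = torus_proj (s *\<^sub>R (y - z)) \<or> torus_proj y = torus_proj (- (s *\<^sub>R (y - z)))"
      using s torus_proj_diff[OF z, of y] by auto
    then show "blowup_grad (Away (torus_proj y)) = simplex_grad (s *\<^sub>R (y - z))"
      using y by (intro blowup_grad_away) auto
  qed
  show ?thesis
    using assms
  proof (cases rule: away_cases)
    case (1 u)
    have "lattice_pt (y0 - u)" using 1(2) by (simp add: torus_proj_eq_iff[of u y0, symmetric])
    then show ?thesis using *[of 1 "y0 - u"] 1(1) by simp
  next
    case (2 u)
    have "lattice_pt (y0 + u)" using 2(2) torus_proj_eq_iff[of "- u" y0] by simp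
    then show ?thesis using *[of "- 1" "y0 + u"] 2(1) by simp
  qed
qed

section \<open>Charts of the blow up\<close>

definition blowup_map :: "'n::finite option blowup_point \<Rightarrow> (real^('n option)) \<times> 'n option torus" where
  "blowup_map p = (blowup_grad p, blowup_proj p)"

definition away_set :: "real^('n::finite option) \<Rightarrow> (real^('n option)) set" where
  "away_set c = {y \<in> ball c (pi/2). torus_proj y \<in> coamoeba - coamoeba_vertices}"

lemma open_away_set:
  fixes c :: "real^('n::finite option)"
  shows "open (away_set c)"
proof -
  have "open {y :: real^('n option). torus_proj y \<in> coamoeba - coamoeba_vertices}"
  proof (subst open_subopen, rule ballI)
    fix y0 :: "real^('n option)"
    assume "y0 \<in> {y. torus_proj y \<in> coamoeba - coamoeba_vertices}"
    then have "torus_proj y0 \<in> coamoeba - coamoeba_vertices" by simp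
    then obtain u where u: "u \<in> simplex_interior" "torus_proj y0 = torus_proj u \<or> torus_proj y0 = torus_proj (- u)"
      by (cases rule: away_cases) auto
    then obtain s :: real where s: "torus_proj y0 = torus_proj (s *\<^sub>R u)" "s = 1 \<or> s = - 1"
      by (metis scaleR_minus1_left scaleR_one)
    define z where "z = s *\<^sub>R u - y0"
    have z: "lattice_pt z" using s(1) by (simp add: torus_proj_eq_iff z_def)
    let ?T = "(\<lambda>y. s *\<^sub>R (y + z)) -` simplex_interior"
    have "open ?T"
      by (intro open_vimage open_simplex_interior continuous_intros)
    moreover have "y0 \<in> ?T" using u(1) s(2) by (auto simp: z_def)
    moreover have "torus_proj y \<in> coamoeba - coamoeba_vertices" if "y \<in> ?T" for y
    proof -
      let ?w = "s *\<^sub>R (y + z)"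
      have "torus_proj y = torus_proj ?w \<or> torus_proj y = torus_proj (- ?w)"
        using s(2) torus_proj_add[OF z, of y] by (auto simp: add.commute)
      moreover have "?w \<in> simplex_interior" using \<open>y \<in> ?T\<close> by simp
      ultimately show ?thesis using away_intros(1,2)[of ?w] by metis
    qed
    ultimately show "\<exists>T. open T \<and> y0 \<in> T \<and> T \<subseteq> {y. torus_proj y \<in> coamoeba - coamoeba_vertices}"
      by blast
  qed
  moreover have "away_set c = ball c (pi/2) \<inter> {y. torus_proj y \<in> coamoeba - coamoeba_vertices}"
    by (auto simp: away_set_def)
  ultimately show ?thesis by (simp only: open_Int open_ball)
qed

abbreviation away_dom where "away_dom c \<equiv> (\<lambda>y. Away (torus_proj y)) ` away_set c"
abbreviation away_chart where "away_chart c \<equiv> inv_into (ball c (pi/2)) torus_proj \<circ> blowup_proj"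
abbreviation over_chart where "over_chart k \<equiv> inv_into (over_domain k) (over_pt k)"

lemma blowup_atlas_eq:
  "blowup_atlas = range (\<lambda>c. (away_dom c, away_chart c)) \<union> range (\<lambda>k. (over_pt k ` over_domain k, over_chart k))"
proof -
  have 1: "Away ` (torus_proj ` ball c (pi/2) \<inter> (coamoeba - coamoeba_vertices)) = away_dom c"
    for c :: "real^('a option)"
    by (auto simp: away_set_def)
  have 2: "glue k \<circ> chart_param k = over_pt k" for k :: "'a option option"
    by (auto simp: over_pt_def)
  then have 3: "glue k ` blowup_nbhd k = over_pt k ` over_domain k" for k :: "'a option option"
    by (auto simp: blowup_nbhd_eq image_image over_pt_def)
  show ?thesis
    unfolding blowup_atlas_def torus_atlas_def chart_param_domain_eq 2 3
    by (simp add: image_image 1)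
qed

lemma blowup_atlas_cases:
  assumes "(U, \<phi>) \<in> blowup_atlas"
  obtains c where "U = away_dom c" "\<phi> = away_chart c"
  | k where "U = over_pt k ` over_domain k" "\<phi> = over_chart k"
  using assms unfolding blowup_atlas_eq by blast

lemma away_chart_Away: "y \<in> away_set c \<Longrightarrow> away_chart c (Away (torus_proj y)) = y"
  by (simp add: away_set_def inv_into_f_f[OF inj_on_torus_proj])

lemma over_chart_over_pt: "a \<in> over_domain k \<Longrightarrow> over_chart k (over_pt k a) = a"
  by (rule inv_into_f_f[OF inj_on_over_pt])

lemma param_chart:
  assumes "\<And>a. a \<in> D \<Longrightarrow> \<phi> (f a) = a"
  shows "inj_on \<phi> (f ` D)" "\<phi> ` f ` D = D"
  using assms by (auto simp: inj_on_def image_image)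

lemma blowup_point_cases:
  assumes "p \<in> charted blowup_atlas"
  obtains q where "p = Away q" "q \<in> coamoeba - coamoeba_vertices"
  | k a where "a \<in> over_domain k" "p = over_pt k a" "a $ None = 0"
proof -
  obtain U \<phi> where U: "(U, \<phi>) \<in> blowup_atlas" "p \<in> U" using assms unfolding charted_iff by blast
  from U(1) show thesis
  proof (cases rule: blowup_atlas_cases)
    case (1 c)
    then show thesis using U(2) that(1) by (auto simp: away_set_def)
  next
    case (2 k)
    then obtain a where a: "a \<in> over_domain k" "p = over_pt k a" using U(2) by blast
    show thesis
    proof (cases "a $ None = 0")
      case True
      then show thesis using that(2) a by blast
    next
      case False
      then show thesis using that(1) a(2) over_away[OF a(1) False] by (simp add: over_pt_eq[OF a(1)])
    qed
  qed
qed

section \<open>Lifts of the map and their isotropy\<close>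

definition away_lift :: "real^('n::finite option) \<Rightarrow> (real^('n option)) \<times> (real^('n option))" where
  "away_lift y = (blowup_grad (Away (torus_proj y)), y)"

lemma smooth_on_away_lift: "smooth_on (away_set c) away_lift"
proof (rule smooth_on_local)
  fix y0 assume "y0 \<in> away_set c"
  then have "torus_proj y0 \<in> coamoeba - coamoeba_vertices" by (simp add: away_set_def)
  then obtain N s z where N: "open N" "y0 \<in> N"
    "\<forall>y\<in>N. s *\<^sub>R (y - z) \<in> simplex_interior \<and> blowup_grad (Away (torus_proj y)) = simplex_grad (s *\<^sub>R (y - z))"
    using blowup_grad_local by blast
  have "smooth_on N (\<lambda>y. simplex_grad (s *\<^sub>R (y - z)))"
    by (rule smooth_on_compose[OF smooth_on_simplex_grad N(1) open_simplex_interior])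
      (use N in \<open>auto intro!: smooth_on_intros\<close>)
  then have "smooth_on N (\<lambda>y. (simplex_grad (s *\<^sub>R (y - z)), y))"
    by (intro smooth_on_intros N(1))
  then have "smooth_on N away_lift"
    by (rule smooth_on_cong[OF N(1)]) (use N(3) in \<open>simp add: away_lift_def\<close>)
  then show "\<exists>N. open N \<and> y0 \<in> N \<and> smooth_on N away_lift" using N by blast
qed

text \<open>Locally the image is the graph of \<open>simplex_grad\<close> after an affine map with
  scalar linear part \<open>s\<close>. The form evaluates to \<open>s\<close> times the
  antisymmetric part of the Hessian, up to a constant.\<close>

lemma isotropic_away_lift:
  assumes "y0 \<in> away_set c"
  shows "cotangent_omega (frechet_derivative away_lift (at y0) v) (frechet_derivative away_lift (at y0) w) = 0"
proof -
  have "torus_proj y0 \<in> coamoeba - coamoeba_vertices" using assms by (simp add: away_set_def)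
  then obtain N s z where N: "open N" "y0 \<in> N"
    "\<forall>y\<in>N. s *\<^sub>R (y - z) \<in> simplex_interior \<and> blowup_grad (Away (torus_proj y)) = simplex_grad (s *\<^sub>R (y - z))"
    using blowup_grad_local by blast
  let ?u = "s *\<^sub>R (y0 - z)"
  have 1: "((\<lambda>y. s *\<^sub>R (y - z)) has_derivative (\<lambda>v. s *\<^sub>R v)) (at y0)"
    by (auto intro!: derivative_eq_intros)
  have "((\<lambda>y. (simplex_grad (s *\<^sub>R (y - z)), y)) has_derivative (\<lambda>v. (simplex_hess ?u (s *\<^sub>R v), v))) (at y0)"
    using N by (intro has_derivative_Pair has_derivative_ident has_derivative_compose[OF 1]
        simplex_grad_has_derivative) blast
  then have "(away_lift has_derivative (\<lambda>v. (simplex_hess ?u (s *\<^sub>R v), v))) (at y0)"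
    by (rule has_derivative_transform_within_open[OF _ N(1,2)]) (use N(3) in \<open>simp add: away_lift_def\<close>)
  then have *: "frechet_derivative away_lift (at y0) = (\<lambda>v. (simplex_hess ?u (s *\<^sub>R v), v))"
    by (rule frechet_derivative_at[symmetric])
  have "simplex_hess ?u (s *\<^sub>R v) \<bullet> w = s * (simplex_hess ?u w \<bullet> v)" for v w
    by (subst simplex_hess_symmetric) simp
  then show ?thesis
    using simplex_hess_symmetric[of ?u v w] by (simp add: * cotangent_omega_eq)
qed

text \<open>Here the base point is the coordinate, so the second projection is the left inverse.
  Points over a vertex are excluded because \<open>away_set\<close> avoids the vertices.\<close>

lemma recoverable_away: 
  assumes "y0 \<in> away_set c"
  shows "chart_recoverable M blowup_map (away_dom c) (away_chart c) (away_lift y0)"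
  unfolding chart_recoverable_def
proof (intro exI conjI ballI impI)
  show o: "open (UNIV \<times> away_set c)" by (intro open_Times open_UNIV open_away_set)
  show "away_lift y0 \<in> UNIV \<times> away_set c" using assms by (simp add: away_lift_def)
  show "smooth_on (UNIV \<times> away_set c) snd"
    using smooth_on_snd[OF o smooth_on_ident[OF o]] by simp
  fix q b assume b: "b \<in> UNIV \<times> away_set c" and eq: "blowup_map q = cover_map b"
  then have y: "snd b \<in> away_set c" and p: "blowup_proj q = torus_proj (snd b)"
    by (auto simp: blowup_map_def cover_map_def split: prod.splits)
  then have "blowup_proj q \<notin> coamoeba_vertices" by (simp add: away_set_def)
  then have "q = Away (torus_proj (snd b))"
    using p by (cases q) (auto simp: coamoeba_vertices_def)
  then show "q \<in> away_dom c" "away_chart c q = snd b"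
    using y away_chart_Away[OF y] by auto
qed

definition over_lift :: "'n option option \<Rightarrow> real^('n::finite option) \<Rightarrow> (real^('n option)) \<times> (real^('n option))" where
  "over_lift k a = (adjoint (swap_linear k) (model_grad a), vertex k + swap_linear k (chart_pt a))"

lemma smooth_on_over_lift: "smooth_on (over_domain k) (over_lift k)"
  unfolding over_lift_def[abs_def]
  by (intro smooth_on_Pair smooth_on_add smooth_on_const smooth_on_chart_pt smooth_on_model_grad open_over_domain
      smooth_on_linear[OF linear_swap_linear] smooth_on_linear[OF adjoint_linear[OF linear_swap_linear]])

lemma blowup_map_over:
  assumes "a \<in> over_domain k"
  shows "blowup_map (over_pt k a) = cover_map (over_lift k a)"
  unfolding blowup_map_def over_lift_def cover_map_simp blowup_grad_over[OF assms]
  by (simp add: over_pt_eq[OF assms] chart_pt_def)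

text \<open>The gradient is a function of \<open>chart_pt a\<close> on each side of the divisor. The
  adjoint and the involution cancel in the pairing, leaving the symmetric Hessian applied to
  derivatives of \<open>chart_pt\<close>.\<close>

lemma isotropic_over_lift_away:
  fixes a0 :: "real^('n::finite option)"
  assumes a0: "a0 \<in> over_domain k" and t: "a0 $ None \<noteq> 0"
  shows "cotangent_omega (frechet_derivative (over_lift k) (at a0) v) (frechet_derivative (over_lift k) (at a0) w) = 0"
proof -
  \<comment> \<open>The sign of \<open>t\<close> is constant on \<open>T\<close>, so that
    \<open>|t| d\<close> is \<open>s\<close> times the smooth map \<open>chart_pt\<close>.\<close>
  define s where "s = sgn (a0 $ None)"
  define T :: "(real^('n option)) set" where "T = over_domain k \<inter> {a. 0 < s * a $ None}"
  have T: "open T" "a0 \<in> T"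
  proof -
    have "open {a :: real^('n option). 0 < s * a $ None}"
      by (intro open_Collect_less continuous_intros)
    then show "open T" by (simp add: T_def open_Int open_over_domain)
    show "a0 \<in> T" using a0 t by (simp add: T_def s_def sgn_real_def)
  qed
  have s: "s = 1 \<or> s = - 1" using t by (auto simp: s_def sgn_real_def)
  have m: "simplex_grad (s *\<^sub>R chart_pt a) = model_grad a" "s *\<^sub>R chart_pt a \<in> simplex_interior" if "a \<in> T" for a
  proof -
    have "a \<in> over_domain k" "a $ None \<noteq> 0" "s * a $ None = \<bar>a $ None\<bar>"
      using that s by (auto simp: T_def)
    then show "simplex_grad (s *\<^sub>R chart_pt a) = model_grad a" "s *\<^sub>R chart_pt a \<in> simplex_interior"
      using model_grad_eq[of a k] over_domain_simplex[of a k] by (simp_all add: chart_pt_def)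
  qed
  let ?D = "frechet_derivative chart_pt (at a0)" and ?H = "simplex_hess (s *\<^sub>R chart_pt a0)"
  have D: "(chart_pt has_derivative ?D) (at a0)"
    by (rule smooth_on_has_derivative[OF smooth_on_chart_pt[OF open_UNIV]]) simp
  have "((\<lambda>a. simplex_grad (s *\<^sub>R chart_pt a)) has_derivative (\<lambda>v. ?H (s *\<^sub>R ?D v))) (at a0)"
    by (rule has_derivative_compose[OF has_derivative_scaleR_right[OF D]])
      (rule simplex_grad_has_derivative[OF m(2)[OF T(2)]])
  then have "(model_grad has_derivative (\<lambda>v. ?H (s *\<^sub>R ?D v))) (at a0)"
    by (rule has_derivative_transform_within_open[OF _ T]) (rule m(1))
  note M = this
  have "bounded_linear (swap_linear k)" "bounded_linear (adjoint (swap_linear k))"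
    using linear_swap_linear adjoint_linear[OF linear_swap_linear]
    by (simp_all only: linear_conv_bounded_linear)
  then have "(over_lift k has_derivative
      (\<lambda>v. (adjoint (swap_linear k) (?H (s *\<^sub>R ?D v)), 0 + swap_linear k (?D v)))) (at a0)"
    unfolding over_lift_def[abs_def]
    by (intro has_derivative_Pair has_derivative_add has_derivative_const
        bounded_linear.has_derivative[OF _ M] bounded_linear.has_derivative[OF _ D])
  then have *: "frechet_derivative (over_lift k) (at a0) =
      (\<lambda>v. (adjoint (swap_linear k) (?H (s *\<^sub>R ?D v)), 0 + swap_linear k (?D v)))"
    by (rule frechet_derivative_at[symmetric])
  have "?H (s *\<^sub>R v) \<bullet> w = s * (?H w \<bullet> v)" for v w
    by (subst simplex_hess_symmetric) simp
  then show ?thesis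
    using simplex_hess_symmetric[of "s *\<^sub>R chart_pt a0" "?D v" "?D w"]
    by (simp add: * cotangent_omega_eq adjoint_swap_linear_swap_linear)
qed

text \<open>The form vanishes where \<open>t \<noteq> 0\<close>, hence by continuity also on the exceptional divisor.\<close>

lemma isotropic_over_lift:
  fixes a0 :: "real^('n::finite option)"
  assumes a0: "a0 \<in> over_domain k"
  shows "cotangent_omega (frechet_derivative (over_lift k) (at a0) v) (frechet_derivative (over_lift k) (at a0) w) = 0"
proof (rule ccontr)
  let ?o = "\<lambda>a. cotangent_omega (frechet_derivative (over_lift k) (at a) v) (frechet_derivative (over_lift k) (at a) w)"
  assume "?o a0 \<noteq> 0"
  have "continuous_on (over_domain k) ?o"
    unfolding cotangent_omega_eq
    by (intro continuous_intros smooth_on_continuous smooth_on_frechet_derivative smooth_on_over_lift) simp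
  then have "open (?o -` (- {0}) \<inter> over_domain k)"
    by (rule open_vimage_Int[OF open_over_domain]) auto
  then obtain e where e: "0 < e" "ball a0 e \<subseteq> ?o -` (- {0}) \<inter> over_domain k"
    using \<open>?o a0 \<noteq> 0\<close> a0 by (auto elim: openE)
  \<comment> \<open>A step of half the radius along the \<open>t\<close> axis leaves the divisor; a
    point already off it stays where it is.\<close>
  define r where "r = (if a0 $ None = 0 then e / 2 else 0)"
  let ?a = "a0 + r *\<^sub>R axis None 1"
  have "?a \<in> ball a0 e" using e(1) by (simp add: dist_norm r_def)
  then have "?a \<in> over_domain k" "?o ?a \<noteq> 0" using e(2) by blast+
  moreover have "?a $ None \<noteq> 0" using e(1) by (simp add: r_def)
  ultimately show False using isotropic_over_lift_away by blast
qed

section \<open>Left inverses on the charts around a vertex\<close>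

text \<open>The inverse of \<open>chart_pt\<close> off the hyperplane where the last coordinate
  vanishes.\<close>

definition affine_coords :: "real^('n::finite option) \<Rightarrow> real^('n option)" where
  "affine_coords w = (\<chi> i. case i of None \<Rightarrow> w $ None | Some j \<Rightarrow> w $ Some j / w $ None)"

lemma chart_pt_affine_coords: "w $ None \<noteq> 0 \<Longrightarrow> chart_pt (affine_coords w) = w"
  by (auto simp: vec_eq_iff chart_pt_def chart_dir_def affine_coords_def split: option.split)

lemma affine_coords_chart_pt: "a $ None \<noteq> 0 \<Longrightarrow> affine_coords (chart_pt a) = a"
  by (auto simp: vec_eq_iff chart_pt_nth affine_coords_def split: option.split)

lemma smooth_on_affine_coords:
  fixes S :: "(real^('n::finite option)) set"
  assumes "open S" "\<And>w. w \<in> S \<Longrightarrow> w $ None \<noteq> 0"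
  shows "smooth_on S affine_coords"
  unfolding affine_coords_def[abs_def]
proof (rule smooth_on_vec[OF \<open>open S\<close>])
  show "smooth_on S (\<lambda>w. case i of None \<Rightarrow> w $ None | Some j \<Rightarrow> w $ Some j / w $ None)" for i :: "'n option"
    using assms by (cases i) (auto intro!: smooth_on_intros)
qed

lemma over_domain_affine_coords:
  assumes "w \<in> simplex_interior" "norm (swap_linear k w) < pi / 4" "v = w \<or> v = - w"
  shows "affine_coords v \<in> over_domain k" "chart_pt (affine_coords v) = v"
proof -
  have "v $ None \<noteq> 0" using simplex_coord(1)[OF assms(1), of None] assms(3) by auto
  then show pt: "chart_pt (affine_coords v) = v" by (rule chart_pt_affine_coords)
  have "0 < affine_coords v $ Some j" for j
    using simplex_coord(1)[OF assms(1)] assms(3) by (auto simp: affine_coords_def)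
  moreover have "\<bar>coord_sum v\<bar> < pi / 2"
    using assms(3) simplex_sum[OF assms(1)] simplex_coord[OF assms(1), of None] by (auto simp: sum_negf)
  ultimately show "affine_coords v \<in> over_domain k"
    using assms(2,3) by (auto simp: over_domain_def pt swap_linear_minus)
qed

text \<open>Recoverability must account for all points of the manifold with a given image. A point
  away from the vertices lies in the double cone at \<open>k\<close> by
  \<open>small_away_cone\<close>; one over a vertex can only be over \<open>k\<close>, with
  \<open>v = 0\<close>.\<close>

lemma near_vertex:
  assumes q: "q \<in> charted blowup_atlas" and v: "norm v < pi / 4"
    and eq: "blowup_proj q = torus_proj (vertex k + v)"
  shows "\<exists>a\<in>over_domain k. q = over_pt k a \<and> v = swap_linear k (chart_pt a)"
  using q
proof (cases rule: blowup_point_cases)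
  case (1 r)
  then have r: "r = torus_proj (vertex k + v)" "r \<in> coamoeba - coamoeba_vertices" using eq by simp_all
  then obtain w where w: "w \<in> simplex_interior" "v = swap_linear k w \<or> v = - swap_linear k w"
    using small_away_cone[OF v, of k] by auto
  then have n: "norm (swap_linear k w) < pi / 4" using v by auto
  obtain w' where w': "w' = w \<or> w' = - w" "v = swap_linear k w'"
    using w(2) swap_linear_minus[of k w] by metis
  note a = over_domain_affine_coords[OF w(1) n w'(1)]
  have "w' $ None \<noteq> 0" using simplex_coord(1)[OF w(1), of None] w'(1) by auto
  then have "q = over_pt k (affine_coords w')"
    unfolding over_pt_eq[OF a(1)] using 1(1) r(1) a(2) w'(2) by (simp add: affine_coords_def)
  then show ?thesis using a w'(2) by auto
next
  case (2 k' a)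
  then have "torus_proj (vertex k + v) = torus_proj (vertex k')"
    using eq by (simp add: over_pt_eq[OF 2(1)])
  then have "k' = k" "v = 0" using small_vertex_eq[OF v] by auto
  then show ?thesis using 2 by (intro bexI[of _ a]) (auto simp: chart_pt_def)
qed

lemma smooth_on_vertex_swap:
  fixes S :: "((real^('n::finite)) \<times> (real^'n)) set"
  shows "open S \<Longrightarrow> smooth_on S (\<lambda>b. swap_linear k (snd b - vertex k))"
  by (intro smooth_on_linear[OF linear_swap_linear] smooth_on_intros)

text \<open>Off the divisor the base point determines the coordinates through
  \<open>affine_coords\<close>.\<close>

lemma recoverable_over_away:
  fixes a0 :: "real^('n::finite option)"
  assumes a0: "a0 \<in> over_domain k" and t: "a0 $ None \<noteq> 0"
  shows "chart_recoverable M blowup_map (over_pt k ` over_domain k) (over_chart k) (over_lift k a0)"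
  unfolding chart_recoverable_def
proof -
  let ?w = "\<lambda>b :: (real^('n option)) \<times> (real^('n option)). swap_linear k (snd b - vertex k)"
  define W :: "(real^('n option)) set" where "W = {w. w $ None \<noteq> 0}"
  have W: "open W" unfolding W_def by (intro open_Collect_neq continuous_intros)
  have sm: "smooth_on W affine_coords" using W by (rule smooth_on_affine_coords) (simp add: W_def)
  define B where "B = ?w -` (affine_coords -` over_domain k \<inter> W)"
  have "open B"
    unfolding B_def
    by (rule open_vimage[OF _ smooth_on_continuous[OF smooth_on_vertex_swap[OF open_UNIV]]]) (rule open_vimage_Int[OF W smooth_on_continuous[OF sm] open_over_domain])
  moreover have "over_lift k a0 \<in> B"
    using a0 t by (simp add: B_def over_lift_def affine_coords_chart_pt W_def chart_pt_nth)
  moreover have "smooth_on B (\<lambda>b. affine_coords (?w b))"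
    by (rule smooth_on_compose[OF sm \<open>open B\<close> W smooth_on_vertex_swap[OF \<open>open B\<close>]]) (simp add: B_def)
  moreover have "q \<in> over_pt k ` over_domain k \<and> over_chart k q = affine_coords (?w b)"
    if b: "b \<in> B" and eq: "blowup_map q = cover_map b" for q b
  proof -
    let ?a = "affine_coords (?w b)"
    have a: "?a \<in> over_domain k" and w: "?w b $ None \<noteq> 0" using b by (simp_all add: B_def W_def)
    have "blowup_proj q = torus_proj (snd b)"
      using eq by (auto simp: blowup_map_def cover_map_def split: prod.splits)
    then have p: "blowup_proj q = torus_proj (vertex k + swap_linear k (chart_pt ?a))"
      unfolding chart_pt_affine_coords[OF w] by simp
    have N: "?a $ None \<noteq> 0" using w by (simp add: affine_coords_def)
    have "blowup_proj q \<notin> coamoeba_vertices"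
      unfolding p using over_away[OF a N] by blast
    then have "q = Away (torus_proj (vertex k + swap_linear k (chart_pt ?a)))"
      using p by (cases q) (auto simp: coamoeba_vertices_def)
    also have "\<dots> = over_pt k ?a" unfolding over_pt_eq[OF a] using N by simp
    finally show ?thesis using a over_chart_over_pt[OF a] by simp
  qed
  ultimately show "\<exists>B l. open B \<and> over_lift k a0 \<in> B \<and> smooth_on B l \<and>
     (\<forall>q\<in>M. \<forall>b\<in>B. blowup_map q = cover_map b \<longrightarrow> q \<in> over_pt k ` over_domain k \<and> over_chart k q = l b)"
    by (intro exI[of _ B] exI[of _ "\<lambda>b. affine_coords (?w b)"]) blast
qed

text \<open>An open set where the denominators of \<open>recover\<close> do not vanish: the bound pi
  keeps \<open>sinc_fun\<close> positive, and the condition on the cosines is the hypothesis under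
  which \<open>recover\<close> inverts the gradient.\<close>

definition recover_domain :: "((real^('n::finite option)) \<times> (real^('n option))) set" where
  "recover_domain = (\<Inter>i. {b. 0 < fst b $ i} \<inter> {b. \<bar>snd b $ i\<bar> < pi} \<inter> {b. 0 < cos (coord_sum (snd b) + snd b $ i)})"

lemma open_recover_domain: "open recover_domain"
  unfolding recover_domain_def
  by (intro open_INT open_Int ballI finite_UNIV open_Collect_less continuous_intros) auto

lemma smooth_on_recover:
  "smooth_on (recover_domain :: ((real^('n::finite option)) \<times> (real^('n option))) set) (\<lambda>b. recover (fst b) (snd b))"
  unfolding recover_def
proof (rule smooth_on_vec[OF open_recover_domain])
  let ?R = "recover_domain :: ((real^('n::finite option)) \<times> (real^('n option))) set"
  have nz: "sinc_fun (snd b $ i) \<noteq> 0" "fst b $ i \<noteq> 0" "cos (coord_sum (snd b) + snd b $ i) \<noteq> 0"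
    if "b \<in> ?R" for b i
    using that sinc_fun_pos[of "snd b $ i"] by (auto simp: recover_domain_def) (metis less_irrefl)+
  show "smooth_on ?R (\<lambda>b. case i of None \<Rightarrow> snd b $ None | Some j \<Rightarrow>
     sinc_fun (snd b $ None) * fst b $ None * cos (coord_sum (snd b) + snd b $ Some j) /
     (sinc_fun (snd b $ Some j) * fst b $ Some j * cos (coord_sum (snd b) + snd b $ None)))" for i :: "'n option"
  proof (cases i)
    case None
    then show ?thesis by (simp only: option.case) (intro smooth_on_intros open_recover_domain)
  next
    case (Some j)
    show ?thesis
      unfolding Some option.case
      by (intro smooth_on_intros open_recover_domain) (simp add: nz del: split_paired_All)
  qed
qed

text \<open>The divisor has a single base point, so the left inverse combines gradient and base
  point through \<open>recover\<close>, after the involution has moved the vertex to the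
  origin.\<close>

lemma recoverable_over_divisor:
  fixes a0 :: "real^('n::finite option)"
  assumes a0: "a0 \<in> over_domain k" and t: "a0 $ None = 0"
  shows "chart_recoverable (charted blowup_atlas) blowup_map (over_pt k ` over_domain k) (over_chart k) (over_lift k a0)"
  unfolding chart_recoverable_def
proof -
  let ?R = "recover_domain :: ((real^('n::finite option)) \<times> (real^('n option))) set"
  let ?f = "\<lambda>b :: (real^('n option)) \<times> (real^('n option)).
    (adjoint (swap_linear k) (fst b), swap_linear k (snd b - vertex k))"
  let ?r = "\<lambda>b :: (real^('n option)) \<times> (real^('n option)). recover (fst b) (snd b)"
  have lin: "linear (adjoint (swap_linear k) :: real^('n option) \<Rightarrow> _)"
    by (rule adjoint_linear[OF linear_swap_linear])
  have smf: "smooth_on S ?f" if "open S" for S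
    using that by (intro smooth_on_Pair smooth_on_linear[OF lin] smooth_on_vertex_swap smooth_on_intros)
  \<comment> \<open>The bound pi/4 is there so that \<open>near_vertex\<close> puts every point with
    image in \<open>cover_map\<close> of \<open>B\<close> into the chart at
    \<open>k\<close>.\<close>
  define B where "B = ?f -` (?r -` over_domain k \<inter> ?R) \<inter> {b. norm (snd b - vertex k) < pi / 4}"
  have "open (?r -` over_domain k \<inter> ?R)"
    by (rule open_vimage_Int[OF open_recover_domain smooth_on_continuous[OF smooth_on_recover] open_over_domain])
  then have "open (?f -` (?r -` over_domain k \<inter> ?R))"
    by (rule open_vimage) (rule smooth_on_continuous[OF smf[OF open_UNIV]])
  moreover have "open {b :: (real^('n option)) \<times> (real^('n option)). norm (snd b - vertex k) < pi / 4}"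
    by (intro open_Collect_less continuous_intros)
  ultimately have "open B" unfolding B_def by (rule open_Int)
  moreover have "over_lift k a0 \<in> B"
  proof -
    \<comment> \<open>Over the vertex all cosines equal 1, so the gradient is positive and can be
      inverted.\<close>
    have pt: "chart_pt a0 = 0" using t by (simp add: chart_pt_def)
    have "(model_grad a0, 0) \<in> ?R"
      using model_grad_pos[OF a0] by (simp add: recover_domain_def pt)
    moreover have "recover (model_grad a0) 0 = a0"
      using recover_model_grad[OF a0] by (simp add: pt)
    ultimately show ?thesis using a0 by (simp add: B_def over_lift_def pt)
  qed
  moreover have "smooth_on B (\<lambda>b. ?r (?f b))"
    by (rule smooth_on_compose[OF smooth_on_recover \<open>open B\<close> open_recover_domain smf[OF \<open>open B\<close>]])
      (simp add: B_def)
  moreover have "q \<in> over_pt k ` over_domain k \<and> over_chart k q = ?r (?f b)"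
    if q: "q \<in> charted blowup_atlas" and b: "b \<in> B" and eq: "blowup_map q = cover_map b" for q b
  proof -
    have p: "blowup_grad q = fst b" "blowup_proj q = torus_proj (snd b)"
      using eq by (auto simp: blowup_map_def cover_map_def split: prod.splits)
    have "norm (snd b - vertex k) < pi / 4" using b by (simp add: B_def)
    moreover have "blowup_proj q = torus_proj (vertex k + (snd b - vertex k))" using p(2) by simp
    ultimately obtain a where a: "a \<in> over_domain k" "q = over_pt k a"
      and v: "snd b - vertex k = swap_linear k (chart_pt a)"
      using near_vertex[OF q] by blast
    have w: "swap_linear k (snd b - vertex k) = chart_pt a" by (simp add: v)
    have x: "adjoint (swap_linear k) (fst b) = model_grad a"
      using p(1) blowup_grad_over[OF a(1)] a(2) by (metis adjoint_swap_linear_adjoint)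
    have "(model_grad a, chart_pt a) \<in> ?R" using b by (simp add: B_def w x)
    then have "recover (model_grad a) (chart_pt a) = a"
      by (intro recover_model_grad[OF a(1)]) (simp add: recover_domain_def)
    then show ?thesis using a over_chart_over_pt[OF a(1)] by (simp add: w x)
  qed
  ultimately show "\<exists>B l. open B \<and> over_lift k a0 \<in> B \<and> smooth_on B l \<and>
     (\<forall>q\<in>charted blowup_atlas. \<forall>b\<in>B. blowup_map q = cover_map b \<longrightarrow>
       q \<in> over_pt k ` over_domain k \<and> over_chart k q = l b)"
    by (intro exI[of _ B] exI[of _ "\<lambda>b. ?r (?f b)"]) blast
qed

section \<open>Assembly of the charts and conclusion\<close>

lemma away_domain:
  "inj_on (away_chart c) (away_dom c)" "away_chart c ` away_dom c = away_set c"
  by (rule param_chart, erule away_chart_Away)+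

lemma over_chart_domain:
  "inj_on (over_chart k) (over_pt k ` over_domain k)"
  "over_chart k ` over_pt k ` over_domain k = over_domain k"
  by (rule param_chart, erule over_chart_over_pt)+

lemma is_lift_away: "is_lift blowup_map (away_dom c) (away_chart c) away_lift"
  unfolding is_lift_def away_domain
proof (intro conjI ballI smooth_on_away_lift)
  fix p assume "p \<in> away_dom c"
  then obtain y where "y \<in> away_set c" "p = Away (torus_proj y)" by blast
  then show "blowup_map p = cover_map (away_lift (away_chart c p))"
    by (simp only: away_chart_Away) (simp add: blowup_map_def away_lift_def)
qed

lemma is_lift_over: "is_lift blowup_map (over_pt k ` over_domain k) (over_chart k) (over_lift k)"
  unfolding is_lift_def over_chart_domain
proof (intro conjI ballI smooth_on_over_lift)
  fix p assume "p \<in> over_pt k ` over_domain k"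
  then obtain a where "a \<in> over_domain k" "p = over_pt k a" by blast
  then show "blowup_map p = cover_map (over_lift k (over_chart k p))"
    by (simp only: over_chart_over_pt blowup_map_over)
qed

interpretation blowup: lifted_atlas "blowup_atlas :: ('n::finite option blowup_point, _) chart set" blowup_map
proof
  fix U and \<phi> :: "'n option blowup_point \<Rightarrow> real^('n option)"
  assume U: "(U, \<phi>) \<in> blowup_atlas"
  show "inj_on \<phi> U"
    using U by (cases rule: blowup_atlas_cases) (simp_all only: away_domain over_chart_domain)
  show "open (\<phi> ` U)"
    using U by (cases rule: blowup_atlas_cases)
      (simp_all only: away_domain over_chart_domain open_away_set open_over_domain)
  show "\<exists>g. is_lift blowup_map U \<phi> g \<and>
      (\<forall>p\<in>U. chart_recoverable (charted blowup_atlas) blowup_map U \<phi> (g (\<phi> p)))"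
    using U
  proof (cases rule: blowup_atlas_cases)
    case (1 c)
    have "chart_recoverable (charted blowup_atlas) blowup_map U \<phi> (away_lift (\<phi> p))" if "p \<in> U" for p
    proof -
      have "\<phi> p \<in> away_set c" using that 1 away_domain(2)[of c] by blast
      then show ?thesis unfolding 1 by (rule recoverable_away)
    qed
    then show ?thesis using is_lift_away unfolding 1 by blast
  next
    case (2 k)
    have "chart_recoverable (charted blowup_atlas) blowup_map U \<phi> (over_lift k (\<phi> p))" if "p \<in> U" for p
    proof -
      have "\<phi> p \<in> over_domain k" using that 2 over_chart_domain(2)[of k] by blast
      then show ?thesis
        unfolding 2 using recoverable_over_away recoverable_over_divisor by blast
    qed
    then show ?thesis using is_lift_over unfolding 2 by blast
  qed
qed

text \<open>The covering leaves the fibre component alone, so in each chart the gradient is the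
  first component of the lift.\<close>

lemma smooth_map_blowup_grad:
  "smooth_map (blowup_atlas :: ('n::finite option blowup_point, _) chart set) euclidean_atlas blowup_grad"
proof -
  have lift: "\<exists>g. smooth_on (\<phi> ` U) g \<and> (\<forall>p\<in>U. blowup_grad p = g (\<phi> p))"
    if U: "(U, \<phi>) \<in> blowup_atlas" for U and \<phi> :: "'n option blowup_point \<Rightarrow> real^('n option)"
  proof -
    obtain g where g: "smooth_on (\<phi> ` U) g" "\<forall>p\<in>U. blowup_map p = cover_map (g (\<phi> p))"
      using blowup.lifts[OF U] unfolding is_lift_def by blast
    have "smooth_on (\<phi> ` U) (\<lambda>a. fst (g a))" using smooth_on_fst[OF blowup.open_image[OF U] g(1)] .
    moreover have "blowup_grad p = fst (g (\<phi> p))" if "p \<in> U" for p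
      using g(2)[rule_format, OF that] by (auto simp: blowup_map_def cover_map_def split: prod.splits)
    ultimately show ?thesis by (intro exI[of _ "\<lambda>a. fst (g a)"]) blast
  qed
  have "continuous_map (atlas_topology blowup_atlas) euclidean (blowup_grad :: 'n option blowup_point \<Rightarrow> _)"
  proof (rule blowup.continuous_map_A[where k = "\<lambda>x. x"])
    fix U and \<phi> :: "'n option blowup_point \<Rightarrow> real^('n option)"
    assume "(U, \<phi>) \<in> blowup_atlas"
    then show "\<exists>g. continuous_on (\<phi> ` U) g \<and> (\<forall>p\<in>U. blowup_grad p = g (\<phi> p))"
      using lift smooth_on_continuous by blast
  qed auto
  moreover have "smooth_on (\<phi> ` U) (blowup_grad \<circ> inv_into U \<phi>)"
    if U: "(U, \<phi>) \<in> blowup_atlas" for U and \<phi> :: "'n option blowup_point \<Rightarrow> real^('n option)"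
  proof -
    obtain g where g: "smooth_on (\<phi> ` U) g" "\<forall>p\<in>U. blowup_grad p = g (\<phi> p)" using lift[OF U] by blast
    show ?thesis
      by (rule smooth_on_cong[OF blowup.open_image[OF U] g(1)])
        (use g(2) in \<open>auto simp: inv_into_f_f[OF blowup.inj[OF U]]\<close>)
  qed
  ultimately show ?thesis
    unfolding smooth_map_def atlas_topology_euclidean by (auto simp: euclidean_atlas_def)
qed

lemma lagrangian_embedding_blowup_map:
  "lagrangian_embedding (blowup_atlas :: ('n::finite option blowup_point, _) chart set) cotangent_atlas cotangent_omega blowup_map"
proof (rule blowup.lagrangian_embedding_f[OF smooth_manifold_cotangent])
  fix U and \<phi> :: "'n option blowup_point \<Rightarrow> real^('n option)"
  assume U: "(U, \<phi>) \<in> blowup_atlas"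
  then show "\<exists>g. is_lift blowup_map U \<phi> g \<and> (\<forall>a\<in>\<phi> ` U. \<forall>u v.
      cotangent_omega (frechet_derivative g (at a) u) (frechet_derivative g (at a) v) = 0)"
  proof (cases rule: blowup_atlas_cases)
    case (1 c)
    show ?thesis
      unfolding 1 away_domain using is_lift_away isotropic_away_lift by blast
  next
    case (2 k)
    show ?thesis
      unfolding 2 over_chart_domain using is_lift_over isotropic_over_lift by blast
  qed
qed simp

text \<open>The first conjunct makes \<open>h\<close> an extension of the partial derivatives, which
  are taken along coordinate lines in the universal covering. As \<open>'n\<close> is nonempty,
  \<open>'n option\<close> has at least two elements, in accordance with
  \<open>n \<ge> 1\<close>.\<close>

theorem lemma3p5:
  shows "\<exists>h :: ('n::finite) option blowup_point \<Rightarrow> real^('n option).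
    (\<forall>y. torus_proj y \<in> coamoeba - coamoeba_vertices \<longrightarrow>
       (\<forall>j. ((\<lambda>s. coamoeba_fun (torus_proj (y + s *\<^sub>R axis j 1))) has_real_derivative
               h (Away (torus_proj y)) $ j) (at 0))) \<and>
    smooth_map blowup_atlas euclidean_atlas h \<and>
    lagrangian_embedding blowup_atlas cotangent_atlas cotangent_omega (\<lambda>q. (h q, blowup_proj q))"
proof (intro exI[of _ blowup_grad] conjI allI impI)
  show "smooth_map blowup_atlas euclidean_atlas (blowup_grad :: 'n option blowup_point \<Rightarrow> _)"
    by (rule smooth_map_blowup_grad)
  show "lagrangian_embedding blowup_atlas cotangent_atlas cotangent_omega
      (\<lambda>q :: 'n option blowup_point. (blowup_grad q, blowup_proj q))"
    using lagrangian_embedding_blowup_map by (simp add: blowup_map_def[abs_def])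
qed (rule coamoeba_fun_derivative)

end
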